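(* Let $a<b$, $K\ge2$, $\mathcal{I}=\{1,\dots,K\}$, $\mathscr{D}\subseteq D_{cdf}([a,b])$ nonempty and convex, $\mathsf{T}:D_{cdf}([a,b])\to\mathbb{R}$ with $|\mathsf{T}(F)-\mathsf{T}(G)|\le C\|F-G\|_\infty$ for all $F\in\mathscr{D}$, $G\in D_{cdf}([a,b])$ and some $C>0$, and assume for every $m\in\mathbb{N}$, $\delta\in\mathscr{S}_m$ the map $x\mapsto\mathsf{T}(\sum_{j=1}^m\delta_j\mathbf{1}\{x_j\le\cdot\})$ on $[a,b]^m$ is Borel measurable. Let $\{A_1,\dots,A_m\}$ ($2\le m\le K$) be a partition of $\mathcal{I}$ and $\mathscr{M}_K=\bigcup_{j=1}^m\mathscr{M}_{A_j,K}$ with $\emptyset\ne\mathscr{M}_{A_j,K}\subseteq\mathscr{S}_{A_j,K}$, $\mathscr{M}_K$ closed with at least two elements. Let $n>K$, and consider the sequential elimination policy $\tilde\pi$ with a finite discretization $\mathscr{M}_K^n=\bigcup_j\mathscr{M}^n_{A_j,K}$, $\emptyset\ne\mathscr{M}^n_{A_j,K}\subseteq\mathscr{M}_{A_j,K}$, elimination rounds $\mathcal{R}\subseteq\{1,\dots,\lfloor n/2\rfloor\}$ with $\underline r:=\min\mathcal{R}\le\lfloor n/K\rfloor$, and $\eta>0$. Then $$\sup_{F^1,\dots,F^K\in\mathscr{D}}\mathbb{E}[r_n(\tilde\pi,\mathscr{M}_K)]\le\varepsilon(n)+C\big(2\min(A_{n,K},B_{n,K})+C_{n,K}\big),$$ where,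 with $f_{n,K}(u)=\frac12+\frac un-\frac{uK}{2n}+\frac1n$, $$A_{n,K}=\frac{1+e}{\sqrt2\,e(1-K/n)}\sqrt{\log\big(K[1+(1+\sqrt{8\pi})\sqrt{2\pi}]\big)}\sqrt{f_{n,K}(\underline r)}\frac{K}{\sqrt n}\le\frac{1}{1-K/n}\sqrt{\log(17K)}\frac{K}{\sqrt n},$$ $$B_{n,K}=\sqrt{\frac{1+e}{2e(1-K/n)}\log\Big(K\big[\underline r+\lceil\tfrac{n-\underline rK}{2}\rceil-\lfloor n/K\rfloor+1\big](1+\sqrt{8\pi})\Big)\frac Kn}\le\sqrt{\frac{1}{1-K/n}\log\big(6.02K[3+\tfrac n2-\tfrac nK]\big)\frac Kn},$$ $$C_{n,K}=\min\Big(\frac{(1+K\sqrt{16\pi/(\eta e)})^2}{(\sqrt nK)^{1+\eta/(2+\eta)}}\sum_{r\in\mathcal{R}}\frac{1}{r^{1+\eta/(2+\eta)}},\ \frac{2K^{(1-\eta)/2}}{n^{(1+\eta)/4}}\sum_{r\in\mathcal{R}}\frac{1}{r^{(1+\eta)/2}}\Big),$$ with $C_{n,K}\le\min\big(\frac{(1+K\sqrt{16\pi/(\eta e)})^2}{(\sqrt nK)^{1+\eta/(2+\eta)}}\frac{2(1+\eta)}{\eta},\frac{2K^{(1-\eta)/2}}{n^{(1+\eta)/4}}\sum_{r\in\mathcal{R}}r^{-(1+\eta)/2}\big)$ and $$\frac{(1+K\sqrt{16\pi/(\eta e)})^2}{(\sqrt nK)^{1+\eta/(2+\eta)}}\frac{2(1+\eta)}{\eta}\le\frac{1+18.5K^2/\eta}{(\sqrt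 nK)^{1+\eta/(2+\eta)}}\frac{4(1+\eta)}{\eta}\le\frac{K^{1-\frac{3\eta}{4+2\eta}}}{\sqrt n}\,4(1+18.5\eta^{-1})^2.$$ The supremum is over i.i.d. potential outcome distributions with marginal cdfs in $\mathscr{D}$.
   Context: $D_{cdf}([a,b])$: cdfs with $F(a-)=0$, $F(b)=1$; $\mathscr{S}_K$ unit simplex; $\mathscr{S}_{A,K}=\{\delta\in\mathscr{S}_K:\delta_k=0\text{ for }k\notin A\}$; $\langle\delta,\mathbf{F}\rangle=\sum_i\delta_iF^i$. Potential outcomes $Y_t=(Y_{1,t},\dots,Y_{K,t})$ i.i.d. over $t$, $Y_{i,t}\sim F^i$. $\hat F_{i,t,n}$ is the empirical cdf of outcomes of subjects among $1,\dots,t$ assigned to treatment $i$; $\hat{\mathbf{F}}_{t,n}=(\hat F_{1,t,n},\dots,\hat F_{K,t,n})$. $u_\eta(r,n)=C\sqrt{\frac{1+\eta}{r}[0.5\log n+\log(rK)]}$. Policy $\tilde\pi$: $t=0$, $r=0$, $\mathcal{I}_0=\mathcal{I}$, $\mathcal{J}_0=\{1,\dots,m\}$, $\mathscr{M}^n_{A_j,K,0}=\mathscr{M}^n_{A_j,K}$. While $n-t\ge|\mathcal{I}_r|$: assign the next subjects once to each $i\in\mathcal{I}_r$ (incrementing $t$); $r\leftarrow r+1$, $\mathcal{I}_r=\mathcal{I}_{r-1}$, $\mathcal{J}_r=\mathcal{J}_{r-1}$; for each $j\in\mathcal{J}_r$ in turn: if $r\in\mathcal{R}$ and $|\mathcal{J}_r|\ge2$,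 let $h=\max\{\mathsf{T}(\langle\delta,\hat{\mathbf{F}}_{t,n}\rangle):\delta\in\mathscr{M}^n_{A_l,K,r-1},l\in\mathcal{J}_r\setminus\{j\}\}$, $\mathscr{M}^n_{A_j,K,r}=\{\gamma\in\mathscr{M}^n_{A_j,K,r-1}:h-\mathsf{T}(\langle\gamma,\hat{\mathbf{F}}_{t,n}\rangle)\le u_\eta(r,n)\}$, and if empty remove $A_j$ from $\mathcal{I}_r$ and $j$ from $\mathcal{J}_r$; else $\mathscr{M}^n_{A_j,K,r}=\mathscr{M}^n_{A_j,K,r-1}$. After the loop, if $t<n$, assign the remaining $n-t$ subjects to the $n-t$ smallest elements of $\mathcal{I}_r$, one each. Recommend the lexicographic minimum of $\arg\max\{\mathsf{T}(\langle\delta,\hat{\mathbf{F}}_{n,n}\rangle):\delta\in\bigcup_{j\in\mathcal{J}_r}\mathscr{M}^n_{A_j,K,r}\}$. Regret $r_n(\pi,\mathscr{M}_K)=\max_{\delta\in\mathscr{M}_K}\mathsf{T}(\langle\delta,\mathbf{F}\rangle)-\mathsf{T}(\langle\text{recommendation},\mathbf{F}\rangle)$; $\varepsilon(n)=\sup_{\mathbf{F}\in\mathscr{D}^K}|\max_{\mathscr{M}_K}\mathsf{T}(\langle\delta,\mathbf{F}\rangle)-\max_{\mathscr{M}_K^n}\mathsf{T}(\langle\delta,\mathbf{F}\rangle)|$. *)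

theory Defs
  imports "HOL-Probability.Probability"
begin

definition real_cdf :: "(real \<Rightarrow> real) \<Rightarrow> bool" where
  "real_cdf F \<longleftrightarrow> mono F \<and> (\<forall>x. continuous (at_right x) F) \<and>
     (F \<longlongrightarrow> 0) at_bot \<and> (F \<longlongrightarrow> 1) at_top"

definition D_cdf :: "real \<Rightarrow> real \<Rightarrow> (real \<Rightarrow> real) set" where
  "D_cdf a b = {F. real_cdf F \<and> (F \<longlongrightarrow> 0) (at_left a) \<and> F b = 1}"

definition sup_norm :: "(real \<Rightarrow> real) \<Rightarrow> real" where
  "sup_norm F = (SUP x. \<bar>F x\<bar>)"

definition convex_fun_set :: "(real \<Rightarrow> real) set \<Rightarrow> bool" where
  "convex_fun_set D \<longleftrightarrow> (\<forall>F\<in>D. \<forall>G\<in>D. \<forall>u::real. 0 \<le> u \<and> u \<le> 1 \<longrightarrow> (\<lambda>x. u * F x + (1 - u) * G x) \<in> D)"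

definition unit_simplex :: "nat \<Rightarrow> (nat \<Rightarrow> real) set" where
  "unit_simplex K = {\<delta>. (\<forall>i. 0 \<le> \<delta> i) \<and> (\<forall>i. i \<notin> {1..K} \<longrightarrow> \<delta> i = 0) \<and> (\<Sum>i\<in>{1..K}. \<delta> i) = 1}"

definition simplex_on :: "nat set \<Rightarrow> nat \<Rightarrow> (nat \<Rightarrow> real) set" where
  "simplex_on A K = {\<delta> \<in> unit_simplex K. \<forall>k. k \<notin> A \<longrightarrow> \<delta> k = 0}"

definition mix :: "nat \<Rightarrow> (nat \<Rightarrow> real) \<Rightarrow> (nat \<Rightarrow> real \<Rightarrow> real) \<Rightarrow> real \<Rightarrow> real" where
  "mix K \<delta> F = (\<lambda>x. \<Sum>i\<in>{1..K}. \<delta> i * F i x)"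

text \<open>y s i = outcome of subject s under treatment i; asg s = treatment assigned to subject s.
  Empirical cdf of treatment i based on subjects 1..t.\<close>
definition Fhat :: "(nat \<Rightarrow> nat \<Rightarrow> real) \<Rightarrow> (nat \<Rightarrow> nat) \<Rightarrow> nat \<Rightarrow> nat \<Rightarrow> real \<Rightarrow> real" where
  "Fhat y asg t i x =
     real (card {s \<in> {1..t}. asg s = i \<and> y s i \<le> x}) / real (card {s \<in> {1..t}. asg s = i})"

definition u_eta :: "real \<Rightarrow> real \<Rightarrow> nat \<Rightarrow> nat \<Rightarrow> nat \<Rightarrow> real" where
  "u_eta C \<eta> K r n = C * sqrt ((1 + \<eta>) / real r * (0.5 * ln (real n) + ln (real r * real K)))"

definition assign_next :: "nat set \<Rightarrow> nat \<Rightarrow> nat \<Rightarrow> (nat \<Rightarrow> nat) \<Rightarrow> nat \<Rightarrow> nat" where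
  "assign_next I t k asg = (\<lambda>s. if t < s \<and> s \<le> t + k then sorted_list_of_set I ! (s - t - 1) else asg s)"

text \<open>Processing of one group index j in round r (state: I_r, J_r, current sets M_{A_j,K,r});
  Mprev are the sets M_{A_l,K,r-1}.\<close>
definition elim_step ::
  "nat \<Rightarrow> ((real \<Rightarrow> real) \<Rightarrow> real) \<Rightarrow> (nat \<Rightarrow> nat set) \<Rightarrow> nat set \<Rightarrow> real \<Rightarrow> real \<Rightarrow> nat \<Rightarrow>
   (nat \<Rightarrow> nat \<Rightarrow> real) \<Rightarrow> (nat \<Rightarrow> nat) \<Rightarrow> nat \<Rightarrow> nat \<Rightarrow> (nat \<Rightarrow> (nat \<Rightarrow> real) set) \<Rightarrow> nat \<Rightarrow>
   nat set \<times> nat set \<times> (nat \<Rightarrow> (nat \<Rightarrow> real) set) \<Rightarrow> nat set \<times> nat set \<times> (nat \<Rightarrow> (nat \<Rightarrow> real) set)" where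
  "elim_step K T A R C \<eta> n y asg t r Mprev j st = (case st of (I, J, Mc) \<Rightarrow>
     if r \<in> R \<and> 2 \<le> card J then
       (let Fh = Fhat y asg t;
            h = Max {T (mix K \<delta> Fh) | \<delta> l. l \<in> J - {j} \<and> \<delta> \<in> Mprev l};
            Mj = {\<gamma> \<in> Mprev j. h - T (mix K \<gamma> Fh) \<le> u_eta C \<eta> K r n}
        in if Mj = {} then (I - A j, J - {j}, Mc(j := Mj)) else (I, J, Mc(j := Mj)))
     else (I, J, Mc))"

text \<open>Main while loop, with fuel (the loop terminates after at most n rounds).
  State: (t, r, I_r, J_r, M_{.,K,r}, assignment).\<close>
primrec policy_loop ::
  "nat \<Rightarrow> ((real \<Rightarrow> real) \<Rightarrow> real) \<Rightarrow> (nat \<Rightarrow> nat set) \<Rightarrow> nat set \<Rightarrow> real \<Rightarrow> real \<Rightarrow> nat \<Rightarrow>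
   (nat \<Rightarrow> nat \<Rightarrow> real) \<Rightarrow> nat \<Rightarrow>
   nat \<times> nat \<times> nat set \<times> nat set \<times> (nat \<Rightarrow> (nat \<Rightarrow> real) set) \<times> (nat \<Rightarrow> nat) \<Rightarrow>
   nat \<times> nat \<times> nat set \<times> nat set \<times> (nat \<Rightarrow> (nat \<Rightarrow> real) set) \<times> (nat \<Rightarrow> nat)" where
  "policy_loop K T A R C \<eta> n y 0 st = st"
| "policy_loop K T A R C \<eta> n y (Suc k) st = (case st of (t, r, I, J, Ms, asg) \<Rightarrow>
     if card I \<le> n - t then
       (let asg' = assign_next I t (card I) asg;
            t' = t + card I;
            r' = r + 1;
            (I', J', Ms') = fold (elim_step K T A R C \<eta> n y asg' t' r' Ms) (sorted_list_of_set J) (I, J, Ms)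
        in policy_loop K T A R C \<eta> n y k (t', r', I', J', Ms', asg'))
     else st)"

definition lex_less :: "nat \<Rightarrow> (nat \<Rightarrow> real) \<Rightarrow> (nat \<Rightarrow> real) \<Rightarrow> bool" where
  "lex_less K \<delta> \<gamma> \<longleftrightarrow> (\<exists>k\<in>{1..K}. (\<forall>i\<in>{1..<k}. \<delta> i = \<gamma> i) \<and> \<delta> k < \<gamma> k)"

definition lexmin :: "nat \<Rightarrow> (nat \<Rightarrow> real) set \<Rightarrow> nat \<Rightarrow> real" where
  "lexmin K S = (THE \<delta>. \<delta> \<in> S \<and> (\<forall>\<gamma>\<in>S. \<gamma> \<noteq> \<delta> \<longrightarrow> lex_less K \<delta> \<gamma>))"

definition recommend ::
  "nat \<Rightarrow> ((real \<Rightarrow> real) \<Rightarrow> real) \<Rightarrow> (nat \<Rightarrow> nat set) \<Rightarrow> nat set \<Rightarrow> real \<Rightarrow> real \<Rightarrow> nat \<Rightarrow>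
   nat \<Rightarrow> (nat \<Rightarrow> (nat \<Rightarrow> real) set) \<Rightarrow> (nat \<Rightarrow> nat \<Rightarrow> real) \<Rightarrow> nat \<Rightarrow> real" where
  "recommend K T A R C \<eta> n m Mn y =
     (case policy_loop K T A R C \<eta> n y (Suc n) (0, 0, {1..K}, {1..m}, Mn, (\<lambda>_. 0)) of
        (t, r, I, J, Ms, asg) \<Rightarrow>
          (let asg' = assign_next I t (n - t) asg;
               Fh = Fhat y asg' n;
               S = (\<Union>j\<in>J. Ms j);
               AM = {\<delta> \<in> S. \<forall>\<gamma>\<in>S. T (mix K \<gamma> Fh) \<le> T (mix K \<delta> Fh)}
           in lexmin K AM))"

definition regret ::
  "nat \<Rightarrow> ((real \<Rightarrow> real) \<Rightarrow> real) \<Rightarrow> (nat \<Rightarrow> real) set \<Rightarrow> (nat \<Rightarrow> real \<Rightarrow> real) \<Rightarrow> (nat \<Rightarrow> real) \<Rightarrow> real" where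
  "regret K T M F \<delta> = (SUP \<gamma>\<in>M. T (mix K \<gamma> F)) - T (mix K \<delta> F)"

definition disc_err ::
  "nat \<Rightarrow> ((real \<Rightarrow> real) \<Rightarrow> real) \<Rightarrow> (real \<Rightarrow> real) set \<Rightarrow> (nat \<Rightarrow> real) set \<Rightarrow> (nat \<Rightarrow> real) set \<Rightarrow> real" where
  "disc_err K T D M Mn =
     (SUP F\<in>{F. \<forall>i\<in>{1..K}. F i \<in> D}. \<bar>(SUP \<delta>\<in>M. T (mix K \<delta> F)) - (SUP \<delta>\<in>Mn. T (mix K \<delta> F))\<bar>)"

definition f_nK :: "nat \<Rightarrow> nat \<Rightarrow> real \<Rightarrow> real" where
  "f_nK n K u = 1/2 + u / real n - u * real K / (2 * real n) + 1 / real n"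

definition A_nK :: "nat \<Rightarrow> nat \<Rightarrow> nat \<Rightarrow> real" where
  "A_nK n K rmin = (1 + exp 1) / (sqrt 2 * exp 1 * (1 - real K / real n))
     * sqrt (ln (real K * (1 + (1 + sqrt (8 * pi)) * sqrt (2 * pi))))
     * sqrt (f_nK n K (real rmin)) * real K / sqrt (real n)"

definition B_nK :: "nat \<Rightarrow> nat \<Rightarrow> nat \<Rightarrow> real" where
  "B_nK n K rmin = sqrt ((1 + exp 1) / (2 * exp 1 * (1 - real K / real n))
     * ln (real K * (real rmin + real_of_int \<lceil>(real n - real rmin * real K) / 2\<rceil>
                     - real_of_int \<lfloor>real n / real K\<rfloor> + 1) * (1 + sqrt (8 * pi)))
     * real K / real n)"

definition C1_nK :: "nat \<Rightarrow> nat \<Rightarrow> real \<Rightarrow> real" where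
  "C1_nK n K \<eta> = (1 + real K * sqrt (16 * pi / (\<eta> * exp 1)))\<^sup>2
                   / ((sqrt (real n) * real K) powr (1 + \<eta> / (2 + \<eta>)))"

definition C2_nK :: "nat \<Rightarrow> nat \<Rightarrow> real \<Rightarrow> real" where
  "C2_nK n K \<eta> = 2 * real K powr ((1 - \<eta>) / 2) / real n powr ((1 + \<eta>) / 4)"

definition C_nK :: "nat \<Rightarrow> nat \<Rightarrow> real \<Rightarrow> nat set \<Rightarrow> real" where
  "C_nK n K \<eta> R = min (C1_nK n K \<eta> * (\<Sum>r\<in>R. 1 / real r powr (1 + \<eta> / (2 + \<eta>))))
                        (C2_nK n K \<eta> * (\<Sum>r\<in>R. 1 / real r powr ((1 + \<eta>) / 2)))"

end

(* The outcomes observed under the treatments, placed in the cells (i, q) of the q-th observation of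
   arm i and completed by independent fillers, form a table with independent entries, entry (i, q)
   having cdf F^i, although the assignment is adaptive. Let the deviation of an arm be the sup
   distance between its empirical cdf and F^i. Along each path, either the best discretized rule is
   eliminated in some round r, and then the maximal deviations of its own group and of the other
   groups after r observations sum to more than u_eta(r, n) / C; or it survives, and then the regret
   against it is at most 2 C times the maximal deviation at the final sample sizes. The two groups
   use disjoint rows of the table, so their exponential moments multiply; this, or a plain union
   bound, gives C_{n,K}. For the maximal deviation, B_{n,K} comes from a union bound over all possible
   final sample sizes, and A_{n,K} from Doob's inequality for the submartingale
   exp (beta (r dev_r)^2), since the unnormalized deviation r dev_r is the norm of a random walk.

   All tail bounds rest on the Dvoretzky-Kiefer-Wolfowitz inequality with Massart's constant. For its
   one-sided form with nested events E_x of probability p_x and sample xi_1, ..., xi_n, the product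
   W_x = prod_s (1 + (theta / p_x) 1[xi_s in E_x]) has mean (1 + theta)^n and is a martingale as E_x
   shrinks, so Ville's maximal inequality applies. A single theta makes the resulting bound at most
   exp (-2 n eps^2) for all p_x at once: it is fixed by the point t at which the relative entropy of
   Bernoulli (t + eps) with respect to Bernoulli t is stationary in t. *)

theory Submission
  imports Defs
begin


text \<open>The final sample sizes are random and depend on the outcomes, so the deviations are
  bounded uniformly over a deterministic range of sizes. An arm still in play has at least
  \<open>n div K\<close> observations. The upper end
  \<open>Min R + (n - Min R * K + 1) div 2\<close> is valid only while two arms are in play, when
  each round after round \<open>Min R\<close> costs at least two subjects; if a single arm is left,
  all surviving rules coincide and the deviation is irrelevant.

  One \<theta> serves all p by an envelope argument. For fixed p, the exponent (p + \<epsilon>) ln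
  (1 + \<theta> / p) - ln (1 + \<theta>) is maximal at \<theta> = \<epsilon> / (1 - p - \<epsilon>),
  with value the relative entropy. If \<theta> is the maximizer at a point t where the relative
  entropy is stationary, the exponent for this fixed \<theta> is stationary in p at t as well. That
  point is its minimum, and Pinsker's inequality bounds it there by 2 \<epsilon>^2.

  The states of the policy contain sets of functions; their measurability is expressed by simple
  functions instead of a product structure on states.\<close>

section \<open>The Dvoretzky-Kiefer-Wolfowitz inequality\<close>

lemma bernoulli_KL_ge:
  fixes t \<epsilon> :: real
  assumes "0 < t" "0 < \<epsilon>" "t + \<epsilon> < 1"
  shows "2 * \<epsilon>\<^sup>2 \<le> (t + \<epsilon>) * ln ((t + \<epsilon>) / t) + (1 - t - \<epsilon>) * ln ((1 - t - \<epsilon>) / (1 - t))"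
proof -
  define c where "c = t + \<epsilon>"
  \<comment> \<open>The first parameter c stays fixed while the second, c - e, moves away from it.
    The derivative of g is e / ((c - e) (1 - c + e)) - 4 e, nonnegative because p (1 - p) is at most
    1/4.\<close>
  define g where "g e = c * ln c - c * ln (c - e) + (1 - c) * ln (1 - c) - (1 - c) * ln (1 - c + e) - 2 * e\<^sup>2" for e
  have c: "0 < c" "c < 1" "c - \<epsilon> = t" "1 - c + \<epsilon> = 1 - t" "1 - t - \<epsilon> = 1 - c" "t + \<epsilon> = c"
    using assms by (auto simp: c_def)
  have t1: "0 < 1 - t" using assms by simp
  have "g 0 \<le> g \<epsilon>"
  proof (rule DERIV_nonneg_imp_nondecreasing[of 0 \<epsilon> g])
    fix x assume x: "0 \<le> x" "x \<le> \<epsilon>"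
    have pos: "0 < c - x" "0 < 1 - c + x" using x assms c by auto
    have d: "(g has_real_derivative - (c * (- 1 / (c - x))) - (1 - c) * (1 / (1 - c + x)) - 4 * x) (at x)"
      unfolding g_def using pos by (auto intro!: derivative_eq_intros)
    have "c / (c - x) - (1 - c) / (1 - c + x) = x / ((c - x) * (1 - c + x))"
      using pos by (simp add: field_simps)
    moreover have "4 * ((c - x) * (1 - c + x)) \<le> 1"
      using zero_le_power2[of "2 * (c - x) - 1"] by (simp add: power2_eq_square algebra_simps)
    then have "x * (4 * ((c - x) * (1 - c + x))) \<le> x" using x mult_left_mono[of _ 1 x] by simp
    then have "4 * x \<le> x / ((c - x) * (1 - c + x))"
      using pos by (simp add: pos_le_divide_eq mult_ac)
    ultimately have "0 \<le> - (c * (- 1 / (c - x))) - (1 - c) * (1 / (1 - c + x)) - 4 * x" by simp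
    then show "\<exists>y. (g has_real_derivative y) (at x) \<and> 0 \<le> y" using d by blast
  qed (use assms in auto)
  moreover have "g 0 = 0" by (simp add: g_def)
  moreover have "(t + \<epsilon>) * ln ((t + \<epsilon>) / t) + (1 - t - \<epsilon>) * ln ((1 - t - \<epsilon>) / (1 - t)) = g \<epsilon> + 2 * \<epsilon>\<^sup>2"
    using assms(1) c(1,2) t1 unfolding g_def c(3-6) by (simp add: ln_div algebra_simps)
  ultimately show ?thesis by simp
qed

text \<open>The equation says that the derivative in t of the relative entropy of Bernoulli (t +
  \<epsilon>) with respect to Bernoulli t vanishes. The intermediate value theorem solves it between
  the symmetric point (1 - \<epsilon>) / 2 and a point close to 1 - \<epsilon>, where the second
  logarithm is large.\<close>

lemma stationary_KL_exists:
  fixes \<epsilon> :: real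
  assumes "0 < \<epsilon>" "\<epsilon> < 1"
  shows "\<exists>t. 0 < t \<and> t + \<epsilon> < 1 \<and> ln ((t + \<epsilon>) / t) + ln ((1 - t) / (1 - t - \<epsilon>)) = \<epsilon> / (t * (1 - t))"
proof -
  define f where "f t = ln ((t + \<epsilon>) / t) + ln ((1 - t) / (1 - t - \<epsilon>)) - \<epsilon> / (t * (1 - t))" for t
  define l where "l = (1 - \<epsilon>) / 2"
  \<comment> \<open>d is so small that ln (\<epsilon> / d) \<ge> 2 / (1 - \<epsilon>) = 1 / l. This
    dominates the rational term at h, since 1 - h \<ge> \<epsilon> and h \<ge> l.\<close>
  define d where "d = min l (\<epsilon> * exp (- (2 / (1 - \<epsilon>))))"
  define h where "h = 1 - \<epsilon> - d"
  have l: "0 < l" "l < 1 - \<epsilon>" "2 * l = 1 - \<epsilon>" using assms by (auto simp: l_def)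
  have d: "0 < d" "d \<le> l" "d \<le> \<epsilon> * exp (- (2 / (1 - \<epsilon>)))" 
    using assms l(1) unfolding d_def by auto
  have lh: "l \<le> h" using d(2) l(3) unfolding h_def by linarith
  have h: "0 < h" "h < 1 - \<epsilon>" using lh l d by (auto simp: h_def)
  have "f l \<le> 0"
  proof -
    \<comment> \<open>At the symmetric point f equals -2 times g \<epsilon>, and g is nondecreasing
      from g 0 = 0.\<close>
    define g where "g e = 2 * e / (1 - e\<^sup>2) - (ln (1 + e) - ln (1 - e))" for e :: real
    have "g 0 \<le> g \<epsilon>"
    proof (rule DERIV_nonneg_imp_nondecreasing[of 0 \<epsilon> g])
      fix x assume x: "0 \<le> x" "x \<le> \<epsilon>"
      have pos: "0 < 1 + x" "0 < 1 - x" using x assms by auto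
      have x2: "0 < 1 - x\<^sup>2" using x assms by (simp add: power_less_one_iff abs_square_less_1)
      have "(g has_real_derivative (2 * (1 - x\<^sup>2) - 2 * x * (- (2 * x))) / (1 - x\<^sup>2)\<^sup>2 - (1 / (1 + x) + 1 / (1 - x))) (at x)"
        unfolding g_def using pos x2 by (auto intro!: derivative_eq_intros simp: power2_eq_square)
      moreover have "1 / (1 + x) + 1 / (1 - x) = 2 * (1 - x\<^sup>2) / (1 - x\<^sup>2)\<^sup>2"
      proof -
        have "1 - x\<^sup>2 = (1 + x) * (1 - x)" by (simp add: power2_eq_square algebra_simps)
        then have "2 / (1 - x\<^sup>2) = 1 / (1 + x) + 1 / (1 - x)"
          using pos by (simp add: add_frac_eq)
        moreover have "2 / (1 - x\<^sup>2) = 2 * (1 - x\<^sup>2) / (1 - x\<^sup>2)\<^sup>2"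
          using x2 by (simp only: power2_eq_square[of "1 - x\<^sup>2"] mult_divide_mult_cancel_right)
        ultimately show ?thesis by simp
      qed
      moreover have "2 * (1 - x\<^sup>2) / (1 - x\<^sup>2)\<^sup>2 \<le> (2 * (1 - x\<^sup>2) - 2 * x * (- (2 * x))) / (1 - x\<^sup>2)\<^sup>2"
        by (intro divide_right_mono) (auto simp: power2_eq_square)
      ultimately show "\<exists>y. (g has_real_derivative y) (at x) \<and> 0 \<le> y" by (metis diff_ge_0_iff_ge)
    qed (use assms in auto)
    moreover have "f l = 2 * (ln (1 + \<epsilon>) - ln (1 - \<epsilon>)) - 4 * \<epsilon> / (1 - \<epsilon>\<^sup>2)"
    proof -
      have e: "l + \<epsilon> = (1 + \<epsilon>) / 2" "1 - l = (1 + \<epsilon>) / 2" "1 - l - \<epsilon> = (1 - \<epsilon>) / 2" by (auto simp: l_def field_simps)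
      have "(l + \<epsilon>) / l = (1 + \<epsilon>) / (1 - \<epsilon>)" "(1 - l) / (1 - l - \<epsilon>) = (1 + \<epsilon>) / (1 - \<epsilon>)"
        unfolding e unfolding l_def using assms by (auto simp: divide_simps, auto simp: algebra_simps)
      moreover have "\<epsilon> / (l * (1 - l)) = 4 * \<epsilon> / (1 - \<epsilon>\<^sup>2)"
        unfolding e by (simp add: l_def power2_eq_square algebra_simps)
      ultimately show ?thesis unfolding f_def using assms by (simp add: ln_div)
    qed
    ultimately show ?thesis by (simp add: g_def)
  qed
  moreover have "0 \<le> f h"
  proof -
    have "2 / (1 - \<epsilon>) = ln (\<epsilon> / (\<epsilon> * exp (- (2 / (1 - \<epsilon>)))))" using assms by (simp add: ln_div ln_mult)
    also have "\<dots> \<le> ln ((1 - h) / (1 - h - \<epsilon>))"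
    proof -
      have "1 - h = \<epsilon> + d" "1 - h - \<epsilon> = d" by (auto simp: h_def)
      then show ?thesis using d assms
        by (intro ln_mono) (simp only: , intro frac_le, auto)
    qed
    finally have a: "2 / (1 - \<epsilon>) \<le> ln ((1 - h) / (1 - h - \<epsilon>))" .
    have "\<epsilon> / (h * (1 - h)) \<le> (1 - h) / (l * (1 - h))"
      using lh l h assms by (intro frac_le mult_mono mult_pos_pos) auto
    also have "\<dots> = 1 / l" using h assms by simp
    also have "\<dots> = 2 / (1 - \<epsilon>)" by (simp add: l_def)
    finally have "\<epsilon> / (h * (1 - h)) \<le> ln ((1 - h) / (1 - h - \<epsilon>))" using a by simp
    moreover have "0 \<le> ln ((h + \<epsilon>) / h)" using h assms by (intro ln_ge_zero) auto
    ultimately show ?thesis by (simp add: f_def)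
  qed
  moreover have "continuous_on {l..h} f"
  proof -
    have "x \<noteq> 0 \<and> 1 - x \<noteq> 0 \<and> 1 - x - \<epsilon> \<noteq> 0 \<and> x + \<epsilon> \<noteq> 0" if "x \<in> {l..h}" for x
      using that l h assms(1) by auto
    then show ?thesis unfolding f_def by (intro continuous_intros) auto
  qed
  ultimately obtain t where t: "l \<le> t" "t \<le> h" "f t = 0" using IVT'[of f l 0 h] lh by auto
  then show ?thesis using l h by (intro exI[of _ t]) (auto simp: f_def)
qed

text \<open>This is the Chernoff bound for a Bernoulli p variable with tilt e^\<lambda> = 1 +
  \<theta> / p, whose moment generating function is then 1 + \<theta>. The point is the order of the
  quantifiers: \<theta> comes before p.\<close>

lemma ville_parameter_exists:
  fixes \<epsilon> :: real
  assumes "0 < \<epsilon>" "\<epsilon> < 1"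
  shows "\<exists>\<theta>>0. \<forall>p. 0 < p \<and> p + \<epsilon> \<le> 1 \<longrightarrow> 2 * \<epsilon>\<^sup>2 + ln (1 + \<theta>) \<le> (p + \<epsilon>) * ln (1 + \<theta> / p)"
proof -
  obtain t where t: "0 < t" "t + \<epsilon> < 1"
    and root: "ln ((t + \<epsilon>) / t) + ln ((1 - t) / (1 - t - \<epsilon>)) = \<epsilon> / (t * (1 - t))"
    using stationary_KL_exists[OF assms] by auto
  define c where "c = t + \<epsilon>"
  \<comment> \<open>This \<theta> tilts Bernoulli t to Bernoulli c, so at p = t the exponent is
    exactly the relative entropy. By stationarity, L is the value of (p + \<epsilon>) ln (1 +
    \<theta> / p) at p = t; it remains to show that L is its minimum over p.\<close>
  define \<theta> where "\<theta> = \<epsilon> / (1 - c)"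
  define L where "L = c * \<epsilon> / (t * (1 - t))"
  define \<alpha> where "\<alpha> = \<theta> - \<epsilon>"
  have c: "0 < c" "c < 1" "t < c" "\<epsilon> < c" using t assms by (auto simp: c_def)
  have \<theta>: "0 < \<theta>" using assms c by (simp add: \<theta>_def)
  have \<alpha>: "\<alpha> = \<epsilon> * c / (1 - c)" "0 < \<alpha>" using assms c by (auto simp: \<alpha>_def \<theta>_def field_simps)
  have L0: "0 < L" using t assms c by (simp add: L_def)
  have \<theta>1: "1 + \<theta> = (1 - t) / (1 - c)" "1 + \<theta> / t = (c / t) * ((1 - t) / (1 - c))"
  proof -
    have e: "\<epsilon> = c * (1 - t) - t * (1 - c)" "\<epsilon> = c - t" by (auto simp: c_def algebra_simps)
    show "1 + \<theta> = (1 - t) / (1 - c)" unfolding \<theta>_def using c by (simp add: add_divide_eq_iff e(2))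
    show "1 + \<theta> / t = (c / t) * ((1 - t) / (1 - c))" 
      unfolding \<theta>_def using c t e(1) by (simp add: add_divide_eq_iff)
  qed
  have L: "L = c * ln (1 + \<theta> / t)"
    unfolding \<theta>1 L_def using root c t by (subst ln_mult) (auto simp: c_def diff_diff_eq)
  have KL: "2 * \<epsilon>\<^sup>2 \<le> L - ln (1 + \<theta>)"
  proof -
    have pos: "0 < 1 - t" "0 < 1 - c" using t assms c by auto
    have "2 * \<epsilon>\<^sup>2 \<le> c * ln (c / t) + (1 - c) * ln ((1 - c) / (1 - t))"
      using bernoulli_KL_ge[OF t(1) assms(1) t(2)] by (simp add: c_def diff_diff_eq)
    also have "\<dots> = c * (ln c - ln t + (ln (1 - t) - ln (1 - c))) - (ln (1 - t) - ln (1 - c))"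
      using pos t c by (simp add: ln_div algebra_simps)
    also have "\<dots> = L - ln (1 + \<theta>)"
      using pos t c unfolding L \<theta>1 by (simp add: ln_div ln_mult_pos)
    finally show ?thesis .
  qed
  \<comment> \<open>With x = 1 / (p + \<epsilon>), the quantity 1 + \<theta> / p becomes (1 +
    \<alpha> x) / (1 - \<epsilon> x), and minimality of L becomes u x \<ge> 0. The derivative of u
    has the sign of the quadratic N, whose roots are z and z'; z corresponds to p = t.\<close>
  define u where "u x = ln (1 + \<alpha> * x) - ln (1 - \<epsilon> * x) - L * x" for x
  define N where "N x = \<theta> - L * (1 + \<alpha> * x) * (1 - \<epsilon> * x)" for x
  define z where "z = 1 / c"
  define z' where "z' = (\<alpha> - \<epsilon>) / (\<alpha> * \<epsilon>) - z"
  have z: "0 < z" "\<epsilon> * z < 1" using c by (auto simp: z_def)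
  have du: "(u has_real_derivative N x / ((1 + \<alpha> * x) * (1 - \<epsilon> * x))) (at x)" if "0 \<le> x" "\<epsilon> * x < 1" for x
  proof -
    have p: "0 < 1 + \<alpha> * x" "0 < 1 - \<epsilon> * x" using that \<alpha>(2) by (auto simp: add_pos_nonneg)
    have "(u has_real_derivative \<alpha> / (1 + \<alpha> * x) + \<epsilon> / (1 - \<epsilon> * x) - L) (at x)"
      unfolding u_def using p by (auto intro!: derivative_eq_intros)
    moreover have "\<alpha> / (1 + \<alpha> * x) + \<epsilon> / (1 - \<epsilon> * x) - L = N x / ((1 + \<alpha> * x) * (1 - \<epsilon> * x))"
      using p by (simp add: N_def \<alpha>_def divide_simps) (simp add: algebra_simps)
    ultimately show ?thesis by simp
  qed
  have Nz: "N z = 0"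
  proof -
    have "1 + \<alpha> * z = (1 - t) / (1 - c)" using \<theta>1(1) c by (simp add: \<alpha>(1) z_def \<theta>_def)
    moreover have "1 - \<epsilon> * z = t / c" using c by (simp add: z_def c_def field_simps)
    ultimately show ?thesis using c t by (simp add: N_def L_def \<theta>_def)
  qed
  have Nfac: "N x = L * \<alpha> * \<epsilon> * (x - z) * (x - z')" for x
  proof -
    have "N x = N x - N z" using Nz by simp
    also have "\<dots> = L * (x - z) * (\<alpha> * \<epsilon> * (x + z) - (\<alpha> - \<epsilon>))" by (simp add: N_def algebra_simps)
    also have "\<dots> = L * \<alpha> * \<epsilon> * (x - z) * (x - z')" using \<alpha>(2) assms by (simp add: z'_def field_simps)
    finally show ?thesis .
  qed
  have u0: "u 0 = 0" by (simp add: u_def)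
  have uz: "u z = 0"
  proof -
    have "1 + \<alpha> * z = (1 - t) / (1 - c)" using \<theta>1(1) c by (simp add: \<alpha>(1) z_def \<theta>_def)
    moreover have "1 - \<epsilon> * z = t / c" using c by (simp add: z_def c_def field_simps)
    ultimately show ?thesis using c t unfolding u_def L \<theta>1 by (simp add: z_def ln_div ln_mult)
  qed
  have pos: "0 < (1 + \<alpha> * x) * (1 - \<epsilon> * x)" if "0 \<le> x" "\<epsilon> * x < 1" for x
    using that \<alpha>(2) by (simp add: add_pos_nonneg)
  have small: "\<epsilon> * x < 1" if "x \<le> y" "\<epsilon> * y < 1" for x y
    using mult_left_mono[OF that(1), of \<epsilon>] that(2) assms(1) by linarith
  \<comment> \<open>If z' exceeded z, u would increase strictly on (0, z), against u 0 = u z = 0. So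
    u rises up to z', falls to z and rises again, with minimum value 0.\<close>
  have zz: "z' \<le> z"
  proof (rule ccontr)
    assume "\<not> z' \<le> z"
    then have "u 0 < u z"
    proof (intro DERIV_pos_imp_increasing_open[of 0 z u])
      fix x assume x: "0 < x" "x < z" "\<not> z' \<le> z"
      then have "0 < (x - z) * (x - z')" by (intro mult_neg_neg) auto
      then have "0 < N x" unfolding Nfac using L0 \<alpha>(2) assms by (simp add: mult.assoc)
      moreover have nn: "0 \<le> x" "\<epsilon> * x < 1" using small[of x z] z x by auto
          ultimately have "0 < N x / ((1 + \<alpha> * x) * (1 - \<epsilon> * x))" using pos[of x] by (intro divide_pos_pos) auto
          then show "\<exists>y. (u has_real_derivative y) (at x) \<and> 0 < y" using du[OF nn] by blast
    next
      show "continuous_on {0..z} u"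
        using DERIV_isCont[OF du] small[of _ z] z by (intro continuous_at_imp_continuous_on) auto
    qed (use z in auto)
    then show False using u0 uz by simp
  qed
  have u_nonneg: "0 \<le> u x" if x: "0 \<le> x" "\<epsilon> * x < 1" for x
  proof -
    consider "z \<le> x" | "x < z" "z' \<le> x" | "x < z'" by linarith
    then show ?thesis
    proof cases
      case 1
      have "u z \<le> u x"
      proof (rule DERIV_nonneg_imp_nondecreasing[OF 1])
        fix y assume y: "z \<le> y" "y \<le> x"
        then have "0 \<le> N y" unfolding Nfac using L0 \<alpha>(2) assms zz by (intro mult_nonneg_nonneg) auto
        moreover have nn: "0 \<le> y" "\<epsilon> * y < 1" using small[of y x] z x y by auto
          ultimately have "0 \<le> N y / ((1 + \<alpha> * y) * (1 - \<epsilon> * y))" using pos[of y] by (intro divide_nonneg_pos) auto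
          then show "\<exists>d. (u has_real_derivative d) (at y) \<and> 0 \<le> d" using du[OF nn] by blast
      qed
      then show ?thesis using uz by simp
    next
      case 2
      have "u z \<le> u x"
      proof (rule DERIV_nonpos_imp_nonincreasing[of x z u])
        fix y assume y: "x \<le> y" "y \<le> z"
        then have "N y \<le> 0" unfolding Nfac using L0 \<alpha>(2) assms 2
          by (intro mult_nonpos_nonneg mult_nonneg_nonpos) auto
        moreover have nn: "0 \<le> y" "\<epsilon> * y < 1" using small[of y z] z x y by auto
          ultimately have "N y / ((1 + \<alpha> * y) * (1 - \<epsilon> * y)) \<le> 0" using pos[of y] by (intro divide_nonpos_pos) auto
          then show "\<exists>d. (u has_real_derivative d) (at y) \<and> d \<le> 0" using du[OF nn] by blast
      qed (use 2 in auto)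
      then show ?thesis using uz by simp
    next
      case 3
      have "u 0 \<le> u x"
      proof (rule DERIV_nonneg_imp_nondecreasing[of 0 x u])
        fix y assume y: "0 \<le> y" "y \<le> x"
        then have "0 \<le> (y - z) * (y - z')" using 3 zz by (intro mult_nonpos_nonpos) auto
        then have "0 \<le> N y" unfolding Nfac using L0 \<alpha>(2) assms by (simp add: mult.assoc)
        moreover have nn: "0 \<le> y" "\<epsilon> * y < 1" using small[of y x] z x y by auto
          ultimately have "0 \<le> N y / ((1 + \<alpha> * y) * (1 - \<epsilon> * y))" using pos[of y] by (intro divide_nonneg_pos) auto
          then show "\<exists>d. (u has_real_derivative d) (at y) \<and> 0 \<le> d" using du[OF nn] by blast
      qed (use x in auto)
      then show ?thesis using u0 by simp
    qed
  qed
  show ?thesis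
  proof (intro exI[of _ \<theta>] conjI allI impI \<theta>)
    fix p assume p: "0 < p \<and> p + \<epsilon> \<le> 1"
    define x where "x = 1 / (p + \<epsilon>)"
    have x: "0 \<le> x" "\<epsilon> * x < 1" using p assms by (auto simp: x_def)
    have e: "1 + \<alpha> * x = (p + \<theta>) * x" "1 - \<epsilon> * x = p * x" 
      using p assms by (auto simp: x_def \<alpha>_def field_simps)
    have "0 < x" using p assms by (auto simp: x_def)
    then have "ln (1 + \<alpha> * x) - ln (1 - \<epsilon> * x) = ln (1 + \<theta> / p)"
    proof -
      have "1 + \<theta> / p = (p + \<theta>) / p" using p by (simp add: add_divide_distrib)
      then show ?thesis unfolding e using p \<theta> \<open>0 < x\<close> by (simp add: ln_mult ln_div)
    qed
    then have "L * x \<le> ln (1 + \<theta> / p)" using u_nonneg[OF x] by (simp add: u_def)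
    then have "L \<le> (p + \<epsilon>) * ln (1 + \<theta> / p)" using p assms by (simp add: x_def divide_simps mult.commute)
    then show "2 * \<epsilon>\<^sup>2 + ln (1 + \<theta>) \<le> (p + \<epsilon>) * ln (1 + \<theta> / p)" using KL by simp
  qed
qed


section \<open>A maximal inequality along a shrinking chain of events\<close>

text \<open>A weight on coordinate s may be redistributed inside E as long as the other factor
  \<psi> does not see where in E that coordinate lies. This replaces conditional expectations in the
  martingale argument for W.\<close>

lemma (in product_sigma_finite) nn_integral_coordinate_swap:
  fixes h h' :: "'a \<Rightarrow> ennreal" and \<psi> :: "('i \<Rightarrow> 'a) \<Rightarrow> ennreal"
  assumes J: "finite J" "s \<in> J"
    and E[measurable]: "E \<in> sets (M s)"
    and h[measurable]: "h \<in> borel_measurable (M s)" "h' \<in> borel_measurable (M s)"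
    and \<psi>[measurable]: "\<psi> \<in> borel_measurable (PiM J M)"
    and off: "\<And>v. v \<in> space (M s) \<Longrightarrow> v \<notin> E \<Longrightarrow> h v = h' v"
    and int: "(\<integral>\<^sup>+v. h v * indicator E v \<partial>M s) = (\<integral>\<^sup>+v. h' v * indicator E v \<partial>M s)"
    and const: "\<And>\<xi> v w. v \<in> E \<Longrightarrow> w \<in> E \<Longrightarrow> \<psi> (\<xi>(s := v)) = \<psi> (\<xi>(s := w))"
  shows "(\<integral>\<^sup>+\<xi>. h (\<xi> s) * \<psi> \<xi> \<partial>PiM J M) = (\<integral>\<^sup>+\<xi>. h' (\<xi> s) * \<psi> \<xi> \<partial>PiM J M)"
proof -
  have JJ: "J = insert s (J - {s})" "finite (J - {s})" "s \<notin> J - {s}" using J by auto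
  have [measurable]: "\<psi> \<in> borel_measurable (PiM (insert s (J - {s})) M)" using \<psi> JJ(1) by simp
  have split: "(\<integral>\<^sup>+v. k v * \<psi> (x(s := v)) \<partial>M s) =
      (\<integral>\<^sup>+v. k v * indicator E v \<partial>M s) * \<psi> (x(s := (SOME v. v \<in> E))) +
      (\<integral>\<^sup>+v. k v * indicator (space (M s) - E) v * \<psi> (x(s := v)) \<partial>M s)"
    if x: "x \<in> space (PiM (J - {s}) M)" and k[measurable]: "k \<in> borel_measurable (M s)" for x and k :: "'a \<Rightarrow> ennreal"
  proof -
    have [measurable]: "(\<lambda>v. \<psi> (x(s := v))) \<in> borel_measurable (M s)"
    proof -
      have "(\<lambda>v. x(s := v)) \<in> measurable (M s) (PiM (insert s (J - {s})) M)"
        using x by (intro measurable_component_update) auto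
      then show ?thesis by measurable
    qed
    have "(\<integral>\<^sup>+v. k v * \<psi> (x(s := v)) \<partial>M s) =
      (\<integral>\<^sup>+v. k v * indicator E v * \<psi> (x(s := (SOME v. v \<in> E))) + k v * indicator (space (M s) - E) v * \<psi> (x(s := v)) \<partial>M s)"
    proof (intro nn_integral_cong)
      fix v assume v: "v \<in> space (M s)"
      show "k v * \<psi> (x(s := v)) = k v * indicator E v * \<psi> (x(s := (SOME v. v \<in> E))) + k v * indicator (space (M s) - E) v * \<psi> (x(s := v))"
      proof (cases "v \<in> E")
        case True
        then have "(SOME v. v \<in> E) \<in> E" by (rule someI)
        with True show ?thesis using const[of v "SOME v. v \<in> E" x] by simp
      qed (use v in simp)
    qed
    also have "\<dots> = (\<integral>\<^sup>+v. k v * indicator E v * \<psi> (x(s := (SOME v. v \<in> E))) \<partial>M s) + (\<integral>\<^sup>+v. k v * indicator (space (M s) - E) v * \<psi> (x(s := v)) \<partial>M s)"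
      by (intro nn_integral_add) measurable
    also have "(\<integral>\<^sup>+v. k v * indicator E v * \<psi> (x(s := (SOME v. v \<in> E))) \<partial>M s) = (\<integral>\<^sup>+v. k v * indicator E v \<partial>M s) * \<psi> (x(s := (SOME v. v \<in> E)))"
      by (intro nn_integral_multc) measurable
    finally show ?thesis .
  qed
  have "(\<integral>\<^sup>+\<xi>. k (\<xi> s) * \<psi> \<xi> \<partial>PiM J M) = (\<integral>\<^sup>+x. \<integral>\<^sup>+v. k v * \<psi> (x(s := v)) \<partial>M s \<partial>PiM (J - {s}) M)"
    if [measurable]: "k \<in> borel_measurable (M s)" for k :: "'a \<Rightarrow> ennreal"
  proof -
    have "(\<lambda>\<xi>. k (\<xi> s) * \<psi> \<xi>) \<in> borel_measurable (PiM (insert s (J - {s})) M)" by measurable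
    from product_nn_integral_insert[OF JJ(2,3) this] show ?thesis using JJ(1) by simp
  qed
  moreover have "(\<integral>\<^sup>+v. h v * \<psi> (x(s := v)) \<partial>M s) = (\<integral>\<^sup>+v. h' v * \<psi> (x(s := v)) \<partial>M s)"
    if x: "x \<in> space (PiM (J - {s}) M)" for x
  proof -
    have "(\<integral>\<^sup>+v. h v * indicator (space (M s) - E) v * \<psi> (x(s := v)) \<partial>M s) =
      (\<integral>\<^sup>+v. h' v * indicator (space (M s) - E) v * \<psi> (x(s := v)) \<partial>M s)"
      by (intro nn_integral_cong) (auto simp: off indicator_def)
    then show ?thesis using split[OF x h(1)] split[OF x h(2)] int by simp
  qed
  ultimately show ?thesis by (simp cong: nn_integral_cong)
qed

text \<open>The coordinates are exchanged one at a time; S' collects those that already carry h'.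
  The product over the other coordinates does not contain the one being exchanged, so only \<phi>
  has to be constant on E in it.\<close>

lemma (in product_sigma_finite) nn_integral_prod_swap:
  fixes h h' :: "'a \<Rightarrow> ennreal" and \<phi> :: "('i \<Rightarrow> 'a) \<Rightarrow> ennreal"
  assumes J: "finite J" "S \<subseteq> J"
    and M: "\<And>s. s \<in> S \<Longrightarrow> M s = N"
    and E: "E \<in> sets N"
    and h: "h \<in> borel_measurable N" "h' \<in> borel_measurable N"
    and \<phi>[measurable]: "\<phi> \<in> borel_measurable (PiM J M)"
    and off: "\<And>v. v \<in> space N \<Longrightarrow> v \<notin> E \<Longrightarrow> h v = h' v"
    and int: "(\<integral>\<^sup>+v. h v * indicator E v \<partial>N) = (\<integral>\<^sup>+v. h' v * indicator E v \<partial>N)"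
    and const: "\<And>s \<xi> v w. s \<in> S \<Longrightarrow> v \<in> E \<Longrightarrow> w \<in> E \<Longrightarrow> \<phi> (\<xi>(s := v)) = \<phi> (\<xi>(s := w))"
  shows "(\<integral>\<^sup>+\<xi>. (\<Prod>s\<in>S. h (\<xi> s)) * \<phi> \<xi> \<partial>PiM J M) = (\<integral>\<^sup>+\<xi>. (\<Prod>s\<in>S. h' (\<xi> s)) * \<phi> \<xi> \<partial>PiM J M)"
proof -
  have fS: "finite S" using J finite_subset by auto
  have meas: "(\<lambda>\<xi>. h (\<xi> t)) \<in> borel_measurable (PiM J M)" "(\<lambda>\<xi>. h' (\<xi> t)) \<in> borel_measurable (PiM J M)" if "t \<in> S" for t
    using h M[OF that] that J by (auto intro!: measurable_compose[OF measurable_component_singleton])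
  have "(\<integral>\<^sup>+\<xi>. (\<Prod>s\<in>S. h (\<xi> s)) * \<phi> \<xi> \<partial>PiM J M) =
      (\<integral>\<^sup>+\<xi>. (\<Prod>s\<in>S'. h' (\<xi> s)) * (\<Prod>s\<in>S - S'. h (\<xi> s)) * \<phi> \<xi> \<partial>PiM J M)"
    if "S' \<subseteq> S" for S'
    using finite_subset[OF that fS] that
  proof (induction S')
    case (insert s S')
    then have s: "s \<in> S" "s \<in> J" "S - S' = insert s (S - insert s S')" using J by auto
    define \<psi> where "\<psi> \<xi> = (\<Prod>s\<in>S'. h' (\<xi> s)) * (\<Prod>s\<in>S - insert s S'. h (\<xi> s)) * \<phi> \<xi>" for \<xi>
    have \<psi>m: "\<psi> \<in> borel_measurable (PiM J M)"
      unfolding \<psi>_def by (intro borel_measurable_times_ennreal borel_measurable_prod_ennreal meas \<phi>) (use insert.prems in auto)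
    have \<psi>c: "\<psi> (\<xi>(s := v)) = \<psi> (\<xi>(s := w))" if "v \<in> E" "w \<in> E" for \<xi> v w
    proof -
      have "(\<Prod>t\<in>S'. h' ((\<xi>(s := z)) t)) = (\<Prod>t\<in>S'. h' (\<xi> t))"
        "(\<Prod>t\<in>S - insert s S'. h ((\<xi>(s := z)) t)) = (\<Prod>t\<in>S - insert s S'. h (\<xi> t))" for z
        using insert.hyps by (auto intro!: prod.cong)
      then show ?thesis unfolding \<psi>_def using const[OF s(1) that] by simp
    qed
    have "(\<integral>\<^sup>+\<xi>. (\<Prod>s\<in>S. h (\<xi> s)) * \<phi> \<xi> \<partial>PiM J M) = (\<integral>\<^sup>+\<xi>. h (\<xi> s) * \<psi> \<xi> \<partial>PiM J M)"
    proof -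
      have "(\<Prod>t\<in>S - S'. h (\<xi> t)) = h (\<xi> s) * (\<Prod>t\<in>S - insert s S'. h (\<xi> t))" for \<xi>
        using fS by (subst s(3), subst prod.insert) auto
      then show ?thesis using insert.prems insert.IH unfolding \<psi>_def by (simp add: mult_ac)
    qed
    also have "\<dots> = (\<integral>\<^sup>+\<xi>. h' (\<xi> s) * \<psi> \<xi> \<partial>PiM J M)"
      using E h off int M[OF s(1)] by (intro nn_integral_coordinate_swap[OF J(1) s(2) _ _ _ \<psi>m _ _ \<psi>c]) auto
    finally show ?case using insert.hyps unfolding \<psi>_def by (simp add: mult_ac)
  qed simp
  from this[of S] show ?thesis by simp
qed

text \<open>Here x plays the role of time: as it grows, more is revealed about the positions of the
  points lying in E x. Threshold events for W y with y \<le> x do not distinguish points of E x,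
  because E x lies inside E y; this is what the exchange lemma asks for.\<close>

lemma (in product_prob_space) ville_chain:
  fixes E :: "real \<Rightarrow> 'a set"
  assumes J: "finite J" "S \<subseteq> J"
    and M: "\<And>s. s \<in> S \<Longrightarrow> M s = N" and N: "prob_space N"
    and E[measurable]: "\<And>x. E x \<in> sets N" and anti: "\<And>x y. x \<le> y \<Longrightarrow> E y \<subseteq> E x"
    and Y: "finite Y" and pos: "\<And>x. x \<in> Y \<Longrightarrow> 0 < measure N (E x)"
    and c: "0 < c" and \<theta>: "0 < \<theta>"
    and W_def: "\<And>x \<xi>. W x \<xi> = (\<Prod>s\<in>S. 1 + (\<theta> / measure N (E x)) * indicator (E x) (\<xi> s))"
  shows "emeasure (PiM J M) {\<xi> \<in> space (PiM J M). \<exists>x\<in>Y. c \<le> W x \<xi>} \<le> ennreal ((1 + \<theta>) ^ card S / c)"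
proof -
  interpret N: prob_space N by fact
  define h where "h x v = ennreal (1 + (\<theta> / measure N (E x)) * indicator (E x) v)" for x v
  have fS: "finite S" using J finite_subset by auto
  have h1: "0 \<le> 1 + (\<theta> / measure N (E x)) * indicator (E x) v" for x v using \<theta> by (intro add_nonneg_nonneg) auto
  have Wh: "ennreal (W x \<xi>) = (\<Prod>s\<in>S. h x (\<xi> s))" for x \<xi>
    unfolding W_def h_def using h1 by (subst prod_ennreal) auto
  have hm[measurable]: "h x \<in> borel_measurable N" for x unfolding h_def by measurable
  have Wm[measurable]: "W x \<in> borel_measurable (PiM J M)" for x
    unfolding W_def
  proof (intro borel_measurable_prod borel_measurable_add borel_measurable_times borel_measurable_const)
    fix s assume s: "s \<in> S"
    then show "(\<lambda>\<xi>. indicator (E x) (\<xi> s)) \<in> borel_measurable (PiM J M)"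
      using J M[OF s] by (intro measurable_compose[OF measurable_component_singleton[of s J M]]) auto
  qed
  \<comment> \<open>The mass of the factor on E x is the same for every later b. Hence W b may be
    replaced by W x on events determined up to time x.\<close>
  have hE: "(\<integral>\<^sup>+v. h b v * indicator (E x) v \<partial>N) = ennreal (measure N (E x) + \<theta>)"
    if "x \<le> b" "0 < measure N (E b)" for x b
  proof -
    have "h b v * indicator (E x) v = ennreal (indicator (E x) v) + ennreal (\<theta> / measure N (E b)) * ennreal (indicator (E b) v)" for v
      using anti[OF that(1)] \<theta> by (auto simp: h_def indicator_def)
    then have "(\<integral>\<^sup>+v. h b v * indicator (E x) v \<partial>N) = emeasure N (E x) + ennreal (\<theta> / measure N (E b)) * emeasure N (E b)"
      by (simp add: nn_integral_add nn_integral_cmult ennreal_indicator)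
    then show ?thesis using that \<theta> by (simp add: N.emeasure_eq_measure ennreal_mult'[symmetric] ennreal_plus[symmetric] del: ennreal_plus)
  qed
  have EW: "(\<integral>\<^sup>+\<xi>. ennreal (W b \<xi>) \<partial>PiM J M) = ennreal ((1 + \<theta>) ^ card S)" if "0 < measure N (E b)" for b
  proof -
    have "(\<integral>\<^sup>+v. h b v \<partial>N) = ennreal (1 + \<theta>)"
    proof -
      have "h b v = 1 + ennreal (\<theta> / measure N (E b)) * ennreal (indicator (E b) v)" for v
        using \<theta> by (auto simp: h_def indicator_def)
      then have "(\<integral>\<^sup>+v. h b v \<partial>N) = 1 + ennreal (\<theta> / measure N (E b)) * emeasure N (E b)"
        by (simp add: nn_integral_add nn_integral_cmult ennreal_indicator N.emeasure_space_1)
      also have "\<dots> = ennreal (1 + \<theta>)"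
        using that \<theta> by (simp add: N.emeasure_eq_measure ennreal_mult'[symmetric])
      finally show ?thesis .
    qed
    moreover have "(\<integral>\<^sup>+\<xi>. ennreal (W b \<xi>) \<partial>PiM J M) = (\<integral>\<^sup>+\<xi>. (\<Prod>s\<in>J. (if s \<in> S then h b (\<xi> s) else 1)) \<partial>PiM J M)"
      using J fS by (simp add: Wh prod.If_cases Int_absorb1)
    moreover have "\<dots> = (\<Prod>s\<in>J. \<integral>\<^sup>+v. (if s \<in> S then h b v else 1) \<partial>M s)"
    proof (rule product_nn_integral_prod[OF J(1)])
      fix s assume "s \<in> J"
      show "(\<lambda>v. if s \<in> S then h b v else 1) \<in> borel_measurable (M s)"
        using M[of s] hm[of b] by (cases "s \<in> S") auto
    qed
    moreover have "\<dots> = (\<Prod>s\<in>J. if s \<in> S then ennreal (1 + \<theta>) else 1)"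
      using M calculation(1) by (intro prod.cong refl) (auto simp: M.emeasure_space_1)
    moreover have "\<dots> = ennreal ((1 + \<theta>) ^ card S)"
      using J \<theta> by (simp add: prod.If_cases Int_absorb1 ennreal_power del: ennreal_plus)
    ultimately show ?thesis by simp
  qed
  have sw: "(\<integral>\<^sup>+\<xi>. ennreal (W b \<xi>) * indicator {\<xi>. \<forall>y\<in>Z. W y \<xi> < c} \<xi> \<partial>PiM J M) =
      (\<integral>\<^sup>+\<xi>. ennreal (W x \<xi>) * indicator {\<xi>. \<forall>y\<in>Z. W y \<xi> < c} \<xi> \<partial>PiM J M)"
    if Z: "finite Z" "\<forall>y\<in>Z. y \<le> x" and xb: "x \<le> b" "0 < measure N (E b)" "0 < measure N (E x)" for Z x b
    unfolding Wh
  proof (rule nn_integral_prod_swap[OF J M E[of x]])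
    show "(\<lambda>\<xi>. indicator {\<xi>. \<forall>y\<in>Z. W y \<xi> < c} \<xi> :: ennreal) \<in> borel_measurable (PiM J M)"
      using Z by measurable
    show "h b v = h x v" if "v \<notin> E x" for v using that anti[OF xb(1)] by (auto simp: h_def indicator_def)
    show "(\<integral>\<^sup>+v. h b v * indicator (E x) v \<partial>N) = (\<integral>\<^sup>+v. h x v * indicator (E x) v \<partial>N)"
      using hE xb by simp
    fix s \<xi> v w assume s: "s \<in> S" "v \<in> E x" "w \<in> E x"
    have "W y (\<xi>(s := v)) = W y (\<xi>(s := w))" if "y \<in> Z" for y
      unfolding W_def using Z that s anti[of y x] by (intro prod.cong refl) (auto simp: indicator_def)
    then show "indicator {\<xi>. \<forall>y\<in>Z. W y \<xi> < c} (\<xi>(s := v)) = (indicator {\<xi>. \<forall>y\<in>Z. W y \<xi> < c} (\<xi>(s := w)) :: ennreal)"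
      by (auto simp: indicator_def)
  qed auto
  \<comment> \<open>Stopping at the first crossing: paths that have crossed count c, the others
    carry a later value W b. When a new largest point x joins Z, W b is pulled back to W x, and W x
    \<ge> c on the paths that cross at x.\<close>
  have main: "(\<integral>\<^sup>+\<xi>. ennreal c * indicator {\<xi>. \<exists>y\<in>Z. c \<le> W y \<xi>} \<xi> + ennreal (W b \<xi>) * indicator {\<xi>. \<forall>y\<in>Z. W y \<xi> < c} \<xi> \<partial>PiM J M)
      \<le> ennreal ((1 + \<theta>) ^ card S)"
    if "finite Z" "\<forall>y\<in>Z. y \<le> b \<and> 0 < measure N (E y)" "0 < measure N (E b)" for Z b
    using that
  proof (induction Z arbitrary: b rule: finite_linorder_max_induct)
    case empty
    then show ?case by (simp add: EW)
  next
    case (insert x Z)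
    have lt: "\<forall>y\<in>insert x Z. y \<le> x" using insert by auto
    have "(\<integral>\<^sup>+\<xi>. ennreal c * indicator {\<xi>. \<exists>y\<in>insert x Z. c \<le> W y \<xi>} \<xi> + ennreal (W b \<xi>) * indicator {\<xi>. \<forall>y\<in>insert x Z. W y \<xi> < c} \<xi> \<partial>PiM J M)
       = (\<integral>\<^sup>+\<xi>. ennreal c * indicator {\<xi>. \<exists>y\<in>insert x Z. c \<le> W y \<xi>} \<xi> \<partial>PiM J M)
        + (\<integral>\<^sup>+\<xi>. ennreal (W b \<xi>) * indicator {\<xi>. \<forall>y\<in>insert x Z. W y \<xi> < c} \<xi> \<partial>PiM J M)"
      using insert.hyps(1) by (intro nn_integral_add) measurable
    also have "(\<integral>\<^sup>+\<xi>. ennreal (W b \<xi>) * indicator {\<xi>. \<forall>y\<in>insert x Z. W y \<xi> < c} \<xi> \<partial>PiM J M)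
       = (\<integral>\<^sup>+\<xi>. ennreal (W x \<xi>) * indicator {\<xi>. \<forall>y\<in>insert x Z. W y \<xi> < c} \<xi> \<partial>PiM J M)"
      using insert.prems insert.hyps lt by (intro sw) auto
    also have "(\<integral>\<^sup>+\<xi>. ennreal c * indicator {\<xi>. \<exists>y\<in>insert x Z. c \<le> W y \<xi>} \<xi> \<partial>PiM J M) + \<dots>
       = (\<integral>\<^sup>+\<xi>. ennreal c * indicator {\<xi>. \<exists>y\<in>insert x Z. c \<le> W y \<xi>} \<xi> + ennreal (W x \<xi>) * indicator {\<xi>. \<forall>y\<in>insert x Z. W y \<xi> < c} \<xi> \<partial>PiM J M)"
      using insert.hyps(1) by (intro nn_integral_add[symmetric]) measurable
    also have "\<dots> \<le> (\<integral>\<^sup>+\<xi>. ennreal c * indicator {\<xi>. \<exists>y\<in>Z. c \<le> W y \<xi>} \<xi> + ennreal (W x \<xi>) * indicator {\<xi>. \<forall>y\<in>Z. W y \<xi> < c} \<xi> \<partial>PiM J M)"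
      by (intro nn_integral_mono) (auto simp: indicator_def not_less intro: ennreal_leI)
    also have "\<dots> \<le> ennreal ((1 + \<theta>) ^ card S)" using insert by (intro insert.IH) auto
    finally show ?case .
  qed
  show ?thesis
  proof (cases "Y = {}")
    case False
    let ?A = "{\<xi> \<in> space (PiM J M). \<exists>x\<in>Y. c \<le> W x \<xi>}"
    have A: "?A \<in> sets (PiM J M)" using Y by measurable
    have "ennreal c * emeasure (PiM J M) ?A = (\<integral>\<^sup>+\<xi>. ennreal c * indicator ?A \<xi> \<partial>PiM J M)"
      using A by (simp add: nn_integral_cmult)
    also have "\<dots> \<le> (\<integral>\<^sup>+\<xi>. ennreal c * indicator {\<xi>. \<exists>y\<in>Y. c \<le> W y \<xi>} \<xi> + ennreal (W (Max Y) \<xi>) * indicator {\<xi>. \<forall>y\<in>Y. W y \<xi> < c} \<xi> \<partial>PiM J M)"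
      by (intro nn_integral_mono) (auto simp: indicator_def)
    also have "\<dots> \<le> ennreal ((1 + \<theta>) ^ card S)" using False Y pos by (intro main) auto
    finally have "ennreal c * emeasure (PiM J M) ?A \<le> ennreal ((1 + \<theta>) ^ card S)" .
    interpret PJ: prob_space "PiM J M" by (intro prob_space_PiM M.prob_space_axioms)
    have "ennreal c * emeasure (PiM J M) ?A \<le> ennreal ((1 + \<theta>) ^ card S)" by fact
    then show ?thesis using c \<theta>
      by (simp add: PJ.emeasure_eq_measure ennreal_mult'[symmetric] pos_le_divide_eq mult.commute)
  qed simp
qed


lemma (in product_prob_space) dkw_finite_chain:
  fixes E :: "real \<Rightarrow> 'a set" and \<epsilon> :: real
  assumes J: "finite J" "S \<subseteq> J"
    and M: "\<And>s. s \<in> S \<Longrightarrow> M s = N" and N: "prob_space N"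
    and E[measurable]: "\<And>x. E x \<in> sets N" and anti: "\<And>x y. x \<le> y \<Longrightarrow> E y \<subseteq> E x"
    and Y: "finite Y" and \<epsilon>: "0 < \<epsilon>"
  shows "emeasure (PiM J M) {\<xi> \<in> space (PiM J M). \<exists>x\<in>Y. card S * (measure N (E x) + \<epsilon>) < (\<Sum>s\<in>S. indicator (E x) (\<xi> s))}
    \<le> ennreal (exp (- 2 * real (card S) * \<epsilon>\<^sup>2))" (is "emeasure _ ?B \<le> _")
proof -
  interpret N: prob_space N by fact
  have fS: "finite S" using J finite_subset by auto
  have cnt: "(\<Sum>s\<in>S. indicator (E x) (\<xi> s)) = (real (card {s \<in> S. \<xi> s \<in> E x}) :: real)" for x \<xi>
    using fS by (simp add: indicator_def sum.If_cases Int_def)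
  have cnt_le: "(\<Sum>s\<in>S. indicator (E x) (\<xi> s)) \<le> real (card S)" for x \<xi>
    unfolding cnt using fS by (auto intro: card_mono)
  show ?thesis
  proof (cases "\<epsilon> < 1 \<and> S \<noteq> {}")
    case False
    have "?B = {}"
    proof -
      have "(\<Sum>s\<in>S. indicator (E x) (\<xi> s)) \<le> card S * (measure N (E x) + \<epsilon>)" for x \<xi>
      proof (cases "S = {}")
        case False
        then have "1 \<le> measure N (E x) + \<epsilon>" using \<open>\<not> (\<epsilon> < 1 \<and> S \<noteq> {})\<close> by (simp add: add_increasing)
        then have "real (card S) * 1 \<le> card S * (measure N (E x) + \<epsilon>)" by (rule mult_left_mono) simp
        then show ?thesis using cnt_le[of x \<xi>] by simp
      qed simp
      then show ?thesis by (auto simp: not_less[symmetric])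
    qed
    then show ?thesis by (simp only: emeasure_empty zero_le)
  next
    case True
    obtain \<theta> where \<theta>: "0 < \<theta>"
      "\<And>p. 0 < p \<Longrightarrow> p + \<epsilon> \<le> 1 \<Longrightarrow> 2 * \<epsilon>\<^sup>2 + ln (1 + \<theta>) \<le> (p + \<epsilon>) * ln (1 + \<theta> / p)"
      using ville_parameter_exists[OF \<epsilon>] True by auto
    define W where "W x \<xi> = (\<Prod>s\<in>S. 1 + (\<theta> / measure N (E x)) * indicator (E x) (\<xi> s))" for x \<xi>
    \<comment> \<open>By the choice of \<theta>, more than card S (p + \<epsilon>) hits force W x
      \<ge> c, uniformly in p. Dividing the mean (1 + \<theta>)^card S by c leaves exp (-2 card S
      \<epsilon>^2).\<close>
    define c where "c = exp (card S * (2 * \<epsilon>\<^sup>2 + ln (1 + \<theta>)))"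
    let ?Y = "{x \<in> Y. 0 < measure N (E x)}"
    \<comment> \<open>For events of probability 0 the factor \<theta> / p is meaningless; a sample
      point falls into one of them only on a null set.\<close>
    let ?Z = "{x \<in> Y. measure N (E x) = 0}"
    let ?A = "{\<xi> \<in> space (PiM J M). \<exists>x\<in>?Y. c \<le> W x \<xi>}"
    let ?N = "\<Union>x\<in>?Z. \<Union>s\<in>S. {\<xi> \<in> space (PiM J M). \<xi> s \<in> E x}"
    have Ec: "{\<xi> \<in> space (PiM J M). \<xi> s \<in> E x} \<in> sets (PiM J M)"
      "emeasure (PiM J M) {\<xi> \<in> space (PiM J M). \<xi> s \<in> E x} = emeasure N (E x)" if s: "s \<in> S" for s x
    proof -
      let ?F = "\<lambda>t. if t = s then E x else space (M t)"
      have sJ: "s \<in> J" and Ms: "E x \<in> sets (M s)" using s J M[OF s] E by auto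
      have *: "{\<xi> \<in> space (PiM J M). \<xi> s \<in> E x} = Pi\<^sub>E J ?F"
      proof -
        have "((\<forall>t\<in>J. \<xi> t \<in> space (M t)) \<and> \<xi> s \<in> E x) = (\<forall>t\<in>J. \<xi> t \<in> ?F t)" for \<xi>
          using sJ subsetD[OF Ms[THEN sets.sets_into_space], of "\<xi> s"] by metis
        then show ?thesis by (intro set_eqI) (simp only: mem_Collect_eq space_PiM PiE_iff, blast)
      qed
      show "{\<xi> \<in> space (PiM J M). \<xi> s \<in> E x} \<in> sets (PiM J M)"
        unfolding * using Ms J by (intro sets_PiM_I_finite) auto
      have "emeasure (PiM J M) (Pi\<^sub>E J ?F) = (\<Prod>t\<in>J. emeasure (M t) (?F t))"
        using Ms J by (intro emeasure_PiM) auto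
      also have "\<dots> = (\<Prod>t\<in>J. if t = s then emeasure N (E x) else 1)"
        using M[OF s] by (intro prod.cong) (auto simp: M.emeasure_space_1)
      also have "\<dots> = emeasure N (E x)" using J sJ by simp
      finally show "emeasure (PiM J M) {\<xi> \<in> space (PiM J M). \<xi> s \<in> E x} = emeasure N (E x)"
        unfolding * .
    qed
    have Nn: "?N \<in> null_sets (PiM J M)"
      using Y fS by (intro null_sets_UN' null_setsI) (auto simp: Ec N.emeasure_eq_measure intro: countable_finite)
    have Am: "?A \<in> sets (PiM J M)"
    proof -
      have "W x \<in> borel_measurable (PiM J M)" for x
        unfolding W_def
      proof (intro borel_measurable_prod borel_measurable_add borel_measurable_times borel_measurable_const)
        fix s assume s: "s \<in> S"
        then show "(\<lambda>\<xi>. indicator (E x) (\<xi> s)) \<in> borel_measurable (PiM J M)"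
          using J M[OF s] by (intro measurable_compose[OF measurable_component_singleton[of s J M]]) auto
      qed
      then have "{\<xi> \<in> space (PiM J M). c \<le> W x \<xi>} \<in> sets (PiM J M)" for x
        by (intro borel_measurable_le borel_measurable_const) auto
      then show ?thesis using Y by (intro sets.sets_Collect_finite_Ex) auto
    qed
    have sub: "?B \<subseteq> ?A \<union> ?N"
    proof
      fix \<xi> assume "\<xi> \<in> ?B"
      then obtain x where x: "\<xi> \<in> space (PiM J M)" "x \<in> Y" "card S * (measure N (E x) + \<epsilon>) < (\<Sum>s\<in>S. indicator (E x) (\<xi> s))"
        by auto
      let ?p = "measure N (E x)"
      let ?k = "card {s \<in> S. \<xi> s \<in> E x}"
      show "\<xi> \<in> ?A \<union> ?N"
      proof (cases "?p = 0")
        case True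
        then have "0 < (\<Sum>s\<in>S. indicator (E x) (\<xi> s) :: real)"
          using x(3) \<epsilon> by (smt (verit) mult_nonneg_nonneg of_nat_0_le_iff)
        then have "{s \<in> S. \<xi> s \<in> E x} \<noteq> {}" unfolding cnt by (auto simp only: of_nat_0_less_iff card_gt_0_iff)
        then show ?thesis using x True by auto
      next
        case False
        then have p: "0 < ?p" using zero_less_measure_iff by blast
        have cS: "0 < real (card S)" using True fS by (simp add: card_gt_0_iff)
        have "card S * (?p + \<epsilon>) < card S * 1" using x(3) cnt_le[of x \<xi>] by simp
        then have p1: "?p + \<epsilon> \<le> 1" using cS by simp
        have "c \<le> exp (card S * ((?p + \<epsilon>) * ln (1 + \<theta> / ?p)))"
          unfolding c_def using \<theta>(2)[OF p p1] cS by simp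
        also have "\<dots> \<le> exp (?k * ln (1 + \<theta> / ?p))"
        proof -
          have "0 \<le> ln (1 + \<theta> / ?p)" using \<theta>(1) by simp
          then have "(card S * (?p + \<epsilon>)) * ln (1 + \<theta> / ?p) \<le> ?k * ln (1 + \<theta> / ?p)"
            using x(3) unfolding cnt by (intro mult_right_mono) auto
          then show ?thesis by (simp add: mult.assoc)
        qed
        also have "\<dots> = (1 + \<theta> / ?p) ^ ?k"
        proof -
          have "0 < 1 + \<theta> / ?p" using \<theta>(1) p by (simp add: add_pos_pos)
          then show ?thesis by (simp add: exp_of_nat_mult)
        qed
        also have "\<dots> = W x \<xi>"
        proof -
          have "W x \<xi> = (\<Prod>s\<in>S. if \<xi> s \<in> E x then 1 + \<theta> / ?p else 1)"
            unfolding W_def by (intro prod.cong) auto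
          then show ?thesis using fS by (simp add: prod.If_cases Int_def)
        qed
        finally show ?thesis using x p by auto
      qed
    qed
    have "emeasure (PiM J M) ?B \<le> emeasure (PiM J M) (?A \<union> ?N)"
      using sub Am Nn by (intro emeasure_mono) auto
    also have "\<dots> = emeasure (PiM J M) ?A" using Am Nn by (rule emeasure_Un_null_set)
    also have "\<dots> \<le> ennreal ((1 + \<theta>) ^ card S / c)"
      using \<theta>(1) by (intro ville_chain[OF J M N E anti _ _ _ _ W_def]) (auto simp: Y c_def)
    also have "(1 + \<theta>) ^ card S / c = exp (- 2 * real (card S) * \<epsilon>\<^sup>2)"
    proof -
      have "c = exp (2 * real (card S) * \<epsilon>\<^sup>2) * (1 + \<theta>) ^ card S"
        using \<theta>(1) by (simp add: c_def distrib_left exp_add exp_of_nat_mult mult_ac)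
      then show ?thesis using \<theta>(1) by (simp add: exp_minus field_simps)
    qed
    finally show ?thesis .
  qed
qed

text \<open>Continuity from below passes from finite to countable index sets, which suffices for
  cdfs by right continuity.\<close>

lemma (in product_prob_space) dkw_chain:
  fixes E :: "real \<Rightarrow> 'a set" and \<epsilon> :: real
  assumes J: "finite J" "S \<subseteq> J"
    and M: "\<And>s. s \<in> S \<Longrightarrow> M s = N" and N: "prob_space N"
    and E[measurable]: "\<And>x. E x \<in> sets N" and anti: "\<And>x y. x \<le> y \<Longrightarrow> E y \<subseteq> E x"
    and Y: "countable Y" "Y \<noteq> {}" and \<epsilon>: "0 < \<epsilon>"
  shows "emeasure (PiM J M) {\<xi> \<in> space (PiM J M). \<exists>x\<in>Y. card S * (measure N (E x) + \<epsilon>) < (\<Sum>s\<in>S. indicator (E x) (\<xi> s))}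
    \<le> ennreal (exp (- 2 * real (card S) * \<epsilon>\<^sup>2))"
proof -
  define B where "B Z = {\<xi> \<in> space (PiM J M). \<exists>x\<in>Z. card S * (measure N (E x) + \<epsilon>) < (\<Sum>s\<in>S. indicator (E x) (\<xi> s))}" for Z
  define Z where "Z n = from_nat_into Y ` {..<n}" for n :: nat
  have UZ: "Y = (\<Union>n. Z n)"
    using range_from_nat_into[OF Y(2,1)] by (auto simp: Z_def)
  have m: "B (Z n) \<in> sets (PiM J M)" for n
  proof -
    have "(\<lambda>\<xi>. indicat_real (E x) (\<xi> s)) \<in> borel_measurable (PiM J M)" if s: "s \<in> S" for s x
      using J s M[OF s] by (intro measurable_compose[OF measurable_component_singleton[of s J M]]) auto
    then have [measurable]: "(\<lambda>\<xi>. \<Sum>s\<in>S. indicat_real (E x) (\<xi> s)) \<in> borel_measurable (PiM J M)" for x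
      by (intro borel_measurable_sum)
    have "finite (Z n)" by (simp add: Z_def)
    then show ?thesis unfolding B_def by measurable
  qed
  have "B Y = (\<Union>n. B (Z n))" unfolding UZ B_def by auto
  also have "emeasure (PiM J M) \<dots> = (SUP n. emeasure (PiM J M) (B (Z n)))"
  proof (rule SUP_emeasure_incseq[symmetric])
    have "Z i \<subseteq> Z j" if "i \<le> j" for i j using that by (auto simp: Z_def)
    then show "incseq (\<lambda>n. B (Z n))" unfolding incseq_def B_def by blast
  qed (use m in auto)
  also have "\<dots> \<le> ennreal (exp (- 2 * real (card S) * \<epsilon>\<^sup>2))"
    unfolding B_def by (intro SUP_least dkw_finite_chain[OF J M N E anti _ \<epsilon>]) (auto simp: Z_def)
  finally show ?thesis unfolding B_def .
qed


section \<open>The Kolmogorov distance of a sample\<close>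

lemma abs_le_of_rational_right_cont:
  fixes f :: "real \<Rightarrow> real"
  assumes "\<And>x. continuous (at_right x) f" "\<And>q. q \<in> \<rat> \<Longrightarrow> \<bar>f q\<bar> \<le> c"
  shows "\<bar>f x\<bar> \<le> c"
proof (rule ccontr)
  assume "\<not> \<bar>f x\<bar> \<le> c"
  then have "c < \<bar>f x\<bar>" by simp
  moreover have "((\<lambda>y. \<bar>f y\<bar>) \<longlongrightarrow> \<bar>f x\<bar>) (at_right x)"
    using assms(1)[of x] by (auto simp: continuous_within intro: tendsto_rabs)
  ultimately have "eventually (\<lambda>y. c < \<bar>f y\<bar>) (at_right x)" by (metis order_tendstoD(1))
  then obtain b where b: "x < b" "\<And>y. x < y \<Longrightarrow> y < b \<Longrightarrow> c < \<bar>f y\<bar>"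
    by (auto simp: eventually_at_right_field)
  obtain q where "q \<in> \<rat>" "x < q" "q < b" using Rats_dense_in_real[OF b(1)] by auto
  then show False using b(2)[of q] assms(2)[of q] by auto
qed

lemma indicator_atMost_right_cont:
  fixes x v :: real
  shows "continuous (at_right x) (\<lambda>x. indicat_real {..x} v)"
proof (cases "v \<le> x")
  case True
  have "eventually (\<lambda>y. indicat_real {..y} v = indicat_real {..x} v) (at_right x)"
    using True by (auto simp: eventually_at_right_field intro!: exI[of _ "x + 1"])
  then show ?thesis unfolding continuous_within by (rule tendsto_eventually)
next
  case False
  have "eventually (\<lambda>y. indicat_real {..y} v = indicat_real {..x} v) (at_right x)"
    using False by (auto simp: eventually_at_right_field intro!: exI[of _ v])
  then show ?thesis unfolding continuous_within by (rule tendsto_eventually)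
qed

text \<open>The unnormalized Kolmogorov distance: \<^term>\<open>card S\<close> times the distance between the empirical
  cdf of the coordinates in \<open>S\<close> and the cdf of \<open>N\<close>.\<close>

definition edev :: "real measure \<Rightarrow> 'i set \<Rightarrow> ('i \<Rightarrow> real) \<Rightarrow> real" where
  "edev N S \<xi> = (SUP x. \<bar>(\<Sum>s\<in>S. indicat_real {..x} (\<xi> s)) - card S * measure N {..x}\<bar>)"

context
  fixes N :: "real measure"
  assumes N: "prob_space N" "sets N = sets borel"
begin

interpretation N: prob_space N by (rule N)

lemma edev_right_cont:
  "continuous (at_right x) (\<lambda>x. (\<Sum>s\<in>S. indicat_real {..x} (\<xi> s)) - card S * measure N {..x})"
proof -
  interpret real_distribution N using N by (intro real_distribution.intro real_distribution_axioms.intro)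
    (auto simp: sets_eq_imp_space_eq[OF N(2)])
  have "continuous (at_right x) (cdf N)" by (rule cdf_is_right_cont)
  then have "continuous (at_right x) (\<lambda>x. measure N {..x})" by (simp add: cdf_def[abs_def])
  then show ?thesis by (intro continuous_intros indicator_atMost_right_cont)
qed

lemma edev_term_le: "\<bar>(\<Sum>s\<in>S. indicat_real {..x} (\<xi> s)) - card S * measure N {..x}\<bar> \<le> card S"
proof -
  have "0 \<le> (\<Sum>s\<in>S. indicat_real {..x} (\<xi> s))" by (intro sum_nonneg) auto
  moreover have "(\<Sum>s\<in>S. indicat_real {..x} (\<xi> s)) \<le> card S"
    using sum_bounded_above[of S "\<lambda>s. indicat_real {..x} (\<xi> s)" 1] by simp
  moreover have "card S * measure N {..x} \<le> real (card S) * 1" by (intro mult_left_mono) auto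
  moreover have "0 \<le> card S * measure N {..x}" by simp
  ultimately show ?thesis by linarith
qed

lemma edev_bdd: "bdd_above (range (\<lambda>x. \<bar>(\<Sum>s\<in>S. indicat_real {..x} (\<xi> s)) - card S * measure N {..x}\<bar>))"
  using edev_term_le by (intro bdd_aboveI) auto

lemma edev_upper: "\<bar>(\<Sum>s\<in>S. indicat_real {..x} (\<xi> s)) - card S * measure N {..x}\<bar> \<le> edev N S \<xi>"
  unfolding edev_def by (rule cSUP_upper[OF _ edev_bdd]) simp

lemma edev_nonneg: "0 \<le> edev N S \<xi>"
  using edev_upper[where x = 0 and S = S and \<xi> = \<xi>] by linarith

lemma edev_le_card: "edev N S \<xi> \<le> card S"
  unfolding edev_def by (intro cSUP_least edev_term_le) auto

text \<open>Right continuity in x reduces the supremum to rational x. Both measurability and the use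
  of countable chains rest on this.\<close>

lemma less_edev_iff:
  "y < edev N S \<xi> \<longleftrightarrow> (\<exists>x\<in>\<rat>. y < \<bar>(\<Sum>s\<in>S. indicat_real {..x} (\<xi> s)) - card S * measure N {..x}\<bar>)"
proof
  assume y: "y < edev N S \<xi>"
  show "\<exists>x\<in>\<rat>. y < \<bar>(\<Sum>s\<in>S. indicat_real {..x} (\<xi> s)) - card S * measure N {..x}\<bar>"
  proof (rule ccontr)
    assume "\<not> ?thesis"
    then have "\<bar>(\<Sum>s\<in>S. indicat_real {..q} (\<xi> s)) - card S * measure N {..q}\<bar> \<le> y" if "q \<in> \<rat>" for q
      using that by (meson not_less)
    then have "\<bar>(\<Sum>s\<in>S. indicat_real {..x} (\<xi> s)) - card S * measure N {..x}\<bar> \<le> y" for x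
      by (rule abs_le_of_rational_right_cont[OF edev_right_cont])
    then have "edev N S \<xi> \<le> y" unfolding edev_def by (intro cSUP_least) auto
    with y show False by simp
  qed
qed (use edev_upper less_le_trans in fast)

lemma edev_measurable:
  assumes S: "finite S" "S \<subseteq> J" "\<And>s. s \<in> S \<Longrightarrow> sets (M s) = sets borel"
  shows "edev N S \<in> borel_measurable (PiM J M)"
proof (subst borel_measurable_iff_greater, intro allI)
  fix y
  have [measurable]: "(\<lambda>\<xi>. \<Sum>s\<in>S. indicat_real {..x} (\<xi> s)) \<in> borel_measurable (PiM J M)" for x
  proof (intro borel_measurable_sum)
    fix s assume s: "s \<in> S"
    then have "(\<lambda>\<xi>. \<xi> s) \<in> measurable (PiM J M) (M s)" using S by (intro measurable_component_singleton) auto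
    then have [measurable]: "(\<lambda>\<xi>. \<xi> s) \<in> measurable (PiM J M) borel"
      using measurable_cong_sets[OF refl S(3)[OF s], of "PiM J M"] by blast
    show "(\<lambda>\<xi>. indicat_real {..x} (\<xi> s)) \<in> borel_measurable (PiM J M)" by measurable
  qed
  have "countable \<rat>" by (rule countable_rat)
  then show "{\<xi> \<in> space (PiM J M). y < edev N S \<xi>} \<in> sets (PiM J M)"
    unfolding less_edev_iff by measurable
qed

lemma edev_update_measurable: "(\<lambda>v. edev N S (\<xi>(s := v))) \<in> borel_measurable N"
proof (subst borel_measurable_iff_greater, intro allI)
  fix y
  have [measurable]: "(\<lambda>v. \<Sum>t\<in>S. indicat_real {..x} ((\<xi>(s := v)) t)) \<in> borel_measurable N" for x
  proof (intro borel_measurable_sum)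
    fix t
    show "(\<lambda>v. indicat_real {..x} ((\<xi>(s := v)) t)) \<in> borel_measurable N"
      using N(2) by (cases "t = s") (auto simp: measurable_cong_sets[OF N(2) refl])
  qed
  have "countable \<rat>" by (rule countable_rat)
  then show "{v \<in> space N. y < edev N S (\<xi>(s := v))} \<in> sets N"
    unfolding less_edev_iff by measurable
qed

lemma integrable_edev_update: "integrable N (\<lambda>v. edev N S (\<xi>(s := v)))"
  using edev_le_card[of S] edev_nonneg[of S] edev_update_measurable
  by (intro N.integrable_const_bound[where B="card S"]) auto

text \<open>At each x a fresh observation contributes an increment of mean 0, and the supremum of
  absolute values is convex: the norm of a random walk is a submartingale.\<close>

lemma edev_insert_ge:
  assumes S: "finite S" "s \<notin> S" 
  shows "edev N S \<xi> \<le> (\<integral>v. edev N (insert s S) (\<xi>(s := v)) \<partial>N)"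
proof -
  have ii: "integrable N (\<lambda>v. indicat_real {..x} v)" for x
    using N(2) by (intro N.integrable_const_bound[where B=1]) (auto simp: indicator_def measurable_cong_sets[OF N(2) refl])
  show ?thesis
    unfolding edev_def[of N S]
  proof (intro cSUP_least)
    fix x
    let ?a = "(\<Sum>t\<in>S. indicat_real {..x} (\<xi> t)) - card S * measure N {..x}"
    let ?b = "\<lambda>v. ?a + (indicat_real {..x} v - measure N {..x})"
    have "(\<integral>v. ?b v \<partial>N) = ?a" using ii N.prob_space N(2) by (simp add: N.prob_space)
    then have "\<bar>?a\<bar> = \<bar>\<integral>v. ?b v \<partial>N\<bar>" by simp
    also have "\<dots> \<le> (\<integral>v. \<bar>?b v\<bar> \<partial>N)" by (rule integral_abs_bound)
    also have "\<dots> \<le> (\<integral>v. edev N (insert s S) (\<xi>(s := v)) \<partial>N)"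
    proof (intro integral_mono integrable_edev_update)
      show "integrable N (\<lambda>v. \<bar>?b v\<bar>)" using ii by simp
      fix v
      have "(\<Sum>t\<in>S. indicat_real {..x} ((\<xi>(s := v)) t)) = (\<Sum>t\<in>S. indicat_real {..x} (\<xi> t))"
        using S by (intro sum.cong) auto
      then have b: "?b v = (\<Sum>t\<in>insert s S. indicat_real {..x} ((\<xi>(s := v)) t)) - card (insert s S) * measure N {..x}"
        using S by (simp add: algebra_simps)
      show "\<bar>?b v\<bar> \<le> edev N (insert s S) (\<xi>(s := v))" unfolding b by (rule edev_upper)
    qed
    finally show "\<bar>?a\<bar> \<le> (\<integral>v. edev N (insert s S) (\<xi>(s := v)) \<partial>N)" .
  qed simp
qed

lemma dkw:
  fixes M :: "'i \<Rightarrow> real measure" and \<epsilon> :: real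
  assumes M: "\<And>i. prob_space (M i)" "finite J" "S \<subseteq> J" "\<And>s. s \<in> S \<Longrightarrow> M s = N" and \<epsilon>: "0 \<le> \<epsilon>"
  shows "measure (PiM J M) {\<xi> \<in> space (PiM J M). card S * \<epsilon> < edev N S \<xi>} \<le> 2 * exp (- 2 * real (card S) * \<epsilon>\<^sup>2)"
proof -
  interpret M: product_prob_space M UNIV by (rule product_prob_spaceI M)+
  interpret PJ: prob_space "PiM J M" by (intro prob_space_PiM M)
  show ?thesis
  proof (cases "\<epsilon> = 0")
    case True
    then show ?thesis by (auto intro: order_trans[OF PJ.prob_le_1])
  next
    case False
    have fS: "finite S" using M(2,3) finite_subset by auto
    define A where "A E = {\<xi> \<in> space (PiM J M). \<exists>x\<in>\<rat>. card S * (measure N (E x) + \<epsilon>) < (\<Sum>s\<in>S. indicat_real (E x) (\<xi> s))}"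
      for E :: "real \<Rightarrow> real set"
    have A_le: "measure (PiM J M) (A E) \<le> exp (- 2 * real (card S) * \<epsilon>\<^sup>2)"
      if "\<And>x. E x \<in> sets borel" "\<And>x y. x \<le> y \<Longrightarrow> E y \<subseteq> E x" for E
    proof -
      have "emeasure (PiM J M) (A E) \<le> ennreal (exp (- 2 * real (card S) * \<epsilon>\<^sup>2))"
        unfolding A_def using False \<epsilon> that N countable_rat
        by (intro M.dkw_chain[OF M(2,3,4)]) (auto intro: Rats_0)
      then show ?thesis by (simp add: PJ.emeasure_eq_measure)
    qed
    have Am: "A E \<in> sets (PiM J M)" if "\<And>x. E x \<in> sets borel" for E
    proof -
      have [measurable]: "(\<lambda>\<xi>. \<Sum>s\<in>S. indicat_real (E x) (\<xi> s)) \<in> borel_measurable (PiM J M)" for x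
      proof (intro borel_measurable_sum)
        fix s assume s: "s \<in> S"
        then have "(\<lambda>\<xi>. \<xi> s) \<in> measurable (PiM J M) (M s)" using M by (intro measurable_component_singleton) auto
        then have "(\<lambda>\<xi>. \<xi> s) \<in> measurable (PiM J M) borel"
          using measurable_cong_sets[OF refl N(2), of "PiM J M"] M(4)[OF s] by simp
        then show "(\<lambda>\<xi>. indicat_real (E x) (\<xi> s)) \<in> borel_measurable (PiM J M)"
          using that by (auto intro!: measurable_compose[OF _ borel_measurable_indicator])
      qed
      have "countable \<rat>" by (rule countable_rat)
      then show ?thesis unfolding A_def by measurable
    qed
    \<comment> \<open>A downward deviation at x is an upward deviation of the count in {x<..}. The
      sets {..x} are indexed by -x because the chain has to shrink as its index grows.\<close>
    have "{\<xi> \<in> space (PiM J M). card S * \<epsilon> < edev N S \<xi>} \<subseteq> A (\<lambda>z. {..- z}) \<union> A (\<lambda>z. {z<..})"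
    proof
      fix \<xi> assume "\<xi> \<in> {\<xi> \<in> space (PiM J M). card S * \<epsilon> < edev N S \<xi>}"
      then obtain x where \<xi>: "\<xi> \<in> space (PiM J M)" and x: "x \<in> \<rat>"
        "card S * \<epsilon> < \<bar>(\<Sum>s\<in>S. indicat_real {..x} (\<xi> s)) - card S * measure N {..x}\<bar>"
        by (auto simp: less_edev_iff)
      have c: "indicat_real {x<..} v = 1 - indicat_real {..x} v" for v by (auto simp: indicator_def)
      have "{x<..} = space N - {..x}" using sets_eq_imp_space_eq[OF N(2)] by auto
      then have mc: "measure N {x<..} = 1 - measure N {..x}" using N.prob_compl[of "{..x}"] N(2) by simp
      consider "card S * (measure N {..x} + \<epsilon>) < (\<Sum>s\<in>S. indicat_real {..x} (\<xi> s))"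
        | "card S * (measure N {x<..} + \<epsilon>) < (\<Sum>s\<in>S. indicat_real {x<..} (\<xi> s))"
        using x(2) unfolding mc c by (simp add: sum_subtractf algebra_simps abs_real_def split: if_splits)
      then show "\<xi> \<in> A (\<lambda>z. {..- z}) \<union> A (\<lambda>z. {z<..})"
      proof cases
        case 1
        then show ?thesis using \<xi> x(1) by (auto simp: A_def intro!: bexI[of _ "- x"])
      qed (use \<xi> x(1) in \<open>auto simp: A_def\<close>)
    qed
    then have "measure (PiM J M) {\<xi> \<in> space (PiM J M). card S * \<epsilon> < edev N S \<xi>}
      \<le> measure (PiM J M) (A (\<lambda>z. {..- z}) \<union> A (\<lambda>z. {z<..}))"
      by (intro PJ.finite_measure_mono) (auto intro!: Am)
    also have "\<dots> \<le> measure (PiM J M) (A (\<lambda>z. {..- z})) + measure (PiM J M) (A (\<lambda>z. {z<..}))"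
      by (intro measure_Un_le Am) auto
    also have "\<dots> \<le> exp (- 2 * real (card S) * \<epsilon>\<^sup>2) + exp (- 2 * real (card S) * \<epsilon>\<^sup>2)" by (intro add_mono A_le) auto
    finally show ?thesis by simp
  qed
qed

end


section \<open>Moments and maximal inequalities\<close>

text \<open>G (U) - G 0 is the integral of g over [0, U]; exchanging the integrals turns every tail
  bound below into a moment bound.\<close>

lemma (in prob_space) nn_integral_layer_cake:
  fixes U :: "'a \<Rightarrow> real" and g G :: "real \<Rightarrow> real"
  assumes U[measurable]: "U \<in> borel_measurable M" and U0: "\<And>\<omega>. \<omega> \<in> space M \<Longrightarrow> 0 \<le> U \<omega>"
    and g[measurable]: "g \<in> borel_measurable borel"
    and G: "\<And>x. 0 \<le> x \<Longrightarrow> (G has_real_derivative g x) (at x)" "\<And>x. 0 \<le> x \<Longrightarrow> 0 \<le> g x"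
  shows "(\<integral>\<^sup>+\<omega>. ennreal (G (U \<omega>) - G 0) \<partial>M) =
    (\<integral>\<^sup>+x. ennreal (g x) * indicator {0..} x * emeasure M {\<omega> \<in> space M. x < U \<omega>} \<partial>lborel)"
proof -
  interpret pair_sigma_finite M lborel ..
  have "(\<integral>\<^sup>+\<omega>. ennreal (G (U \<omega>) - G 0) \<partial>M) =
    (\<integral>\<^sup>+\<omega>. \<integral>\<^sup>+x. ennreal (g x) * indicator {0..} x * indicator {\<omega> \<in> space M. x < U \<omega>} \<omega> \<partial>lborel \<partial>M)"
  proof (intro nn_integral_cong)
    fix \<omega> assume \<omega>: "\<omega> \<in> space M"
    have "ennreal (G (U \<omega>) - G 0) = (\<integral>\<^sup>+x. ennreal (g x) * indicator {0..U \<omega>} x \<partial>lborel)"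
      using U0[OF \<omega>] G by (intro nn_integral_FTC_Icc[symmetric]) (auto intro: has_field_derivative_at_within)
    also have "\<dots> = (\<integral>\<^sup>+x. ennreal (g x) * indicator {0..} x * indicator {\<omega> \<in> space M. x < U \<omega>} \<omega> \<partial>lborel)"
      using AE_lborel_singleton[of "U \<omega>"] \<omega> by (intro nn_integral_cong_AE) (auto simp: indicator_def)
    finally show "ennreal (G (U \<omega>) - G 0) = \<dots>" .
  qed
  also have "\<dots> = (\<integral>\<^sup>+x. \<integral>\<^sup>+\<omega>. ennreal (g x) * indicator {0..} x * indicator {\<omega> \<in> space M. x < U \<omega>} \<omega> \<partial>M \<partial>lborel)"
    by (rule Fubini'[symmetric]) measurable
  also have "\<dots> = (\<integral>\<^sup>+x. ennreal (g x) * indicator {0..} x * emeasure M {\<omega> \<in> space M. x < U \<omega>} \<partial>lborel)"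
    by (intro nn_integral_cong) (simp add: nn_integral_cmult)
  finally show ?thesis .
qed

lemma (in prob_space) expectation_le_of_exp_tail:
  fixes U :: "'a \<Rightarrow> real"
  assumes U[measurable]: "U \<in> borel_measurable M" and U0: "\<And>\<omega>. \<omega> \<in> space M \<Longrightarrow> 0 \<le> U \<omega>"
    and D: "1 \<le> D" and tail: "\<And>x. 0 \<le> x \<Longrightarrow> prob {\<omega> \<in> space M. x < U \<omega>} \<le> D * exp (- x)"
  shows "expectation U \<le> 1 + ln D"
proof -
  have l: "0 \<le> ln D" using D by simp
  have "(\<integral>\<^sup>+\<omega>. ennreal (U \<omega>) \<partial>M) = (\<integral>\<^sup>+\<omega>. ennreal (U \<omega> - 0) \<partial>M)" by simp
  also have "\<dots> = (\<integral>\<^sup>+x. ennreal 1 * indicator {0..} x * emeasure M {\<omega> \<in> space M. x < U \<omega>} \<partial>lborel)"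
    by (rule nn_integral_layer_cake[where G = "\<lambda>x. x"]) (use U0 in auto)
  \<comment> \<open>The bound D exp (-x) falls below 1 only at ln D; up to there the trivial bound 1
    is used, and the rest integrates to 1.\<close>
  also have "\<dots> \<le> (\<integral>\<^sup>+x. ennreal 1 * indicator {0..ln D} x + ennreal (D * exp (- x)) * indicator {ln D..} x \<partial>lborel)"
  proof (intro nn_integral_mono)
    fix x :: real
    have "emeasure M {\<omega> \<in> space M. x < U \<omega>} \<le> ennreal (D * exp (- x))" if "0 \<le> x"
      using tail[OF that] D by (simp add: emeasure_eq_measure)
    moreover have "emeasure M {\<omega> \<in> space M. x < U \<omega>} \<le> 1" by (rule emeasure_le_1)
    ultimately show "ennreal 1 * indicator {0..} x * emeasure M {\<omega> \<in> space M. x < U \<omega>} \<le>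
      ennreal 1 * indicator {0..ln D} x + ennreal (D * exp (- x)) * indicator {ln D..} x"
      using l by (auto simp: indicator_def intro: add_increasing2)
  qed
  also have "\<dots> = (\<integral>\<^sup>+x. ennreal 1 * indicator {0..ln D} x \<partial>lborel) + (\<integral>\<^sup>+x. ennreal (D * exp (- x)) * indicator {ln D..} x \<partial>lborel)"
    by (intro nn_integral_add) auto
  also have "(\<integral>\<^sup>+x. ennreal 1 * indicator {0..ln D} x \<partial>lborel) = ennreal (ln D)" using l by simp
  also have "(\<integral>\<^sup>+x. ennreal (D * exp (- x)) * indicator {ln D..} x \<partial>lborel) = ennreal (0 - (- D * exp (- ln D)))"
  proof (rule nn_integral_FTC_atLeast)
    show "((\<lambda>x. - D * exp (- x)) \<longlongrightarrow> 0) at_top"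
      by (intro tendsto_mult_right_zero filterlim_compose[OF exp_at_bot] filterlim_uminus_at_bot_at_top)
  qed (use D in \<open>auto intro!: derivative_eq_intros\<close>)
  also have "0 - (- D * exp (- ln D)) = 1" using D by (simp add: exp_minus)
  finally have "(\<integral>\<^sup>+\<omega>. ennreal (U \<omega>) \<partial>M) \<le> ennreal (1 + ln D)" using l by (simp add: add.commute)
  moreover have "0 \<le> 1 + ln D" using l by simp
  ultimately show ?thesis using U0 by (intro integral_real_bounded) auto
qed

lemma (in prob_space) exp_moment_le_of_exp_tail:
  fixes U :: "'a \<Rightarrow> real"
  assumes U[measurable]: "U \<in> borel_measurable M" and U0: "\<And>\<omega>. \<omega> \<in> space M \<Longrightarrow> 0 \<le> U \<omega>"
    and D: "0 \<le> D" and \<beta>: "0 < \<beta>" "\<beta> < 1"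
    and tail: "\<And>x. 0 \<le> x \<Longrightarrow> prob {\<omega> \<in> space M. x < U \<omega>} \<le> D * exp (- x)"
  shows "(\<integral>\<^sup>+\<omega>. ennreal (exp (\<beta> * U \<omega>)) \<partial>M) \<le> ennreal (1 + D * \<beta> / (1 - \<beta>))"
proof -
  have "(\<integral>\<^sup>+\<omega>. ennreal (exp (\<beta> * U \<omega>)) \<partial>M) = (\<integral>\<^sup>+\<omega>. 1 + ennreal (exp (\<beta> * U \<omega>) - exp (\<beta> * 0)) \<partial>M)"
  proof (intro nn_integral_cong)
    fix \<omega> assume "\<omega> \<in> space M"
    then have "1 \<le> exp (\<beta> * U \<omega>)" using U0 \<beta> by simp
    then show "ennreal (exp (\<beta> * U \<omega>)) = 1 + ennreal (exp (\<beta> * U \<omega>) - exp (\<beta> * 0))"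
      by (simp add: ennreal_plus[of 1, symmetric] flip: ennreal_1)
  qed
  also have "\<dots> = 1 + (\<integral>\<^sup>+\<omega>. ennreal (exp (\<beta> * U \<omega>) - exp (\<beta> * 0)) \<partial>M)"
    by (simp add: nn_integral_add emeasure_space_1)
  also have "(\<integral>\<^sup>+\<omega>. ennreal (exp (\<beta> * U \<omega>) - exp (\<beta> * 0)) \<partial>M) =
    (\<integral>\<^sup>+x. ennreal (\<beta> * exp (\<beta> * x)) * indicator {0..} x * emeasure M {\<omega> \<in> space M. x < U \<omega>} \<partial>lborel)"
    using U0 \<beta> by (intro nn_integral_layer_cake[where G = "\<lambda>x. exp (\<beta> * x)"]) (auto intro!: derivative_eq_intros)
  also have "\<dots> \<le> (\<integral>\<^sup>+x. ennreal (D * \<beta> * exp (- ((1 - \<beta>) * x))) * indicator {0..} x \<partial>lborel)"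
  proof (intro nn_integral_mono)
    fix x :: real
    have "ennreal (\<beta> * exp (\<beta> * x)) * emeasure M {\<omega> \<in> space M. x < U \<omega>} \<le> ennreal (D * \<beta> * exp (- ((1 - \<beta>) * x)))" if x: "0 \<le> x"
    proof -
      have "\<beta> * exp (\<beta> * x) * prob {\<omega> \<in> space M. x < U \<omega>} \<le> \<beta> * exp (\<beta> * x) * (D * exp (- x))"
        using tail[OF x] \<beta> by (intro mult_left_mono) auto
      also have "\<dots> = D * \<beta> * exp (- ((1 - \<beta>) * x))" by (simp add: exp_add[symmetric] algebra_simps)
      finally have "ennreal (\<beta> * exp (\<beta> * x) * prob {\<omega> \<in> space M. x < U \<omega>}) \<le> ennreal (D * \<beta> * exp (- ((1 - \<beta>) * x)))"
        by (rule ennreal_leI)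
      then show ?thesis using \<beta> by (simp add: emeasure_eq_measure ennreal_mult del: exp_le_cancel_iff)
    qed
    then show "ennreal (\<beta> * exp (\<beta> * x)) * indicator {0..} x * emeasure M {\<omega> \<in> space M. x < U \<omega>} \<le>
        ennreal (D * \<beta> * exp (- ((1 - \<beta>) * x))) * indicator {0..} x"
      by (auto simp: indicator_def)
  qed
  also have "\<dots> = ennreal (0 - (- (D * \<beta> / (1 - \<beta>)) * exp (- ((1 - \<beta>) * 0))))"
  proof (rule nn_integral_FTC_atLeast)
    have "filterlim (\<lambda>x. (1 - \<beta>) * x) at_top at_top"
      using \<beta> by (intro filterlim_tendsto_pos_mult_at_top[OF tendsto_const] filterlim_ident) auto
    then show "((\<lambda>x. - (D * \<beta> / (1 - \<beta>)) * exp (- ((1 - \<beta>) * x))) \<longlongrightarrow> 0) at_top"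
      by (intro tendsto_mult_right_zero filterlim_compose[OF exp_at_bot]) (simp add: filterlim_uminus_at_top)
    show "((\<lambda>x. - (D * \<beta> / (1 - \<beta>)) * exp (- ((1 - \<beta>) * x))) has_real_derivative D * \<beta> * exp (- ((1 - \<beta>) * x))) (at x)" for x
    proof -
      have "((\<lambda>x. - (D * \<beta> / (1 - \<beta>)) * exp (- ((1 - \<beta>) * x))) has_real_derivative
          - (D * \<beta> / (1 - \<beta>)) * (exp (- ((1 - \<beta>) * x)) * - (1 - \<beta>))) (at x)"
        by (rule DERIV_cmult) (auto intro!: derivative_eq_intros)
      moreover have "- (K / c) * (E * - c) = K * E" if "c \<noteq> 0" for K E c :: real using that by simp
      then have "- (D * \<beta> / (1 - \<beta>)) * (exp (- ((1 - \<beta>) * x)) * - (1 - \<beta>)) = D * \<beta> * exp (- ((1 - \<beta>) * x))"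
        using \<beta> by (metis diff_gt_0_iff_gt less_irrefl)
      ultimately show ?thesis by (simp only:)
    qed
  qed (use D \<beta> in auto)
  finally show ?thesis using D \<beta> by (simp add: add_left_mono ennreal_plus)
qed

lemma nn_integral_gaussian_exp:
  fixes \<theta> r :: real
  assumes "0 < r"
  shows "(\<integral>\<^sup>+x. ennreal (exp (\<theta> * x - 2 * r * x\<^sup>2)) \<partial>lborel) = ennreal (sqrt (pi / (2 * r)) * exp (\<theta>\<^sup>2 / (8 * r)))"
proof -
  \<comment> \<open>Completing the square makes the integrand a multiple of the normal density with
    mean \<theta> / (4 r) and variance 1 / (4 r).\<close>
  define \<sigma> where "\<sigma> = 1 / sqrt (4 * r)"
  have \<sigma>: "0 < \<sigma>" "\<sigma>\<^sup>2 = 1 / (4 * r)" using assms by (auto simp: \<sigma>_def power_divide)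
  have "exp (\<theta> * x - 2 * r * x\<^sup>2) = sqrt (pi / (2 * r)) * exp (\<theta>\<^sup>2 / (8 * r)) * normal_density (\<theta> / (4 * r)) \<sigma> x" for x
  proof -
    have e: "\<theta> * x - 2 * r * x\<^sup>2 = \<theta>\<^sup>2 / (8 * r) + (- (x - \<theta> / (4 * r))\<^sup>2 / (2 * \<sigma>\<^sup>2))"
      using assms unfolding \<sigma>(2) by (simp add: field_simps power2_eq_square)
    have "exp (\<theta> * x - 2 * r * x\<^sup>2) = exp (\<theta>\<^sup>2 / (8 * r)) * exp (- (x - \<theta> / (4 * r))\<^sup>2 / (2 * \<sigma>\<^sup>2))"
      unfolding e exp_add ..
    moreover have "sqrt (pi / (2 * r)) * (1 / sqrt (2 * pi * \<sigma>\<^sup>2)) = 1"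
    proof -
      have "2 * pi * \<sigma>\<^sup>2 = pi / (2 * r)" unfolding \<sigma>(2) by simp
      moreover have "0 < sqrt (pi / (2 * r))" using assms by simp
      ultimately show ?thesis using assms by simp
    qed
    ultimately have "exp (\<theta> * x - 2 * r * x\<^sup>2) = (sqrt (pi / (2 * r)) * (1 / sqrt (2 * pi * \<sigma>\<^sup>2))) * exp (\<theta>\<^sup>2 / (8 * r)) * exp (- (x - \<theta> / (4 * r))\<^sup>2 / (2 * \<sigma>\<^sup>2))"
      using assms by simp
    then show ?thesis unfolding normal_density_def by (simp only: mult_ac)
  qed
  then have "(\<integral>\<^sup>+x. ennreal (exp (\<theta> * x - 2 * r * x\<^sup>2)) \<partial>lborel)
     = (\<integral>\<^sup>+x. ennreal (sqrt (pi / (2 * r)) * exp (\<theta>\<^sup>2 / (8 * r))) * ennreal (normal_density (\<theta> / (4 * r)) \<sigma> x) \<partial>lborel)"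
    using assms by (simp add: ennreal_mult'[symmetric])
  also have "\<dots> = ennreal (sqrt (pi / (2 * r)) * exp (\<theta>\<^sup>2 / (8 * r))) * (\<integral>\<^sup>+x. ennreal (normal_density (\<theta> / (4 * r)) \<sigma> x) \<partial>lborel)"
    by (intro nn_integral_cmult) auto
  also have "(\<integral>\<^sup>+x. ennreal (normal_density (\<theta> / (4 * r)) \<sigma> x) \<partial>lborel) = 1"
  proof -
    interpret prob_space "density lborel (normal_density (\<theta> / (4 * r)) \<sigma>)" by (rule prob_space_normal_density[OF \<sigma>(1)])
    show ?thesis using emeasure_space_1 by (simp add: emeasure_density)
  qed
  finally show ?thesis by simp
qed

lemma (in prob_space) exp_moment_le_of_gaussian_tail:
  fixes U :: "'a \<Rightarrow> real"
  assumes U[measurable]: "U \<in> borel_measurable M" and U0: "\<And>\<omega>. \<omega> \<in> space M \<Longrightarrow> 0 \<le> U \<omega>"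
    and k: "0 \<le> k" and \<theta>: "0 < \<theta>" and r: "0 < r"
    and tail: "\<And>x. 0 \<le> x \<Longrightarrow> prob {\<omega> \<in> space M. x < U \<omega>} \<le> 2 * k * exp (- 2 * r * x\<^sup>2)"
  shows "(\<integral>\<^sup>+\<omega>. ennreal (exp (\<theta> * U \<omega>)) \<partial>M) \<le> ennreal (1 + k * \<theta> * sqrt (2 * pi / r) * exp (\<theta>\<^sup>2 / (8 * r)))"
proof -
  have "(\<integral>\<^sup>+\<omega>. ennreal (exp (\<theta> * U \<omega>)) \<partial>M) = (\<integral>\<^sup>+\<omega>. 1 + ennreal (exp (\<theta> * U \<omega>) - exp (\<theta> * 0)) \<partial>M)"
  proof (intro nn_integral_cong)
    fix \<omega> assume "\<omega> \<in> space M"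
    then have "1 \<le> exp (\<theta> * U \<omega>)" using U0 \<theta> by simp
    then show "ennreal (exp (\<theta> * U \<omega>)) = 1 + ennreal (exp (\<theta> * U \<omega>) - exp (\<theta> * 0))"
      by (simp add: ennreal_plus[of 1, symmetric] flip: ennreal_1)
  qed
  also have "\<dots> = 1 + (\<integral>\<^sup>+\<omega>. ennreal (exp (\<theta> * U \<omega>) - exp (\<theta> * 0)) \<partial>M)"
    by (simp add: nn_integral_add emeasure_space_1)
  also have "(\<integral>\<^sup>+\<omega>. ennreal (exp (\<theta> * U \<omega>) - exp (\<theta> * 0)) \<partial>M) =
    (\<integral>\<^sup>+x. ennreal (\<theta> * exp (\<theta> * x)) * indicator {0..} x * emeasure M {\<omega> \<in> space M. x < U \<omega>} \<partial>lborel)"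
    using U0 \<theta> by (intro nn_integral_layer_cake[where G = "\<lambda>x. exp (\<theta> * x)"]) (auto intro!: derivative_eq_intros)
  also have "\<dots> \<le> (\<integral>\<^sup>+x. ennreal (2 * k * \<theta>) * ennreal (exp (\<theta> * x - 2 * r * x\<^sup>2)) \<partial>lborel)"
  proof (intro nn_integral_mono)
    fix x :: real
    have "ennreal (\<theta> * exp (\<theta> * x)) * emeasure M {\<omega> \<in> space M. x < U \<omega>} \<le> ennreal (2 * k * \<theta>) * ennreal (exp (\<theta> * x - 2 * r * x\<^sup>2))" if x: "0 \<le> x"
    proof -
      have "\<theta> * exp (\<theta> * x) * prob {\<omega> \<in> space M. x < U \<omega>} \<le> \<theta> * exp (\<theta> * x) * (2 * k * exp (- 2 * r * x\<^sup>2))"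
        using tail[OF x] \<theta> by (intro mult_left_mono) auto
      also have "\<dots> = 2 * k * \<theta> * exp (\<theta> * x - 2 * r * x\<^sup>2)" by (simp add: exp_add[symmetric] algebra_simps)
      finally have "ennreal (\<theta> * exp (\<theta> * x) * prob {\<omega> \<in> space M. x < U \<omega>}) \<le> ennreal (2 * k * \<theta> * exp (\<theta> * x - 2 * r * x\<^sup>2))"
        by (rule ennreal_leI)
      then show ?thesis using \<theta> k by (simp add: emeasure_eq_measure ennreal_mult)
    qed
    then show "ennreal (\<theta> * exp (\<theta> * x)) * indicator {0..} x * emeasure M {\<omega> \<in> space M. x < U \<omega>} \<le>
        ennreal (2 * k * \<theta>) * ennreal (exp (\<theta> * x - 2 * r * x\<^sup>2))"
      by (auto simp: indicator_def)
  qed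
  also have "\<dots> = ennreal (2 * k * \<theta>) * ennreal (sqrt (pi / (2 * r)) * exp (\<theta>\<^sup>2 / (8 * r)))"
    by (simp add: nn_integral_cmult nn_integral_gaussian_exp[OF r])
  also have "\<dots> = ennreal (k * \<theta> * sqrt (2 * pi / r) * exp (\<theta>\<^sup>2 / (8 * r)))"
  proof -
    have "sqrt (2 * pi / r) = sqrt (4 * (pi / (2 * r)))" by simp
    also have "\<dots> = 2 * sqrt (pi / (2 * r))" by (simp only: real_sqrt_mult) simp
    finally show ?thesis using k \<theta> r by (simp add: ennreal_mult'[symmetric] mult_ac)
  qed
  finally show ?thesis using k \<theta> r by (simp add: add_left_mono ennreal_plus)
qed

section \<open>Doob's inequality for the unnormalized deviation\<close>

text \<open>The tangent at a of the convex function y -> exp (\<beta> y^2) lies below it.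
  Integrating this over a fresh observation is Jensen's inequality, and carries the submartingale
  property over to the exponential square.\<close>

lemma exp_square_tangent:
  fixes \<beta> a y :: real
  assumes "0 \<le> \<beta>"
  shows "exp (\<beta> * a\<^sup>2) * (1 + 2 * \<beta> * a * (y - a)) \<le> exp (\<beta> * y\<^sup>2)"
proof -
  have "2 * a * (y - a) \<le> y\<^sup>2 - a\<^sup>2" using zero_le_power2[of "y - a"] by (simp add: power2_eq_square algebra_simps)
  then have "\<beta> * (2 * a * (y - a)) \<le> \<beta> * (y\<^sup>2 - a\<^sup>2)" using assms by (rule mult_left_mono)
  then have "1 + 2 * \<beta> * a * (y - a) \<le> exp (\<beta> * (y\<^sup>2 - a\<^sup>2))"
  proof -
    have "2 * \<beta> * a * (y - a) = \<beta> * (2 * a * (y - a))" by simp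
    then show ?thesis
      using exp_ge_add_one_self[of "\<beta> * (y\<^sup>2 - a\<^sup>2)"] \<open>\<beta> * (2 * a * (y - a)) \<le> _\<close> by linarith
  qed
  then have "exp (\<beta> * a\<^sup>2) * (1 + 2 * \<beta> * a * (y - a)) \<le> exp (\<beta> * a\<^sup>2) * exp (\<beta> * (y\<^sup>2 - a\<^sup>2))" by (rule mult_left_mono) simp
  also have "\<dots> = exp (\<beta> * y\<^sup>2)" by (simp add: exp_add[symmetric] algebra_simps)
  finally show ?thesis .
qed

lemma exp_edev_insert_ge:
  fixes N :: "real measure"
  assumes N: "prob_space N" "sets N = sets borel" and S: "finite S" "s \<notin> S" and \<beta>: "0 \<le> \<beta>"
  shows "ennreal (exp (\<beta> * (edev N S \<xi>)\<^sup>2)) \<le> (\<integral>\<^sup>+v. ennreal (exp (\<beta> * (edev N (insert s S) (\<xi>(s := v)))\<^sup>2)) \<partial>N)"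
proof -
  interpret N: prob_space N by (rule N)
  define a where "a = edev N S \<xi>"
  define Y where "Y v = edev N (insert s S) (\<xi>(s := v))" for v
  have Y: "integrable N Y" "Y \<in> borel_measurable N" "\<And>v. 0 \<le> Y v" "\<And>v. Y v \<le> card (insert s S)"
    unfolding Y_def by (rule integrable_edev_update[OF N] edev_update_measurable[OF N] edev_nonneg[OF N] edev_le_card[OF N])+
  have aY: "a \<le> (\<integral>v. Y v \<partial>N)" unfolding a_def Y_def by (rule edev_insert_ge[OF N S])
  have ie: "integrable N (\<lambda>v. exp (\<beta> * (Y v)\<^sup>2))"
  proof (rule N.integrable_const_bound[where B="exp (\<beta> * (card (insert s S))\<^sup>2)"])
    have "(Y v)\<^sup>2 \<le> (real (card (insert s S)))\<^sup>2" for v using Y(3,4)[of v] by (intro power_mono)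
    then show "AE v in N. norm (exp (\<beta> * (Y v)\<^sup>2)) \<le> exp (\<beta> * (card (insert s S))\<^sup>2)"
      using \<beta> by (auto intro!: mult_left_mono)
  qed (use Y in measurable)
  have "exp (\<beta> * a\<^sup>2) * 1 \<le> exp (\<beta> * a\<^sup>2) * (1 + 2 * \<beta> * a * ((\<integral>v. Y v \<partial>N) - a))"
    using aY \<beta> edev_nonneg[OF N, of S \<xi>] by (intro mult_left_mono) (auto simp: a_def)
  also have "\<dots> = (\<integral>v. exp (\<beta> * a\<^sup>2) * (1 + 2 * \<beta> * a * (Y v - a)) \<partial>N)"
    using Y(1) by (simp add: N.prob_space)
  also have "\<dots> \<le> (\<integral>v. exp (\<beta> * (Y v)\<^sup>2) \<partial>N)"
    using Y(1) \<beta> by (intro integral_mono ie exp_square_tangent) auto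
  finally have "ennreal (exp (\<beta> * a\<^sup>2)) \<le> ennreal (\<integral>v. exp (\<beta> * (Y v)\<^sup>2) \<partial>N)" by (intro ennreal_leI) simp
  also have "\<dots> = (\<integral>\<^sup>+v. ennreal (exp (\<beta> * (Y v)\<^sup>2)) \<partial>N)"
    by (intro nn_integral_eq_integral[symmetric] ie) auto
  finally show ?thesis by (simp add: a_def Y_def)
qed

lemma edev_cong: "(\<And>s. s \<in> S \<Longrightarrow> \<xi> s = \<zeta> s) \<Longrightarrow> edev N S \<xi> = edev N S \<zeta>"
  unfolding edev_def by (simp cong: sum.cong)

text \<open>Induction on r shows exp (\<beta> y^2) P (H r) \<le> E [exp (\<beta> d_r^2); H r], where
  H r is the event of a crossing up to r. On paths that have crossed, the submartingale property
  moves the weight from r to r + 1; paths that cross at r + 1 satisfy the bound at that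
  moment.\<close>

lemma edev_maximal_inequality:
  fixes M :: "'i \<Rightarrow> real measure" and N :: "real measure" and s :: "nat \<Rightarrow> 'i" and y \<beta> :: real
  assumes N: "prob_space N" "sets N = sets borel"
    and M: "\<And>i. prob_space (M i)" "finite J" "s ` {1..R} \<subseteq> J" "\<And>q. q \<in> {1..R} \<Longrightarrow> M (s q) = N"
    and inj: "inj_on s {1..R}" and \<beta>: "0 \<le> \<beta>" and y: "0 \<le> y"
  shows "ennreal (exp (\<beta> * y\<^sup>2)) * emeasure (PiM J M) {\<xi> \<in> space (PiM J M). \<exists>r\<in>{1..R}. y < edev N (s ` {1..r}) \<xi>}
    \<le> (\<integral>\<^sup>+\<xi>. ennreal (exp (\<beta> * (edev N (s ` {1..R}) \<xi>)\<^sup>2)) \<partial>PiM J M)"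
proof -
  interpret M: product_prob_space M UNIV by (rule product_prob_spaceI M)+
  define d where "d r = edev N (s ` {1..r})" for r
  define H where "H r = {\<xi> \<in> space (PiM J M). \<exists>q\<in>{1..r}. y < d q \<xi>}" for r
  have dm[measurable]: "d r \<in> borel_measurable (PiM J M)" if "r \<le> R" for r
  proof -
    have sub: "{1..r} \<subseteq> {1..R}" using that by auto
    then have "s ` {1..r} \<subseteq> J" using M(3) by (meson image_mono order_trans)
    moreover have "sets (M t) = sets borel" if t: "t \<in> s ` {1..r}" for t
    proof -
      obtain q where "q \<in> {1..r}" "t = s q" using t by auto
      then show ?thesis using M(4)[of q] sub N(2) by auto
    qed
    ultimately show ?thesis unfolding d_def by (intro edev_measurable[OF N]) auto
  qed
  have Hm: "H r \<in> sets (PiM J M)" if "r \<le> R" for r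
  proof -
    have "{\<xi> \<in> space (PiM J M). y < d q \<xi>} \<in> sets (PiM J M)" if "q \<in> {1..r}" for q
      using dm[of q] that \<open>r \<le> R\<close> by (intro borel_measurable_less borel_measurable_const) auto
    then show ?thesis unfolding H_def by (intro sets.sets_Collect_finite_Ex) auto
  qed
  have em[measurable]: "(\<lambda>\<xi>. ennreal (exp (\<beta> * (d r \<xi>)\<^sup>2))) \<in> borel_measurable (PiM J M)" if "r \<le> R" for r
    using dm[OF that] by measurable
  have sub: "(\<integral>\<^sup>+\<xi>. ennreal (exp (\<beta> * (d r \<xi>)\<^sup>2)) * indicator (H r) \<xi> \<partial>PiM J M)
      \<le> (\<integral>\<^sup>+\<xi>. ennreal (exp (\<beta> * (d (Suc r) \<xi>)\<^sup>2)) * indicator (H r) \<xi> \<partial>PiM J M)" if r: "Suc r \<le> R" for r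
  proof -
    define t where "t = s (Suc r)"
    have rR: "Suc r \<in> {1..R}" using r by simp
    have tJ: "t \<in> J" "M t = N" unfolding t_def using M(3) imageI[OF rR, of s] M(4)[OF rR] by blast+
    have tn: "t \<notin> s ` {1..r}"
    proof
      assume "t \<in> s ` {1..r}"
      then obtain q where q: "q \<in> {1..r}" "s q = s (Suc r)" by (auto simp: t_def)
      then show False using inj_onD[OF inj q(2) _ rR] r by auto
    qed
    have ins: "s ` {1..Suc r} = insert t (s ` {1..r})" by (auto simp: t_def atLeastAtMostSuc_conv)
    have JJ: "J = insert t (J - {t})" "finite (J - {t})" "t \<notin> J - {t}" using M(2) tJ by auto
    \<comment> \<open>The coordinate added at step r + 1 affects neither the earlier deviations nor
      H r, so it can be integrated out with those frozen.\<close>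
    have dind: "d q (\<xi>(t := v)) = d q \<xi>" if "q \<le> r" for q \<xi> v
      unfolding d_def using tn that by (intro edev_cong) auto
    have fub: "(\<integral>\<^sup>+\<xi>. f \<xi> \<partial>PiM J M) = (\<integral>\<^sup>+x. \<integral>\<^sup>+v. f (x(t := v)) \<partial>N \<partial>PiM (J - {t}) M)"
      if "f \<in> borel_measurable (PiM J M)" for f
      using M.product_nn_integral_insert[OF JJ(2,3), of f] that JJ(1) tJ(2) by simp
    have upd: "(\<lambda>v. x(t := v)) \<in> measurable N (PiM J M)" if "x \<in> space (PiM (J - {t}) M)" for x
      using measurable_component_update[OF that JJ(3)] JJ(1) tJ(2) by simp
    interpret NN: prob_space N by (rule N)
    have fm: "(\<lambda>\<xi>. ennreal (exp (\<beta> * (d q \<xi>)\<^sup>2)) * indicator (H r) \<xi>) \<in> borel_measurable (PiM J M)" if "q \<le> R" for q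
      using r Hm[of r] em[OF that] by (intro borel_measurable_times_ennreal borel_measurable_indicator) auto
    have "(\<integral>\<^sup>+x. \<integral>\<^sup>+v. ennreal (exp (\<beta> * (d r (x(t := v)))\<^sup>2)) * indicator (H r) (x(t := v)) \<partial>N \<partial>PiM (J - {t}) M)
        \<le> (\<integral>\<^sup>+x. \<integral>\<^sup>+v. ennreal (exp (\<beta> * (d (Suc r) (x(t := v)))\<^sup>2)) * indicator (H r) (x(t := v)) \<partial>N \<partial>PiM (J - {t}) M)"
      proof (rule nn_integral_mono)
        fix x assume x: "x \<in> space (PiM (J - {t}) M)"
        define h where "h = (indicator {\<xi>. \<exists>q\<in>{1..r}. y < d q \<xi>} x :: ennreal)"
        have h: "indicator (H r) (x(t := v)) = h" if "v \<in> space N" for v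
        proof -
          have "x(t := v) \<in> space (PiM J M)" using measurable_space[OF upd[OF x] that] .
          moreover have "(\<exists>q\<in>{1..r}. y < d q (x(t := v))) \<longleftrightarrow> (\<exists>q\<in>{1..r}. y < d q x)" using dind by auto
          ultimately show ?thesis by (simp add: h_def H_def indicator_def)
        qed
        have "(\<integral>\<^sup>+v. ennreal (exp (\<beta> * (d r (x(t := v)))\<^sup>2)) * indicator (H r) (x(t := v)) \<partial>N)
          = (\<integral>\<^sup>+v. ennreal (exp (\<beta> * (d r x)\<^sup>2)) * h \<partial>N)"
          using h dind by (intro nn_integral_cong) auto
        also have "\<dots> = ennreal (exp (\<beta> * (d r x)\<^sup>2)) * h" by (simp add: NN.emeasure_space_1)
        also have "\<dots> \<le> (\<integral>\<^sup>+v. ennreal (exp (\<beta> * (d (Suc r) (x(t := v)))\<^sup>2)) \<partial>N) * h"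
          unfolding d_def ins using tn by (intro mult_right_mono exp_edev_insert_ge[OF N] \<beta>) auto
        also have "\<dots> = (\<integral>\<^sup>+v. ennreal (exp (\<beta> * (d (Suc r) (x(t := v)))\<^sup>2)) * h \<partial>N)"
          using measurable_compose[OF upd[OF x] em[OF r]] by (intro nn_integral_multc[symmetric])
        also have "\<dots> = (\<integral>\<^sup>+v. ennreal (exp (\<beta> * (d (Suc r) (x(t := v)))\<^sup>2)) * indicator (H r) (x(t := v)) \<partial>N)"
          using h by (intro nn_integral_cong) auto
        finally show "(\<integral>\<^sup>+v. ennreal (exp (\<beta> * (d r (x(t := v)))\<^sup>2)) * indicator (H r) (x(t := v)) \<partial>N) \<le> \<dots>" .
      qed
    then show ?thesis using fub[OF fm[of r]] fub[OF fm[of "Suc r"]] r by simp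
  qed
  have "ennreal (exp (\<beta> * y\<^sup>2)) * emeasure (PiM J M) (H r) \<le> (\<integral>\<^sup>+\<xi>. ennreal (exp (\<beta> * (d r \<xi>)\<^sup>2)) * indicator (H r) \<xi> \<partial>PiM J M)"
    if "r \<le> R" for r
    using that
  proof (induction r)
    case 0
    then show ?case by (simp add: H_def)
  next
    case (Suc r)
    let ?F = "H (Suc r) - H r"
    have ms: "H r \<in> sets (PiM J M)" "H (Suc r) \<in> sets (PiM J M)" "?F \<in> sets (PiM J M)"
      using Hm[of r] Hm[of "Suc r"] Suc.prems by auto
    have HS: "H r \<subseteq> H (Suc r)" by (auto simp: H_def)
    have "emeasure (PiM J M) (H (Suc r)) = emeasure (PiM J M) (H r) + emeasure (PiM J M) ?F"
      using ms HS by (subst plus_emeasure) (auto simp: Un_absorb1)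
    then have "ennreal (exp (\<beta> * y\<^sup>2)) * emeasure (PiM J M) (H (Suc r))
      = ennreal (exp (\<beta> * y\<^sup>2)) * emeasure (PiM J M) (H r) + ennreal (exp (\<beta> * y\<^sup>2)) * emeasure (PiM J M) ?F"
      by (simp add: distrib_left)
    also have "\<dots> \<le> (\<integral>\<^sup>+\<xi>. ennreal (exp (\<beta> * (d (Suc r) \<xi>)\<^sup>2)) * indicator (H r) \<xi> \<partial>PiM J M)
        + (\<integral>\<^sup>+\<xi>. ennreal (exp (\<beta> * (d (Suc r) \<xi>)\<^sup>2)) * indicator ?F \<xi> \<partial>PiM J M)"
    proof (intro add_mono)
      show "ennreal (exp (\<beta> * y\<^sup>2)) * emeasure (PiM J M) (H r) \<le> (\<integral>\<^sup>+\<xi>. ennreal (exp (\<beta> * (d (Suc r) \<xi>)\<^sup>2)) * indicator (H r) \<xi> \<partial>PiM J M)"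
        using Suc sub[of r] by (meson Suc_leD order_trans)
      have "ennreal (exp (\<beta> * y\<^sup>2)) * emeasure (PiM J M) ?F = (\<integral>\<^sup>+\<xi>. ennreal (exp (\<beta> * y\<^sup>2)) * indicator ?F \<xi> \<partial>PiM J M)"
        using ms by (simp add: nn_integral_cmult_indicator)
      also have "\<dots> \<le> (\<integral>\<^sup>+\<xi>. ennreal (exp (\<beta> * (d (Suc r) \<xi>)\<^sup>2)) * indicator ?F \<xi> \<partial>PiM J M)"
      proof (intro nn_integral_mono)
        fix \<xi>
        have "y < d (Suc r) \<xi>" if "\<xi> \<in> ?F"
          using that by (auto simp: H_def le_Suc_eq)
        then have "exp (\<beta> * y\<^sup>2) \<le> exp (\<beta> * (d (Suc r) \<xi>)\<^sup>2)" if "\<xi> \<in> ?F"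
          using that y \<beta> by (auto intro!: mult_left_mono power_mono)
        then show "ennreal (exp (\<beta> * y\<^sup>2)) * indicator ?F \<xi> \<le> ennreal (exp (\<beta> * (d (Suc r) \<xi>)\<^sup>2)) * indicator ?F \<xi>"
          by (cases "\<xi> \<in> ?F") (auto intro: ennreal_leI)
      qed
      finally show "ennreal (exp (\<beta> * y\<^sup>2)) * emeasure (PiM J M) ?F \<le> \<dots>" .
    qed
    also have "\<dots> = (\<integral>\<^sup>+\<xi>. ennreal (exp (\<beta> * (d (Suc r) \<xi>)\<^sup>2)) * indicator (H r) \<xi> + ennreal (exp (\<beta> * (d (Suc r) \<xi>)\<^sup>2)) * indicator ?F \<xi> \<partial>PiM J M)"
      using ms em[OF Suc.prems] by (intro nn_integral_add[symmetric] borel_measurable_times_ennreal borel_measurable_indicator) auto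
    also have "\<dots> = (\<integral>\<^sup>+\<xi>. ennreal (exp (\<beta> * (d (Suc r) \<xi>)\<^sup>2)) * indicator (H (Suc r)) \<xi> \<partial>PiM J M)"
      using HS by (intro nn_integral_cong) (auto simp: indicator_def)
    finally show ?case .
  qed
  from this[of R] have "ennreal (exp (\<beta> * y\<^sup>2)) * emeasure (PiM J M) (H R) \<le> (\<integral>\<^sup>+\<xi>. ennreal (exp (\<beta> * (d R \<xi>)\<^sup>2)) * indicator (H R) \<xi> \<partial>PiM J M)" by simp
  also have "\<dots> \<le> (\<integral>\<^sup>+\<xi>. ennreal (exp (\<beta> * (d R \<xi>)\<^sup>2)) \<partial>PiM J M)"
    by (intro nn_integral_mono) (auto simp: indicator_def)
  finally show ?thesis unfolding H_def d_def .
qed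


section \<open>Tables of independent outcomes\<close>

lemma (in prob_space) expectation_power2_le:
  fixes V :: "'a \<Rightarrow> real"
  assumes "integrable M V" "integrable M (\<lambda>x. (V x)\<^sup>2)"
  shows "(expectation V)\<^sup>2 \<le> expectation (\<lambda>x. (V x)\<^sup>2)"
proof -
  have "0 \<le> variance V" by (rule variance_positive)
  then show ?thesis using variance_eq[OF assms] by simp
qed

lemma le_mult_exp_minusI:
  fixes x p c :: real
  shows "exp x * p \<le> c \<Longrightarrow> p \<le> c * exp (- x)"
  by (simp add: exp_minus field_simps)

text \<open>The left side is largest at x^2 = 1 / (2 c). It follows from exp (u - 1) \<ge> u with u
  = 2 c x^2.\<close>

lemma mult_exp_neg_square_le:
  fixes x c :: real
  assumes "0 < c" "0 \<le> x"
  shows "x * exp (- c * x\<^sup>2) \<le> 1 / sqrt (2 * c * exp 1)"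
proof -
  have "2 * c * x\<^sup>2 * exp 1 \<le> exp (2 * c * x\<^sup>2)"
    using exp_ge_add_one_self[of "2 * c * x\<^sup>2 - 1"] by (simp add: exp_diff field_simps)
  then have "x\<^sup>2 * (2 * c * exp 1) \<le> exp (c * x\<^sup>2) ^ 2" by (simp add: power2_eq_square exp_add[symmetric] mult_ac)
  then have "sqrt (x\<^sup>2 * (2 * c * exp 1)) \<le> sqrt (exp (c * x\<^sup>2) ^ 2)" by (rule real_sqrt_le_mono)
  then have "x * sqrt (2 * c * exp 1) \<le> exp (c * x\<^sup>2)" using assms by (simp add: real_sqrt_mult)
  then show ?thesis using assms by (simp add: exp_minus field_simps)
qed

text \<open>A table \<open>Z\<close> holds in entry \<open>(i, q)\<close> the \<open>q\<close>-th outcome observed under treatment \<open>i\<close>.\<close>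

locale outcome_table =
  fixes \<mu> :: "nat \<Rightarrow> real measure"
  assumes prob_\<mu>: "prob_space (\<mu> i)" and sets_\<mu>: "sets (\<mu> i) = sets borel"
begin

abbreviation table_measure :: "(nat \<times> nat) set \<Rightarrow> (nat \<times> nat \<Rightarrow> real) measure" where
  "table_measure I \<equiv> PiM I (\<lambda>p. \<mu> (fst p))"

definition arm_dev :: "nat \<Rightarrow> nat \<Rightarrow> (nat \<times> nat \<Rightarrow> real) \<Rightarrow> real" where
  "arm_dev i r Z = edev (\<mu> i) ({i} \<times> {1..r}) Z / r"

definition max_dev :: "nat set \<Rightarrow> nat \<Rightarrow> (nat \<times> nat \<Rightarrow> real) \<Rightarrow> real" where
  "max_dev A r Z = Max ((\<lambda>i. arm_dev i r Z) ` A)"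

lemma prob_space_table: "prob_space (table_measure I)"
  by (intro prob_space_PiM prob_\<mu>)

lemma arm_dev_nonneg: "0 \<le> arm_dev i r Z"
  unfolding arm_dev_def by (intro divide_nonneg_nonneg edev_nonneg[OF prob_\<mu> sets_\<mu>]) simp

lemma arm_dev_le_1: "arm_dev i r Z \<le> 1"
proof -
  have "edev (\<mu> i) ({i} \<times> {1..r}) Z \<le> r"
    using edev_le_card[OF prob_\<mu> sets_\<mu>, of i "{i} \<times> {1..r}" Z] by (simp add: card_cartesian_product)
  then show ?thesis by (cases "r = 0") (auto simp: arm_dev_def)
qed

lemma arm_dev_measurable:
  assumes "{i} \<times> {1..r} \<subseteq> I"
  shows "arm_dev i r \<in> borel_measurable (table_measure I)"
  unfolding arm_dev_def
  using edev_measurable[OF prob_\<mu> sets_\<mu>, of "{i} \<times> {1..r}" I "\<lambda>p. \<mu> (fst p)" i] assms sets_\<mu> by auto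

lemma arm_dev_tail:
  assumes I: "finite I" "{i} \<times> {1..r} \<subseteq> I" and r: "0 < r" and x: "0 \<le> x"
  shows "measure (table_measure I) {Z \<in> space (table_measure I). x < arm_dev i r Z} \<le> 2 * exp (- 2 * real r * x\<^sup>2)"
proof -
  have "{Z \<in> space (table_measure I). x < arm_dev i r Z} =
    {Z \<in> space (table_measure I). card ({i} \<times> {1..r}) * x < edev (\<mu> i) ({i} \<times> {1..r}) Z}"
    using r by (auto simp: arm_dev_def card_cartesian_product field_simps)
  also have "measure (table_measure I) \<dots> \<le> 2 * exp (- 2 * real (card ({i} \<times> {1..r})) * x\<^sup>2)"
    using I x by (intro dkw[OF prob_\<mu> sets_\<mu> prob_\<mu>]) auto
  finally show ?thesis by (simp add: card_cartesian_product)
qed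

lemma max_dev_measurable:
  assumes "finite A" "A \<times> {1..r} \<subseteq> I"
  shows "max_dev A r \<in> borel_measurable (table_measure I)"
  unfolding max_dev_def
  by (intro borel_measurable_Max assms arm_dev_measurable) (use assms in auto)

lemma max_dev_nonneg: "finite A \<Longrightarrow> A \<noteq> {} \<Longrightarrow> 0 \<le> max_dev A r Z"
  unfolding max_dev_def using arm_dev_nonneg by (subst Max_ge_iff) auto

lemma max_dev_tail:
  assumes I: "finite I" "A \<times> {1..r} \<subseteq> I" and A: "finite A" "A \<noteq> {}" and r: "0 < r" and x: "0 \<le> x"
  shows "measure (table_measure I) {Z \<in> space (table_measure I). x < max_dev A r Z} \<le> 2 * real (card A) * exp (- 2 * real r * x\<^sup>2)"
proof -
  interpret prob_space "table_measure I" by (rule prob_space_table)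
  let ?B = "\<lambda>i. {Z \<in> space (table_measure I). x < arm_dev i r Z}"
  have s: "{i} \<times> {1..r} \<subseteq> I" if "i \<in> A" for i using I that by auto
  have m: "?B i \<in> sets (table_measure I)" if "i \<in> A" for i
    using arm_dev_measurable[OF s[OF that]] by measurable
  have "{Z \<in> space (table_measure I). x < max_dev A r Z} = (\<Union>i\<in>A. ?B i)"
    using A by (auto simp: max_dev_def Max_gr_iff)
  also have "prob \<dots> \<le> (\<Sum>i\<in>A. prob (?B i))"
    using A m by (intro finite_measure_subadditive_finite) auto
  also have "\<dots> \<le> (\<Sum>i\<in>A. 2 * exp (- 2 * real r * x\<^sup>2))"
    using I s r x by (intro sum_mono arm_dev_tail) auto
  finally show ?thesis by simp
qed

text \<open>The linear factor \<theta> of the moment bound is absorbed by an extra exp (\<kappa>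
  \<theta>^2 / (8 r)). The price sqrt (8 pi / (\<kappa> e)) is the maximum over \<theta> of \<theta>
  sqrt (2 pi / r) against that exponential. In this form the bound can be optimized in
  \<theta>.\<close>

lemma max_dev_exp_moment:
  assumes I: "finite I" "A \<times> {1..r} \<subseteq> I" and A: "finite A" "A \<noteq> {}" and r: "0 < r" and \<theta>: "0 < \<theta>" and \<kappa>: "0 < \<kappa>"
  shows "(\<integral>\<^sup>+Z. ennreal (exp (\<theta> * max_dev A r Z)) \<partial>table_measure I)
    \<le> ennreal ((1 + real (card A) * sqrt (8 * pi / (\<kappa> * exp 1))) * exp ((1 + \<kappa>) * \<theta>\<^sup>2 / (8 * real r)))"
proof -
  interpret prob_space "table_measure I" by (rule prob_space_table)
  have "(\<integral>\<^sup>+Z. ennreal (exp (\<theta> * max_dev A r Z)) \<partial>table_measure I)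
    \<le> ennreal (1 + real (card A) * \<theta> * sqrt (2 * pi / real r) * exp (\<theta>\<^sup>2 / (8 * real r)))"
    using \<theta> r by (intro exp_moment_le_of_gaussian_tail max_dev_measurable[OF A(1) I(2)] max_dev_nonneg[OF A] max_dev_tail[OF I A r]) auto
  also have "\<dots> \<le> ennreal ((1 + real (card A) * sqrt (8 * pi / (\<kappa> * exp 1))) * exp ((1 + \<kappa>) * \<theta>\<^sup>2 / (8 * real r)))"
  proof (rule ennreal_leI)
    have e: "exp ((1 + \<kappa>) * \<theta>\<^sup>2 / (8 * real r)) = exp (\<kappa> / (8 * real r) * \<theta>\<^sup>2) * exp (\<theta>\<^sup>2 / (8 * real r))"
      by (simp add: exp_add[symmetric] add_divide_distrib algebra_simps)
    have "\<theta> * exp (- (\<kappa> / (8 * real r)) * \<theta>\<^sup>2) \<le> 1 / sqrt (2 * (\<kappa> / (8 * real r)) * exp 1)"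
      using \<kappa> r \<theta> by (intro mult_exp_neg_square_le) auto
    then have "\<theta> \<le> exp (\<kappa> / (8 * real r) * \<theta>\<^sup>2) * (1 / sqrt (2 * (\<kappa> / (8 * real r)) * exp 1))"
      by (simp add: exp_minus field_simps)
    then have "\<theta> * sqrt (2 * pi / real r) \<le> exp (\<kappa> / (8 * real r) * \<theta>\<^sup>2) * (1 / sqrt (2 * (\<kappa> / (8 * real r)) * exp 1)) * sqrt (2 * pi / real r)"
      by (rule mult_right_mono) simp
    moreover have "(1 / sqrt (2 * (\<kappa> / (8 * real r)) * exp 1)) * sqrt (2 * pi / real r) = sqrt (8 * pi / (\<kappa> * exp 1))"
    proof -
      have "(1 / sqrt (2 * (\<kappa> / (8 * real r)) * exp 1)) * sqrt (2 * pi / real r) = sqrt (1 / (2 * (\<kappa> / (8 * real r)) * exp 1) * (2 * pi / real r))"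
        by (simp only: real_sqrt_mult real_sqrt_divide real_sqrt_one)
      also have "1 / (2 * (\<kappa> / (8 * real r)) * exp 1) * (2 * pi / real r) = 8 * pi / (\<kappa> * exp 1)"
        using r \<kappa> by (simp add: field_simps)
      finally show ?thesis .
    qed
    ultimately have "\<theta> * sqrt (2 * pi / real r) \<le> exp (\<kappa> / (8 * real r) * \<theta>\<^sup>2) * sqrt (8 * pi / (\<kappa> * exp 1))"
      by (simp only: mult.assoc)
    then have "real (card A) * (\<theta> * sqrt (2 * pi / real r)) * exp (\<theta>\<^sup>2 / (8 * real r))
        \<le> real (card A) * (exp (\<kappa> / (8 * real r) * \<theta>\<^sup>2) * sqrt (8 * pi / (\<kappa> * exp 1))) * exp (\<theta>\<^sup>2 / (8 * real r))"
      by (intro mult_right_mono mult_left_mono) auto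
    moreover have "1 \<le> exp ((1 + \<kappa>) * \<theta>\<^sup>2 / (8 * real r))" using \<kappa> by simp
    ultimately show "1 + real (card A) * \<theta> * sqrt (2 * pi / real r) * exp (\<theta>\<^sup>2 / (8 * real r))
        \<le> (1 + real (card A) * sqrt (8 * pi / (\<kappa> * exp 1))) * exp ((1 + \<kappa>) * \<theta>\<^sup>2 / (8 * real r))"
      unfolding e by (simp add: algebra_simps)
  qed
  finally show ?thesis .
qed

lemma max_dev_cong:
  assumes "\<And>p. p \<in> A \<times> {1..r} \<Longrightarrow> Z p = Z' p"
  shows "max_dev A r Z = max_dev A r Z'"
  unfolding max_dev_def arm_dev_def
  using assms by (intro arg_cong[where f=Max] image_cong arg_cong2[where f="(/)"] edev_cong refl) auto

section \<open>Probability of eliminating the best rule\<close>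

text \<open>A is to be the group of the best rule and w the threshold \<open>u_eta\<close> divided
  by C. The two deviations are kept apart, instead of taking one maximum over all arms, so that
  independence can be used.\<close>

definition bad_event :: "nat \<Rightarrow> nat \<Rightarrow> nat set \<Rightarrow> nat \<Rightarrow> real \<Rightarrow> (nat \<times> nat \<Rightarrow> real) set" where
  "bad_event K n A r w = {Z \<in> space (table_measure ({1..K} \<times> {1..n})). w < max_dev A r Z + max_dev ({1..K} - A) r Z}"

lemma bad_event_sets:
  assumes "A \<subseteq> {1..K}" "r \<le> n"
  shows "bad_event K n A r w \<in> sets (table_measure ({1..K} \<times> {1..n}))"
proof -
  have "finite A" using assms finite_subset by auto
  moreover have "A \<times> {1..r} \<subseteq> {1..K} \<times> {1..n}" "({1..K} - A) \<times> {1..r} \<subseteq> {1..K} \<times> {1..n}" using assms by auto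
  ultimately have [measurable]: "max_dev A r \<in> borel_measurable (table_measure ({1..K} \<times> {1..n}))"
    "max_dev ({1..K} - A) r \<in> borel_measurable (table_measure ({1..K} \<times> {1..n}))"
    using max_dev_measurable[of A] max_dev_measurable[of "{1..K} - A"] by blast+
  show ?thesis unfolding bad_event_def by measurable
qed

lemma prob_bad_event_le_union:
  assumes A: "A \<subseteq> {1..K}" "A \<noteq> {}" "{1..K} - A \<noteq> {}" and r: "0 < r" "r \<le> n" and w: "0 \<le> w"
  shows "measure (table_measure ({1..K} \<times> {1..n})) (bad_event K n A r w) \<le> 2 * real K * exp (- real r * w\<^sup>2 / 2)"
proof -
  let ?I = "{1..K} \<times> {1..n}"
  interpret prob_space "table_measure ?I" by (rule prob_space_table)
  have m: "max_dev {1..K} r \<in> borel_measurable (table_measure ?I)"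
    using r by (intro max_dev_measurable) auto
  have le: "max_dev B r Z \<le> max_dev {1..K} r Z" if "B \<subseteq> {1..K}" "B \<noteq> {}" for B Z
    unfolding max_dev_def using that by (intro Max_mono) auto
  have "bad_event K n A r w \<subseteq> {Z \<in> space (table_measure ?I). w / 2 < max_dev {1..K} r Z}"
  proof
    fix Z assume Z: "Z \<in> bad_event K n A r w"
    have "max_dev A r Z \<le> max_dev {1..K} r Z" "max_dev ({1..K} - A) r Z \<le> max_dev {1..K} r Z"
      by (rule le; use A in blast)+
    then show "Z \<in> {Z \<in> space (table_measure ?I). w / 2 < max_dev {1..K} r Z}"
      using Z by (auto simp: bad_event_def)
  qed
  then have "prob (bad_event K n A r w) \<le> prob {Z \<in> space (table_measure ?I). w / 2 < max_dev {1..K} r Z}"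
    using m by (intro finite_measure_mono) auto
  also have "\<dots> \<le> 2 * real (card {1..K}) * exp (- 2 * real r * (w / 2)\<^sup>2)"
    using A r w by (intro max_dev_tail) auto
  finally show ?thesis by (simp add: power_divide)
qed

text \<open>Independence improves the exponent r w^2 / 2 of the union bound to r w^2 / (1 +
  \<kappa>) with \<kappa> as small as desired; the prefactor grows from order K to order K^2 /
  \<kappa>.\<close>

lemma prob_bad_event_le_indep:
  assumes A: "A \<subseteq> {1..K}" "A \<noteq> {}" "{1..K} - A \<noteq> {}" and r: "0 < r" "r \<le> n" and w: "0 < w" and \<kappa>: "0 < \<kappa>"
  shows "measure (table_measure ({1..K} \<times> {1..n})) (bad_event K n A r w)
    \<le> (1 + real K * sqrt (8 * pi / (\<kappa> * exp 1)))\<^sup>2 * exp (- real r * w\<^sup>2 / (1 + \<kappa>))"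
proof -
  let ?I = "{1..K} \<times> {1..n}"
  let ?B = "{1..K} - A"
  let ?I1 = "A \<times> {1..n}"
  let ?I2 = "?B \<times> {1..n}"
  let ?c = "1 + real K * sqrt (8 * pi / (\<kappa> * exp 1))"
  \<comment> \<open>The minimizer of the Chernoff exponent (1 + \<kappa>) \<theta>^2 / (4 r) -
    \<theta> w.\<close>
  define \<theta> where "\<theta> = 2 * real r * w / (1 + \<kappa>)"
  have \<theta>: "0 < \<theta>" using r w \<kappa> by (simp add: \<theta>_def)
  interpret prob_space "table_measure ?I" by (rule prob_space_table)
  interpret P: product_prob_space "\<lambda>p. \<mu> (fst p)" UNIV by (rule product_prob_spaceI prob_\<mu>)+
  have fA: "finite A" using A finite_subset by auto
  have II: "?I = ?I1 \<union> ?I2" "?I1 \<inter> ?I2 = {}" "finite ?I1" "finite ?I2" using A fA by auto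
  define f where "f Z = ennreal (exp (\<theta> * max_dev A r Z))" for Z
  define g where "g Z = ennreal (exp (\<theta> * max_dev ?B r Z))" for Z
  have mA: "max_dev A r \<in> borel_measurable (table_measure I')" if "?I1 \<subseteq> I'" for I'
    using that r fA by (intro max_dev_measurable) auto
  have mB: "max_dev ?B r \<in> borel_measurable (table_measure I')" if "?I2 \<subseteq> I'" for I'
    using that r by (intro max_dev_measurable) auto
  have fm[measurable]: "f \<in> borel_measurable (table_measure ?I)" "f \<in> borel_measurable (table_measure ?I1)"
    unfolding f_def using mA[of ?I] mA[of ?I1] II(1) by auto
  have gm[measurable]: "g \<in> borel_measurable (table_measure ?I)" "g \<in> borel_measurable (table_measure ?I2)"
    unfolding g_def using mB[of ?I] mB[of ?I2] II(1) by auto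
  have "(\<integral>\<^sup>+Z. f Z * g Z \<partial>table_measure ?I) =
      (\<integral>\<^sup>+x. \<integral>\<^sup>+y. f (merge ?I1 ?I2 (x, y)) * g (merge ?I1 ?I2 (x, y)) \<partial>table_measure ?I2 \<partial>table_measure ?I1)"
  proof -
    have "(\<lambda>Z. f Z * g Z) \<in> borel_measurable (table_measure (?I1 \<union> ?I2))"
      unfolding II(1)[symmetric] by measurable
    from P.product_nn_integral_fold[OF II(2-4) this] show ?thesis unfolding II(1)[symmetric] .
  qed
  also have "\<dots> = (\<integral>\<^sup>+x. \<integral>\<^sup>+y. f x * g y \<partial>table_measure ?I2 \<partial>table_measure ?I1)"
  proof (intro nn_integral_cong)
    fix x y
    have "max_dev A r (merge ?I1 ?I2 (x, y)) = max_dev A r x"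
      using r by (intro max_dev_cong) (auto simp: merge_def)
    moreover have "max_dev ?B r (merge ?I1 ?I2 (x, y)) = max_dev ?B r y"
      using r by (intro max_dev_cong) (auto simp: merge_def)
    ultimately show "f (merge ?I1 ?I2 (x, y)) * g (merge ?I1 ?I2 (x, y)) = f x * g y" by (simp add: f_def g_def)
  qed
  also have "\<dots> = (\<integral>\<^sup>+x. f x \<partial>table_measure ?I1) * (\<integral>\<^sup>+y. g y \<partial>table_measure ?I2)"
    using fm(2) gm(2) by (simp only: nn_integral_cmult nn_integral_multc)
  also have "\<dots> \<le> ennreal (?c * exp ((1 + \<kappa>) * \<theta>\<^sup>2 / (8 * real r))) * ennreal (?c * exp ((1 + \<kappa>) * \<theta>\<^sup>2 / (8 * real r)))"
  proof (intro mult_mono)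
    have c: "(1 + real (card C) * sqrt (8 * pi / (\<kappa> * exp 1))) * exp ((1 + \<kappa>) * \<theta>\<^sup>2 / (8 * real r)) \<le> ?c * exp ((1 + \<kappa>) * \<theta>\<^sup>2 / (8 * real r))"
      if "C \<subseteq> {1..K}" for C
    proof -
      have "card C \<le> K" using card_mono[OF _ that] by simp
      then show ?thesis using \<kappa> by (intro mult_right_mono add_left_mono) auto
    qed
    show "(\<integral>\<^sup>+x. f x \<partial>table_measure ?I1) \<le> ennreal (?c * exp ((1 + \<kappa>) * \<theta>\<^sup>2 / (8 * real r)))"
      unfolding f_def using r fA A \<theta> \<kappa>
      by (intro order_trans[OF max_dev_exp_moment ennreal_leI[OF c[OF A(1)]]]) auto
    show "(\<integral>\<^sup>+y. g y \<partial>table_measure ?I2) \<le> ennreal (?c * exp ((1 + \<kappa>) * \<theta>\<^sup>2 / (8 * real r)))"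
      unfolding g_def using r A \<theta> \<kappa>
      by (intro order_trans[OF max_dev_exp_moment ennreal_leI[OF c]]) auto
  qed auto
  also have "\<dots> = ennreal (?c\<^sup>2 * exp ((1 + \<kappa>) * \<theta>\<^sup>2 / (4 * real r)))"
  proof -
    have "0 \<le> ?c" using \<kappa> by simp
    moreover have "(1 + \<kappa>) * \<theta>\<^sup>2 / (4 * real r) = (1 + \<kappa>) * \<theta>\<^sup>2 / (8 * real r) + (1 + \<kappa>) * \<theta>\<^sup>2 / (8 * real r)" by simp
    then have "exp ((1 + \<kappa>) * \<theta>\<^sup>2 / (4 * real r)) = exp ((1 + \<kappa>) * \<theta>\<^sup>2 / (8 * real r)) * exp ((1 + \<kappa>) * \<theta>\<^sup>2 / (8 * real r))"
      by (simp only: exp_add)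
    ultimately show ?thesis by (simp add: ennreal_mult[symmetric] power2_eq_square mult_ac)
  qed
  finally have fg: "(\<integral>\<^sup>+Z. f Z * g Z \<partial>table_measure ?I) \<le> ennreal (?c\<^sup>2 * exp ((1 + \<kappa>) * \<theta>\<^sup>2 / (4 * real r)))" .
  have bs: "bad_event K n A r w \<in> sets (table_measure ?I)" using A r by (intro bad_event_sets) auto
  have "ennreal (exp (\<theta> * w)) * emeasure (table_measure ?I) (bad_event K n A r w)
      = (\<integral>\<^sup>+Z. ennreal (exp (\<theta> * w)) * indicator (bad_event K n A r w) Z \<partial>table_measure ?I)"
    using bs by (simp add: nn_integral_cmult_indicator)
  also have "\<dots> \<le> (\<integral>\<^sup>+Z. f Z * g Z \<partial>table_measure ?I)"
  proof (intro nn_integral_mono)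
    fix Z
    have "exp (\<theta> * w) \<le> exp (\<theta> * max_dev A r Z) * exp (\<theta> * max_dev ?B r Z)" if "Z \<in> bad_event K n A r w"
      using that \<theta> by (simp add: exp_add[symmetric] distrib_left[symmetric] bad_event_def)
    then show "ennreal (exp (\<theta> * w)) * indicator (bad_event K n A r w) Z \<le> f Z * g Z"
      by (auto simp: f_def g_def indicator_def ennreal_mult[symmetric] intro!: ennreal_leI)
  qed
  also note fg
  finally have "exp (\<theta> * w) * prob (bad_event K n A r w) \<le> ?c\<^sup>2 * exp ((1 + \<kappa>) * \<theta>\<^sup>2 / (4 * real r))"
    unfolding emeasure_eq_measure by (simp add: ennreal_mult[symmetric])
  then have "prob (bad_event K n A r w) \<le> ?c\<^sup>2 * exp ((1 + \<kappa>) * \<theta>\<^sup>2 / (4 * real r)) * exp (- (\<theta> * w))"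
    by (rule le_mult_exp_minusI)
  also have "\<dots> = ?c\<^sup>2 * exp ((1 + \<kappa>) * \<theta>\<^sup>2 / (4 * real r) - \<theta> * w)"
    by (simp only: mult.assoc exp_add[symmetric] diff_conv_add_uminus)
  also have "(1 + \<kappa>) * \<theta>\<^sup>2 / (4 * real r) - \<theta> * w = - real r * w\<^sup>2 / (1 + \<kappa>)"
  proof -
    have "(1 + \<kappa>) * \<theta> = 2 * real r * w" using \<kappa> by (simp add: \<theta>_def)
    moreover have "(1 + \<kappa>) * \<theta>\<^sup>2 = ((1 + \<kappa>) * \<theta>) * \<theta>" by (simp only: power2_eq_square mult.assoc)
    ultimately have "(1 + \<kappa>) * \<theta>\<^sup>2 = (2 * real r * w) * \<theta>" by (simp only:)
    then have "(1 + \<kappa>) * \<theta>\<^sup>2 / (4 * real r) = \<theta> * w / 2" using r by simp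
    then have "(1 + \<kappa>) * \<theta>\<^sup>2 / (4 * real r) - \<theta> * w = - (\<theta> * w / 2)" by simp
    moreover have "(2 * x * w / c) * w / 2 = x * w\<^sup>2 / c" for x c :: real by (simp add: power2_eq_square)
    then have "\<theta> * w / 2 = real r * w\<^sup>2 / (1 + \<kappa>)" unfolding \<theta>_def .
    ultimately show ?thesis by simp
  qed
  finally show ?thesis .
qed

section \<open>The largest deviation over a range of sample sizes\<close>

definition sup_dev :: "nat \<Rightarrow> nat \<Rightarrow> nat \<Rightarrow> (nat \<times> nat \<Rightarrow> real) \<Rightarrow> real" where
  "sup_dev K lo hi Z = Max ((\<lambda>(i, r). arm_dev i r Z) ` ({1..K} \<times> {lo..hi}))"

context
  fixes K n lo hi :: nat
  assumes K: "0 < K" and lo: "0 < lo" "lo \<le> hi" and hi: "hi \<le> n"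
begin

interpretation T: prob_space "table_measure ({1..K} \<times> {1..n})" by (rule prob_space_table)

lemma arm_dev_le_sup_dev:
  assumes "i \<in> {1..K}" "r \<in> {lo..hi}"
  shows "arm_dev i r Z \<le> sup_dev K lo hi Z"
proof -
  have "(\<lambda>(i, r). arm_dev i r Z) (i, r) \<in> (\<lambda>(i, r). arm_dev i r Z) ` ({1..K} \<times> {lo..hi})"
    using assms by (intro imageI) auto
  then show ?thesis unfolding sup_dev_def by (intro Max_ge) auto
qed

lemma sup_dev_attained: "\<exists>i\<in>{1..K}. \<exists>r\<in>{lo..hi}. sup_dev K lo hi Z = arm_dev i r Z"
proof -
  have "sup_dev K lo hi Z \<in> (\<lambda>(i, r). arm_dev i r Z) ` ({1..K} \<times> {lo..hi})"
    unfolding sup_dev_def using K lo by (intro Max_in) auto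
  then show ?thesis by auto
qed

lemma sup_dev_bounds: "0 \<le> sup_dev K lo hi Z" "sup_dev K lo hi Z \<le> 1"
  using sup_dev_attained[of Z] arm_dev_nonneg arm_dev_le_1 by auto

lemma arm_dev_measurable': "i \<in> {1..K} \<Longrightarrow> r \<in> {..hi} \<Longrightarrow> arm_dev i r \<in> borel_measurable (table_measure ({1..K} \<times> {1..n}))"
  using hi by (intro arm_dev_measurable) auto

lemma sup_dev_measurable: "sup_dev K lo hi \<in> borel_measurable (table_measure ({1..K} \<times> {1..n}))"
  unfolding sup_dev_def
proof (intro borel_measurable_Max)
  fix p assume "p \<in> {1..K} \<times> {lo..hi}"
  then show "(\<lambda>Z. case p of (i, r) \<Rightarrow> arm_dev i r Z) \<in> borel_measurable (table_measure ({1..K} \<times> {1..n}))"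
    using arm_dev_measurable'[of "fst p" "snd p"] by (cases p) auto
qed simp

text \<open>Second moments suffice: (E S)^2 \<le> E S^2 \<le> c E W, and E W \<le> 1 + ln D by the
  exponential tail. The bound b yields integrability of W.\<close>

lemma expectation_sup_dev_le_sqrt:
  assumes W: "W \<in> borel_measurable (table_measure ({1..K} \<times> {1..n}))"
    and W0: "\<And>Z. 0 \<le> W Z" and WD: "1 \<le> D" "\<And>x. 0 \<le> x \<Longrightarrow> T.prob {Z \<in> space (table_measure ({1..K} \<times> {1..n})). x < W Z} \<le> D * exp (- x)"
    and c: "0 \<le> c" "\<And>Z. (sup_dev K lo hi Z)\<^sup>2 \<le> c * W Z" and Wb: "\<And>Z. W Z \<le> b"
  shows "T.expectation (sup_dev K lo hi) \<le> sqrt (c * (1 + ln D))"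
proof -
  have m: "sup_dev K lo hi \<in> borel_measurable (table_measure ({1..K} \<times> {1..n}))" by (rule sup_dev_measurable)
  have i: "integrable (table_measure ({1..K} \<times> {1..n})) (sup_dev K lo hi)"
    using sup_dev_bounds m by (intro T.integrable_const_bound[where B=1]) auto
  have i2: "integrable (table_measure ({1..K} \<times> {1..n})) (\<lambda>Z. (sup_dev K lo hi Z)\<^sup>2)"
    using sup_dev_bounds m by (intro T.integrable_const_bound[where B=1]) (auto simp: power_le_one)
  have iW: "integrable (table_measure ({1..K} \<times> {1..n})) W"
    using W0 Wb W by (intro T.integrable_const_bound[where B=b]) auto
  have "(T.expectation (sup_dev K lo hi))\<^sup>2 \<le> T.expectation (\<lambda>Z. (sup_dev K lo hi Z)\<^sup>2)"
    by (rule T.expectation_power2_le[OF i i2])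
  also have "\<dots> \<le> T.expectation (\<lambda>Z. c * W Z)" using i2 iW c by (intro integral_mono) auto
  also have "\<dots> = c * T.expectation W" by simp
  also have "\<dots> \<le> c * (1 + ln D)"
    using c W W0 WD by (intro mult_left_mono T.expectation_le_of_exp_tail) auto
  finally show ?thesis by (rule real_le_rsqrt)
qed

lemma expectation_sup_dev_le_union:
  "T.expectation (sup_dev K lo hi) \<le> sqrt ((1 + ln (2 * real (K * (hi - lo + 1)))) / (2 * real lo))"
proof -
  let ?T = "table_measure ({1..K} \<times> {1..n})"
  let ?S = "{1..K} \<times> {lo..hi}"
  \<comment> \<open>After this normalization every entry has tail 2 exp (-x), independently of r.
    The union over all entries gives D, and r \<ge> lo gives the factor 1 / (2 lo).\<close>
  define W where "W Z = Max ((\<lambda>(i, r). 2 * real r * (arm_dev i r Z)\<^sup>2) ` ?S)" for Z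
  have fin: "finite ?S" "?S \<noteq> {}" using K lo by auto
  have cS: "card ?S = K * (hi - lo + 1)" using lo by (simp add: card_cartesian_product Suc_diff_le)
  have m: "(\<lambda>Z. case p of (i, r) \<Rightarrow> 2 * real r * (arm_dev i r Z)\<^sup>2) \<in> borel_measurable ?T" if p: "p \<in> ?S" for p
  proof -
    obtain i r where ir: "p = (i, r)" "i \<in> {1..K}" "r \<in> {..hi}" using p by (cases p) auto
    note [measurable] = arm_dev_measurable'[OF ir(2,3)]
    show ?thesis unfolding ir prod.case by measurable
  qed
  have le: "2 * real r * (arm_dev i r Z)\<^sup>2 \<le> W Z" if "(i, r) \<in> ?S" for i r Z
  proof -
    have "(\<lambda>(i, r). 2 * real r * (arm_dev i r Z)\<^sup>2) (i, r) \<in> (\<lambda>(i, r). 2 * real r * (arm_dev i r Z)\<^sup>2) ` ?S"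
      using that by (rule imageI)
    then show ?thesis unfolding W_def using fin by (intro Max_ge) auto
  qed
  have sq: "sqrt ((1 / (2 * real lo)) * (1 + ln (2 * real (card ?S)))) = sqrt ((1 + ln (2 * real (K * (hi - lo + 1)))) / (2 * real lo))"
    unfolding cS by simp
  have "T.expectation (sup_dev K lo hi) \<le> sqrt ((1 / (2 * real lo)) * (1 + ln (2 * real (card ?S))))"
  proof (rule expectation_sup_dev_le_sqrt)
    show "W \<in> borel_measurable ?T" unfolding W_def using fin m by (intro borel_measurable_Max) auto
    show "0 \<le> W Z" for Z
      using le[of 1 lo Z] K lo by (smt (verit) SigmaI atLeastAtMost_iff less_one not_le order_refl mult_nonneg_nonneg of_nat_0_le_iff zero_le_power2)
    have "0 < card ?S" using fin by (simp only: card_gt_0_iff simp_thms)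
    then have "1 \<le> real (card ?S)" by linarith
    then show "1 \<le> 2 * real (card ?S)" by linarith
    show "T.prob {Z \<in> space ?T. x < W Z} \<le> 2 * real (card ?S) * exp (- x)" if x: "0 \<le> x" for x
    proof -
      let ?B = "\<lambda>p. {Z \<in> space ?T. x < (case p of (i, r) \<Rightarrow> 2 * real r * (arm_dev i r Z)\<^sup>2)}"
      have eq: "{Z \<in> space ?T. x < W Z} = (\<Union>p\<in>?S. ?B p)"
        unfolding W_def using fin by (subst Max_gr_iff) auto
      have "T.prob {Z \<in> space ?T. x < W Z} \<le> (\<Sum>p\<in>?S. T.prob (?B p))" unfolding eq
        using fin m by (intro T.finite_measure_subadditive_finite) (auto intro!: borel_measurable_less)
      also have "\<dots> \<le> (\<Sum>p\<in>?S. 2 * exp (- x))"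
      proof (intro sum_mono)
        fix p assume p: "p \<in> ?S"
        obtain i r where ir: "p = (i, r)" "i \<in> {1..K}" "lo \<le> r" "r \<le> hi" using p by (cases p) auto
        have r: "0 < r" using ir lo by auto
        have "?B p \<subseteq> {Z \<in> space ?T. sqrt (x / (2 * real r)) < arm_dev i r Z}"
        proof
          fix Z assume Z: "Z \<in> ?B p"
          then have "x / (2 * real r) < (arm_dev i r Z)\<^sup>2" using r by (simp add: ir field_simps)
          then have "sqrt (x / (2 * real r)) < arm_dev i r Z" by (intro real_less_lsqrt arm_dev_nonneg)
          then show "Z \<in> {Z \<in> space ?T. sqrt (x / (2 * real r)) < arm_dev i r Z}" using Z by simp
        qed
        then have "T.prob (?B p) \<le> T.prob {Z \<in> space ?T. sqrt (x / (2 * real r)) < arm_dev i r Z}"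
          using arm_dev_measurable'[of i r] ir by (intro T.finite_measure_mono) (auto intro!: borel_measurable_less)
        also have "\<dots> \<le> 2 * exp (- 2 * real r * (sqrt (x / (2 * real r)))\<^sup>2)"
          using ir hi r x by (intro arm_dev_tail) auto
        also have "\<dots> = 2 * exp (- x)" using r x by simp
        finally show "T.prob (?B p) \<le> 2 * exp (- x)" .
      qed
      finally show ?thesis by simp
    qed
    show "(sup_dev K lo hi Z)\<^sup>2 \<le> 1 / (2 * real lo) * W Z" for Z
    proof -
      obtain i r where ir: "i \<in> {1..K}" "r \<in> {lo..hi}" "sup_dev K lo hi Z = arm_dev i r Z"
        using sup_dev_attained by blast
      have "2 * real lo * (arm_dev i r Z)\<^sup>2 \<le> 2 * real r * (arm_dev i r Z)\<^sup>2"
        using ir by (intro mult_right_mono) auto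
      also have "\<dots> \<le> W Z" using ir by (intro le) auto
      finally show ?thesis using lo ir by (simp add: field_simps)
    qed
    show "W Z \<le> 2 * real hi" for Z
      unfolding W_def
    proof (rule Max.boundedI)
      have "2 * real r * (arm_dev i r Z)\<^sup>2 \<le> 2 * real hi * 1" if "r \<le> hi" for i r
        using that arm_dev_nonneg arm_dev_le_1 by (intro mult_mono) (auto simp: power_le_one)
      then show "\<And>a. a \<in> (\<lambda>(i, r). 2 * real r * (arm_dev i r Z)\<^sup>2) ` ?S \<Longrightarrow> a \<le> 2 * real hi" by auto
    qed (use fin in auto)
  qed (use lo in auto)
  then show ?thesis unfolding sq .
qed

lemma expectation_sup_dev_le_maximal:
  "T.expectation (sup_dev K lo hi) \<le> sqrt (3 / 4 * real hi * (1 + ln (5 * real K))) / lo"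
proof -
  let ?I = "{1..K} \<times> {1..n}"
  let ?T = "table_measure ?I"
  let ?S = "{1..K} \<times> {1..hi}"
  define d where "d i r Z = edev (\<mu> i) ({i} \<times> {1..r}) Z" for i r :: nat and Z
  have d_nonneg: "0 \<le> d i r Z" and d_le: "d i r Z \<le> real r" for i r :: nat and Z
    unfolding d_def using edev_nonneg[OF prob_\<mu> sets_\<mu>] edev_le_card[OF prob_\<mu> sets_\<mu>, of i "{i} \<times> {1..r}" Z]
    by (auto simp: card_cartesian_product)
  define V where "V Z = Max ((\<lambda>(i, r). d i r Z) ` ?S)" for Z
  \<comment> \<open>Doob's inequality is used with \<beta> = 4 / (3 hi). At r = hi its exponent is
    2/3 of 2 hi dev^2, a variable with tail 2 exp (-x), so the exponential moment is at most 1 + 2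
    (2/3) / (1/3) = 5. A larger share than 2/3 would lower the factor 3/4 and raise the 5; this
    choice keeps both within the constants of \<open>A_nK\<close>.\<close>
  define W where "W Z = 4 / (3 * real hi) * (V Z)\<^sup>2" for Z
  have hi0: "0 < hi" using lo by simp
  have fin: "finite ?S" "?S \<noteq> {}" using K hi0 by auto
  have m: "d i r \<in> borel_measurable ?T" if "(i, r) \<in> ?S" for i r
  proof -
    have "{i} \<times> {1..r} \<subseteq> ?I" using that hi by auto
    then show ?thesis
      unfolding d_def by (rule edev_measurable[OF prob_\<mu> sets_\<mu>, rotated]) (auto simp: sets_\<mu>)
  qed
  have m': "(\<lambda>Z. case p of (i, r) \<Rightarrow> d i r Z) \<in> borel_measurable ?T" if p: "p \<in> ?S" for p
    using m p by (cases p) auto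
  have Vm[measurable]: "V \<in> borel_measurable ?T" unfolding V_def using fin m' by (intro borel_measurable_Max) auto
  have le: "d i r Z \<le> V Z" if "(i, r) \<in> ?S" for i r Z
  proof -
    have "(\<lambda>(i, r). d i r Z) (i, r) \<in> (\<lambda>(i, r). d i r Z) ` ?S" using that by (rule imageI)
    then show ?thesis unfolding V_def using fin by (intro Max_ge) auto
  qed
  have V0: "0 \<le> V Z" for Z using le[of 1 1 Z] d_nonneg[of 1 1 Z] K hi0 by force
  have Vh: "V Z \<le> hi" for Z
    unfolding V_def
  proof (rule Max.boundedI)
    show "\<And>a. a \<in> (\<lambda>(i, r). d i r Z) ` ?S \<Longrightarrow> a \<le> hi" by (auto intro: order_trans[OF d_le])
  qed (use fin in auto)
  have "T.expectation (sup_dev K lo hi) \<le> sqrt ((3 * real hi / (4 * (real lo)\<^sup>2)) * (1 + ln (5 * real K)))"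
  proof (rule expectation_sup_dev_le_sqrt)
    show "W \<in> borel_measurable ?T" unfolding W_def by measurable
    show "0 \<le> W Z" for Z by (simp add: W_def)
    show "1 \<le> 5 * real K" using K by simp
    show "T.prob {Z \<in> space ?T. x < W Z} \<le> 5 * real K * exp (- x)" if x: "0 \<le> x" for x
    proof -
      define y where "y = sqrt (3 * real hi / 4 * x)"
      have y: "0 \<le> y" "y\<^sup>2 = 3 * real hi / 4 * x" using x by (auto simp: y_def)
      let ?B = "\<lambda>i. {Z \<in> space ?T. \<exists>r\<in>{1..hi}. y < d i r Z}"
      have Bm: "?B i \<in> sets ?T" if "i \<in> {1..K}" for i
        using that m by (intro sets.sets_Collect_finite_Ex borel_measurable_less) auto
      have "{Z \<in> space ?T. x < W Z} \<subseteq> (\<Union>i\<in>{1..K}. ?B i)"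
      proof
        fix Z assume Z: "Z \<in> {Z \<in> space ?T. x < W Z}"
        then have "y\<^sup>2 < (V Z)\<^sup>2" using hi0 unfolding y by (simp add: W_def field_simps)
        then have "y < V Z" using V0 by (rule power2_less_imp_less)
        then have "\<exists>p\<in>?S. y < (case p of (i, r) \<Rightarrow> d i r Z)" unfolding V_def using fin by (subst (asm) Max_gr_iff) auto
        then show "Z \<in> (\<Union>i\<in>{1..K}. ?B i)" using Z by fastforce
      qed
      then have "T.prob {Z \<in> space ?T. x < W Z} \<le> T.prob (\<Union>i\<in>{1..K}. ?B i)"
        using Bm by (intro T.finite_measure_mono) auto
      also have "\<dots> \<le> (\<Sum>i\<in>{1..K}. T.prob (?B i))"
        using Bm by (intro T.finite_measure_subadditive_finite) auto
      also have "\<dots> \<le> (\<Sum>i\<in>{1..K}. 5 * exp (- x))"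
      proof (intro sum_mono)
        fix i assume i: "i \<in> {1..K}"
        let ?c = "4 / (3 * real hi)"
        have im: "(\<lambda>q. (i, q)) ` {1..r} = {i} \<times> {1..r}" for r by auto
        have "ennreal (exp (?c * y\<^sup>2)) * emeasure ?T (?B i) \<le> (\<integral>\<^sup>+Z. ennreal (exp (?c * (d i hi Z)\<^sup>2)) \<partial>?T)"
        proof -
          have "(\<lambda>q. (i, q)) ` {1..hi} \<subseteq> ?I" "finite ?I" "inj_on (\<lambda>q. (i, q)) {1..hi}"
            using i hi by (auto simp: inj_on_def)
          then show ?thesis
            using edev_maximal_inequality[OF prob_\<mu> sets_\<mu>, of "\<lambda>p. \<mu> (fst p)" ?I "\<lambda>q. (i, q)" hi i ?c y]
              prob_\<mu> y(1) unfolding im d_def by simp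
        qed
        also have "\<dots> = (\<integral>\<^sup>+Z. ennreal (exp ((2 / 3) * (2 * real hi * (arm_dev i hi Z)\<^sup>2))) \<partial>?T)"
          using hi0 by (intro nn_integral_cong) (simp add: arm_dev_def d_def power_divide power2_eq_square)
        also have "\<dots> \<le> ennreal (1 + 2 * (2 / 3) / (1 - 2 / 3))"
        proof (rule T.exp_moment_le_of_exp_tail)
          have [measurable]: "arm_dev i hi \<in> borel_measurable ?T" using i by (intro arm_dev_measurable') auto
          show "(\<lambda>Z. 2 * real hi * (arm_dev i hi Z)\<^sup>2) \<in> borel_measurable ?T" by measurable
          show "T.prob {Z \<in> space ?T. x < 2 * real hi * (arm_dev i hi Z)\<^sup>2} \<le> 2 * exp (- x)" if x: "0 \<le> x" for x
          proof -
            have "{Z \<in> space ?T. x < 2 * real hi * (arm_dev i hi Z)\<^sup>2} \<subseteq> {Z \<in> space ?T. sqrt (x / (2 * real hi)) < arm_dev i hi Z}"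
            proof
              fix Z assume Z: "Z \<in> {Z \<in> space ?T. x < 2 * real hi * (arm_dev i hi Z)\<^sup>2}"
              then have "x / (2 * real hi) < (arm_dev i hi Z)\<^sup>2" using hi0 by (simp add: field_simps)
              then have "sqrt (x / (2 * real hi)) < arm_dev i hi Z" by (intro real_less_lsqrt arm_dev_nonneg)
              then show "Z \<in> {Z \<in> space ?T. sqrt (x / (2 * real hi)) < arm_dev i hi Z}" using Z by simp
            qed
            then have "T.prob {Z \<in> space ?T. x < 2 * real hi * (arm_dev i hi Z)\<^sup>2} \<le> T.prob {Z \<in> space ?T. sqrt (x / (2 * real hi)) < arm_dev i hi Z}"
              by (rule T.finite_measure_mono) measurable
            also have "\<dots> \<le> 2 * exp (- 2 * real hi * (sqrt (x / (2 * real hi)))\<^sup>2)"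
              using i hi hi0 x by (intro arm_dev_tail) auto
            also have "\<dots> = 2 * exp (- x)" using hi0 x by simp
            finally show ?thesis .
          qed
        qed auto
        also have "1 + 2 * (2 / 3) / (1 - 2 / 3) = (5 :: real)" by simp
        finally have "ennreal (exp (?c * y\<^sup>2) * T.prob (?B i)) \<le> ennreal 5"
          unfolding T.emeasure_eq_measure by (simp add: ennreal_mult)
        then have "exp (?c * y\<^sup>2) * T.prob (?B i) \<le> 5"
          by (simp only: ennreal_le_iff[OF zero_le_numeral])
        moreover have "?c * y\<^sup>2 = x" using hi0 unfolding y(2) by simp
        ultimately show "T.prob (?B i) \<le> 5 * exp (- x)" by (simp add: exp_minus field_simps)
      qed
      finally show ?thesis by simp
    qed
    show "(sup_dev K lo hi Z)\<^sup>2 \<le> 3 * real hi / (4 * (real lo)\<^sup>2) * W Z" for Z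
    proof -
      obtain i r where ir: "i \<in> {1..K}" "r \<in> {lo..hi}" "sup_dev K lo hi Z = arm_dev i r Z"
        using sup_dev_attained by blast
      have "arm_dev i r Z \<le> V Z / lo"
        unfolding arm_dev_def using le[of i r Z] ir lo d_nonneg[of i r Z] by (intro frac_le) (auto simp: d_def)
      then have "(arm_dev i r Z)\<^sup>2 \<le> (V Z / lo)\<^sup>2" by (intro power_mono arm_dev_nonneg)
      also have "\<dots> = 3 * real hi / (4 * (real lo)\<^sup>2) * W Z" using hi0 by (simp add: W_def power_divide)
      finally show ?thesis using ir by simp
    qed
    show "W Z \<le> 4 / (3 * real hi) * (real hi)\<^sup>2" for Z
      unfolding W_def using V0 Vh by (intro mult_left_mono) (auto intro: power_mono)
  qed auto
  also have "sqrt ((3 * real hi / (4 * (real lo)\<^sup>2)) * (1 + ln (5 * real K))) = sqrt (3 / 4 * real hi * (1 + ln (5 * real K))) / lo"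
    using lo by (simp add: real_sqrt_divide real_sqrt_mult)
  finally show ?thesis .
qed

end

end


section \<open>Adaptive sampling\<close>

lemma D_cdf_range:
  assumes "F \<in> D_cdf a b"
  shows "0 \<le> F x" "F x \<le> 1"
proof -
  have F: "mono F" "(F \<longlongrightarrow> 0) at_bot" "(F \<longlongrightarrow> 1) at_top"
    using assms by (auto simp: D_cdf_def real_cdf_def)
  show "0 \<le> F x"
  proof (rule tendsto_upperbound[OF F(2)])
    show "\<forall>\<^sub>F y in at_bot. F y \<le> F x"
      using F(1) by (auto simp: eventually_at_bot_linorder mono_def)
  qed simp
  show "F x \<le> 1"
  proof (rule tendsto_lowerbound[OF F(3)])
    show "\<forall>\<^sub>F y in at_top. F x \<le> F y"
      using F(1) by (auto simp: eventually_at_top_linorder mono_def)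
  qed simp
qed

lemma convex_D_cdf: "convex_fun_set (D_cdf a b)"
  unfolding convex_fun_set_def
proof (intro ballI allI impI)
  fix F G :: "real \<Rightarrow> real" and u :: real
  assume F: "F \<in> D_cdf a b" and G: "G \<in> D_cdf a b" and u: "0 \<le> u \<and> u \<le> 1"
  let ?H = "\<lambda>x. u * F x + (1 - u) * G x"
  have "mono ?H" using F G u unfolding D_cdf_def real_cdf_def mono_def
    by (auto intro!: add_mono mult_left_mono)
  moreover have "continuous (at_right x) ?H" for x
    using F G unfolding D_cdf_def real_cdf_def by (auto intro!: continuous_intros)
  moreover have "(?H \<longlongrightarrow> u * 0 + (1 - u) * 0) at_bot" "(?H \<longlongrightarrow> u * 1 + (1 - u) * 1) at_top"
    "(?H \<longlongrightarrow> u * 0 + (1 - u) * 0) (at_left a)"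
    using F G unfolding D_cdf_def real_cdf_def
    by (intro tendsto_add tendsto_mult tendsto_const; simp)+
  ultimately show "?H \<in> D_cdf a b" using F G by (auto simp: D_cdf_def real_cdf_def)
qed

lemma step_in_D_cdf:
  assumes "c \<in> {a..b}"
  shows "(\<lambda>z. if c \<le> z then 1 else 0) \<in> D_cdf a b"
proof -
  let ?F = "\<lambda>z. if c \<le> z then 1 else (0 :: real)"
  have "continuous (at_right x) ?F" for x
  proof -
    have "?F = (\<lambda>x. indicat_real {..x} c)" by (auto simp: indicator_def)
    then show ?thesis using indicator_atMost_right_cont[of x c] by simp
  qed
  moreover have "(?F \<longlongrightarrow> 0) at_bot"
    by (rule tendsto_eventually) (auto simp: eventually_at_bot_linorder intro!: exI[of _ "c - 1"])
  moreover have "(?F \<longlongrightarrow> 1) at_top"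
    by (rule tendsto_eventually) (auto simp: eventually_at_top_linorder)
  moreover have "(?F \<longlongrightarrow> 0) (at_left a)"
    using assms by (intro tendsto_eventually) (auto simp: eventually_at_left_field intro!: exI[of _ "a - 1"])
  ultimately show ?thesis using assms by (auto simp: D_cdf_def real_cdf_def mono_def)
qed

lemma convex_fun_set_sum:
  fixes w :: "'i \<Rightarrow> real"
  assumes D: "convex_fun_set D" and S: "finite S" and w: "\<And>s. s \<in> S \<Longrightarrow> 0 \<le> w s" "(\<Sum>s\<in>S. w s) = 1"
    and G: "\<And>s. s \<in> S \<Longrightarrow> G s \<in> D"
  shows "(\<lambda>x. \<Sum>s\<in>S. w s * G s x) \<in> D"
  using S w G
proof (induction S arbitrary: w)
  case (insert s S)
  have nn: "0 \<le> (\<Sum>t\<in>S. w t)" using insert.prems by (intro sum_nonneg) auto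
  show ?case
  proof (cases "w s = 1")
    case True
    then have "(\<Sum>t\<in>S. w t) = 0" using insert by simp
    then have "\<forall>t\<in>S. w t = 0" using insert by (subst (asm) sum_nonneg_eq_0_iff) auto
    then have "(\<lambda>x. \<Sum>t\<in>insert s S. w t * G t x) = G s" using insert True by auto
    then show ?thesis using insert by simp
  next
    case False
    then have lt: "w s < 1" using insert nn by simp
    let ?v = "\<lambda>t. w t / (1 - w s)"
    have "(\<Sum>t\<in>S. ?v t) = (\<Sum>t\<in>S. w t) / (1 - w s)" by (simp add: sum_divide_distrib)
    also have "\<dots> = 1" using insert lt by simp
    finally have H: "(\<lambda>x. \<Sum>t\<in>S. ?v t * G t x) \<in> D" using insert lt by (intro insert.IH) auto
    have "(\<lambda>x. w s * G s x + (1 - w s) * (\<Sum>t\<in>S. ?v t * G t x)) \<in> D"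
      using D H insert lt unfolding convex_fun_set_def by (auto simp: less_imp_le)
    also have "(\<lambda>x. w s * G s x + (1 - w s) * (\<Sum>t\<in>S. ?v t * G t x)) = (\<lambda>x. \<Sum>t\<in>insert s S. w t * G t x)"
      using insert.hyps lt by (auto simp: sum_distrib_left)
    finally show ?thesis .
  qed
qed simp

lemma mix_in_convex:
  assumes "convex_fun_set D" "\<delta> \<in> unit_simplex K" "\<And>i. i \<in> {1..K} \<Longrightarrow> F i \<in> D"
  shows "mix K \<delta> F \<in> D"
  unfolding mix_def using assms by (intro convex_fun_set_sum) (auto simp: unit_simplex_def)

definition arm_count :: "(nat \<Rightarrow> nat) \<Rightarrow> nat \<Rightarrow> nat \<Rightarrow> nat" where
  "arm_count asg t i = card {s \<in> {1..t}. asg s = i}"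

text \<open>With these weights the mixture of empirical cdfs is a convex combination of unit steps
  at the observed outcomes, one per subject. This is the form in which T is assumed to be
  measurable.\<close>

definition emp_weight :: "(nat \<Rightarrow> real) \<Rightarrow> (nat \<Rightarrow> nat) \<Rightarrow> nat \<Rightarrow> nat \<Rightarrow> real" where
  "emp_weight \<delta> asg t s = (if s \<in> {1..t} then \<delta> (asg s) / arm_count asg t (asg s) else 0)"

lemma mix_Fhat:
  assumes "\<And>s. s \<in> {1..t} \<Longrightarrow> asg s \<in> {1..K}"
  shows "mix K \<delta> (Fhat y asg t) = (\<lambda>x. \<Sum>s\<in>{1..t}. emp_weight \<delta> asg t s * (if y s (asg s) \<le> x then 1 else 0))"
proof
  fix x
  have "(\<Sum>s\<in>{1..t}. emp_weight \<delta> asg t s * (if y s (asg s) \<le> x then 1 else 0))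
    = (\<Sum>i\<in>{1..K}. \<Sum>s\<in>{s \<in> {1..t}. asg s = i}. emp_weight \<delta> asg t s * (if y s (asg s) \<le> x then 1 else 0))"
    using assms by (intro sum.group[symmetric]) auto
  also have "\<dots> = (\<Sum>i\<in>{1..K}. \<delta> i * Fhat y asg t i x)"
  proof (intro sum.cong refl)
    fix i
    have "(\<Sum>s\<in>{s \<in> {1..t}. asg s = i}. emp_weight \<delta> asg t s * (if y s (asg s) \<le> x then 1 else 0))
      = (\<Sum>s\<in>{s \<in> {1..t}. asg s = i}. \<delta> i / arm_count asg t i * (if y s i \<le> x then 1 else 0))"
      by (intro sum.cong) (auto simp: emp_weight_def)
    also have "\<dots> = \<delta> i / arm_count asg t i * (\<Sum>s\<in>{s \<in> {1..t}. asg s = i}. if y s i \<le> x then 1 else 0)"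
      by (simp add: sum_distrib_left)
    also have "(\<Sum>s\<in>{s \<in> {1..t}. asg s = i}. if y s i \<le> x then 1 else 0) = real (card {s \<in> {1..t}. asg s = i \<and> y s i \<le> x})"
      by (simp add: sum.If_cases Int_def conj_assoc)
    finally show "(\<Sum>s\<in>{s \<in> {1..t}. asg s = i}. emp_weight \<delta> asg t s * (if y s (asg s) \<le> x then 1 else 0)) = \<delta> i * Fhat y asg t i x"
      by (simp add: Fhat_def arm_count_def)
  qed
  finally show "mix K \<delta> (Fhat y asg t) x = (\<Sum>s\<in>{1..t}. emp_weight \<delta> asg t s * (if y s (asg s) \<le> x then 1 else 0))"
    by (simp add: mix_def)
qed

text \<open>The condition on the counts matters: the empirical cdf of an arm without observations is
  0 / 0 = 0, and the mass \<delta> i would be lost.\<close>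

lemma emp_weight_simplex:
  assumes asg: "\<And>s. s \<in> {1..t} \<Longrightarrow> asg s \<in> {1..K}" and \<delta>: "\<delta> \<in> unit_simplex K"
    and cnt: "\<And>i. i \<in> {1..K} \<Longrightarrow> \<delta> i \<noteq> 0 \<Longrightarrow> 0 < arm_count asg t i"
  shows "emp_weight \<delta> asg t \<in> unit_simplex t"
proof -
  have "(\<Sum>s\<in>{1..t}. emp_weight \<delta> asg t s) = (\<Sum>i\<in>{1..K}. \<Sum>s\<in>{s \<in> {1..t}. asg s = i}. emp_weight \<delta> asg t s)"
    using asg by (intro sum.group[symmetric]) auto
  also have "\<dots> = (\<Sum>i\<in>{1..K}. \<delta> i)"
  proof (intro sum.cong refl)
    fix i assume i: "i \<in> {1..K}"
    have "(\<Sum>s\<in>{s \<in> {1..t}. asg s = i}. emp_weight \<delta> asg t s) = (\<Sum>s\<in>{s \<in> {1..t}. asg s = i}. \<delta> i / arm_count asg t i)"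
      by (intro sum.cong) (auto simp: emp_weight_def)
    also have "\<dots> = arm_count asg t i * (\<delta> i / arm_count asg t i)" by (simp add: arm_count_def)
    also have "\<dots> = \<delta> i" using cnt[OF i] by (cases "\<delta> i = 0") auto
    finally show "(\<Sum>s\<in>{s \<in> {1..t}. asg s = i}. emp_weight \<delta> asg t s) = \<delta> i" .
  qed
  finally show ?thesis using \<delta> by (auto simp: unit_simplex_def emp_weight_def)
qed

lemma mix_diff_le:
  assumes \<delta>: "\<delta> \<in> simplex_on A K" and FG: "\<And>i. i \<in> A \<Longrightarrow> i \<in> {1..K} \<Longrightarrow> \<bar>F i x - G i x\<bar> \<le> c"
  shows "\<bar>mix K \<delta> F x - mix K \<delta> G x\<bar> \<le> c"
proof -
  have "\<bar>mix K \<delta> F x - mix K \<delta> G x\<bar> = \<bar>\<Sum>i\<in>{1..K}. \<delta> i * (F i x - G i x)\<bar>"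
    by (simp add: mix_def sum_subtractf right_diff_distrib)
  also have "\<dots> \<le> (\<Sum>i\<in>{1..K}. \<bar>\<delta> i * (F i x - G i x)\<bar>)" by (rule sum_abs)
  also have "\<dots> \<le> (\<Sum>i\<in>{1..K}. \<delta> i * c)"
  proof (intro sum_mono)
    fix i assume i: "i \<in> {1..K}"
    show "\<bar>\<delta> i * (F i x - G i x)\<bar> \<le> \<delta> i * c"
    proof (cases "i \<in> A")
      case True
      then show ?thesis using FG[OF True i] \<delta> by (auto simp: abs_mult simplex_on_def unit_simplex_def intro!: mult_left_mono)
    qed (use \<delta> in \<open>auto simp: simplex_on_def\<close>)
  qed
  also have "\<dots> = c" using \<delta> by (simp add: simplex_on_def unit_simplex_def sum_distrib_right[symmetric])
  finally show ?thesis .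
qed

lemma sup_norm_le:
  assumes "\<And>x. \<bar>F x\<bar> \<le> c"
  shows "sup_norm F \<le> c"
  unfolding sup_norm_def by (intro cSUP_least assms) simp

section \<open>Arranging adaptively assigned outcomes in a table\<close>

text \<open>An assignment may depend on everything about the earlier subjects, but not on subject s
  itself. This makes the new outcome independent of the treatment chosen for it.\<close>

locale adaptive_design =
  fixes P :: "(nat \<Rightarrow> real) measure" and K n :: nat and a :: "nat \<Rightarrow> (nat \<Rightarrow> nat \<Rightarrow> real) \<Rightarrow> nat"
  assumes prob_P: "prob_space P"
    and comp: "i \<in> {1..K} \<Longrightarrow> (\<lambda>v. v i) \<in> borel_measurable P"
    and a_range: "s \<in> {1..n} \<Longrightarrow> y \<in> space (PiM {1..n} (\<lambda>_. P)) \<Longrightarrow> a s y \<in> {1..K}"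
    and a_simple: "s \<in> {1..n} \<Longrightarrow> simple_function (PiM {1..n} (\<lambda>_. P)) (a s)"
    and a_adapted: "(\<And>u. u \<in> {1..<s} \<Longrightarrow> y u = y' u) \<Longrightarrow> a s y = a s y'"
begin

text \<open>The point mass outside 1, ..., K gives every index a probability measure on the Borel
  sets, as the table locale requires.\<close>

definition arm_law :: "nat \<Rightarrow> real measure" where
  "arm_law i = (if i \<in> {1..K} then distr P borel (\<lambda>v. v i) else return borel 0)"

lemma outcome_table_arm_law: "outcome_table arm_law"
proof (rule outcome_table.intro)
  fix i
  show "prob_space (arm_law i)"
    using prob_space.prob_space_distr[OF prob_P comp] prob_space_return[of 0 borel] by (auto simp: arm_law_def)
  show "sets (arm_law i) = sets borel" by (simp add: arm_law_def)
qed

sublocale outcome_table arm_law by (rule outcome_table_arm_law)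

abbreviation cells :: "(nat \<times> nat) set" where "cells \<equiv> {1..K} \<times> {1..n}"

text \<open>The count includes subject u, so the positions in a row start at 1.\<close>

definition cell :: "(nat \<Rightarrow> nat \<Rightarrow> real) \<Rightarrow> nat \<Rightarrow> nat \<times> nat" where
  "cell y u = (a u y, arm_count (\<lambda>s. a s y) u (a u y))"

text \<open>The outcomes fill their cells; the cells that are never reached are taken from an
  independent table \<open>X\<close>.\<close>

definition tab :: "(nat \<Rightarrow> nat \<Rightarrow> real) \<times> (nat \<times> nat \<Rightarrow> real) \<Rightarrow> nat \<times> nat \<Rightarrow> real" where
  "tab \<omega> = (\<lambda>p\<in>cells. if \<exists>u\<in>{1..n}. cell (fst \<omega>) u = p
     then \<Sum>u\<in>{1..n}. if cell (fst \<omega>) u = p then fst \<omega> u (fst p) else 0 else snd \<omega> p)"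

lemma inj_cell: "inj_on (cell y) {1..n}"
proof (rule linorder_inj_onI)
  fix u v assume uv: "u < v" "u \<in> {1..n}" "v \<in> {1..n}"
  show "cell y u \<noteq> cell y v"
  proof
    assume eq: "cell y u = cell y v"
    then have e: "a u y = a v y" by (simp add: cell_def)
    have "{s \<in> {1..u}. a s y = a u y} \<subseteq> {s \<in> {1..v}. a s y = a u y}"
      "v \<in> {s \<in> {1..v}. a s y = a u y}" "v \<notin> {s \<in> {1..u}. a s y = a u y}" using uv e by auto
    then have "{s \<in> {1..u}. a s y = a u y} \<subset> {s \<in> {1..v}. a s y = a u y}" by blast
    then have "arm_count (\<lambda>s. a s y) u (a u y) < arm_count (\<lambda>s. a s y) v (a u y)"
      unfolding arm_count_def by (intro psubset_card_mono) auto
    then show False using eq e by (simp add: cell_def)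
  qed
qed auto

lemma cell_in_cells:
  assumes "u \<in> {1..n}" "y \<in> space (PiM {1..n} (\<lambda>_. P))"
  shows "cell y u \<in> cells"
proof -
  have "u \<in> {s \<in> {1..u}. a s y = a u y}" using assms by auto
  then have "0 < arm_count (\<lambda>s. a s y) u (a u y)" unfolding arm_count_def by (auto simp: card_gt_0_iff)
  moreover have "arm_count (\<lambda>s. a s y) u (a u y) \<le> card {1..u}" unfolding arm_count_def by (intro card_mono) auto
  ultimately show ?thesis using assms a_range[OF assms] by (auto simp: cell_def)
qed

lemma cell_adapted:
  assumes "\<And>u. u \<in> {1..<s} \<Longrightarrow> y u = y' u" "u \<le> s"
  shows "cell y u = cell y' u"
proof -
  have "a v y = a v y'" if "v \<le> u" for v using assms that by (intro a_adapted) auto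
  then show ?thesis unfolding cell_def arm_count_def by (auto intro!: arg_cong[where f=card])
qed

lemma cell_simple:
  assumes "u \<in> {1..n}"
  shows "simple_function (PiM {1..n} (\<lambda>_. P)) (\<lambda>y. cell y u)"
proof -
  have "arm_count (\<lambda>s. a s y) u i = (\<Sum>s\<in>{1..u}. if a s y = i then 1 else 0)" for y i
    by (simp add: arm_count_def sum.If_cases Int_def)
  moreover have "simple_function (PiM {1..n} (\<lambda>_. P)) (\<lambda>y. (\<Sum>s\<in>{1..u}. if a s y = a u y then 1 else 0 :: nat))"
  proof (intro simple_function_sum)
    fix s assume "s \<in> {1..u}"
    then show "simple_function (PiM {1..n} (\<lambda>_. P)) (\<lambda>y. if a s y = a u y then 1 else 0 :: nat)"
      using assms by (intro simple_function_compose2[where h="\<lambda>x y. if x = y then 1 else 0"] a_simple) auto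
  qed
  ultimately have "simple_function (PiM {1..n} (\<lambda>_. P)) (\<lambda>y. arm_count (\<lambda>s. a s y) u (a u y))" by (simp only:)
  from simple_function_Pair[OF a_simple[OF assms] this] show ?thesis unfolding cell_def .
qed

lemma cell_measurable:
  assumes "u \<in> {1..n}"
  shows "(\<lambda>y. cell y u) \<in> measurable (PiM {1..n} (\<lambda>_. P)) (count_space UNIV)"
  by (rule measurable_simple_function[OF cell_simple[OF assms]])

lemma outcome_measurable:
  assumes "u \<in> {1..n}" "i \<in> {1..K}"
  shows "(\<lambda>y. y u i) \<in> borel_measurable (PiM {1..n} (\<lambda>_. P))"
  using measurable_compose[OF measurable_component_singleton[OF assms(1)] comp[OF assms(2)]] .

lemma cell_pred:
  assumes "u \<in> {1..n}"
  shows "Measurable.pred (PiM {1..n} (\<lambda>_. P)) (\<lambda>y. cell y u = p)"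
  using measurable_compose[OF cell_measurable[OF assms], of "\<lambda>q. q = p" "count_space UNIV"] by simp

lemma tab_measurable: "tab \<in> measurable (PiM {1..n} (\<lambda>_. P) \<Otimes>\<^sub>M table_measure cells) (table_measure cells)"
  unfolding tab_def
proof (rule measurable_restrict)
  fix p assume p: "p \<in> cells"
  let ?M = "PiM {1..n} (\<lambda>_. P) \<Otimes>\<^sub>M table_measure cells"
  have [measurable]: "Measurable.pred ?M (\<lambda>\<omega>. cell (fst \<omega>) u = p)" if "u \<in> {1..n}" for u
    using measurable_compose[OF measurable_fst cell_pred[OF that]] .
  have [measurable]: "(\<lambda>\<omega>. fst \<omega> u (fst p)) \<in> borel_measurable ?M" if "u \<in> {1..n}" for u
    using measurable_compose[OF measurable_fst outcome_measurable[OF that, of "fst p"]] p by auto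
  have "(\<lambda>\<omega>. snd \<omega> p) \<in> measurable ?M (arm_law (fst p))"
    using measurable_compose[OF measurable_snd measurable_component_singleton[OF p]] .
  then have [measurable]: "(\<lambda>\<omega>. snd \<omega> p) \<in> borel_measurable ?M"
    using measurable_cong_sets[OF refl sets_\<mu>, of ?M "fst p"] by simp
  have "(\<lambda>\<omega>. if \<exists>u\<in>{1..n}. cell (fst \<omega>) u = p
     then \<Sum>u\<in>{1..n}. if cell (fst \<omega>) u = p then fst \<omega> u (fst p) else 0 else snd \<omega> p) \<in> borel_measurable ?M"
    by measurable
  then show "(\<lambda>\<omega>. if \<exists>u\<in>{1..n}. cell (fst \<omega>) u = p
     then \<Sum>u\<in>{1..n}. if cell (fst \<omega>) u = p then fst \<omega> u (fst p) else 0 else snd \<omega> p) \<in> measurable ?M (arm_law (fst p))"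
    using measurable_cong_sets[OF refl sets_\<mu>, of ?M "fst p"] by simp
qed

text \<open>By injectivity of \<open>cell\<close> the sum in \<open>tab\<close> has a single nonzero
  term; written as a sum, the entry is visibly measurable.\<close>

lemma tab_cell:
  assumes u: "u \<in> {1..n}" and y: "y \<in> space (PiM {1..n} (\<lambda>_. P))"
  shows "tab (y, X) (cell y u) = y u (a u y)"
proof -
  have "tab (y, X) (cell y u) = (\<Sum>v\<in>{1..n}. if cell y v = cell y u then y v (fst (cell y u)) else 0)"
  proof -
    have "\<exists>v\<in>{1..n}. cell y v = cell y u" using u by blast
    then show ?thesis using cell_in_cells[OF u y] by (simp add: tab_def cong: if_cong)
  qed
  also have "\<dots> = (\<Sum>v\<in>{1..n}. if v = u then y u (a u y) else 0)"
  proof (intro sum.cong refl)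
    fix v assume "v \<in> {1..n}"
    then have "cell y v = cell y u \<longleftrightarrow> v = u" using inj_onD[OF inj_cell, of y v u] u by blast
    then show "(if cell y v = cell y u then y v (fst (cell y u)) else 0) = (if v = u then y u (a u y) else 0)"
      by (simp add: cell_def)
  qed
  also have "\<dots> = y u (a u y)" using u by simp
  finally show ?thesis .
qed

text \<open>H s multiplies the indicators for the cells filled by the first s subjects with the
  probabilities of the cells still empty. Its integral does not depend on s: the cell of the next
  subject is determined by the past, so integrating out that subject turns its indicator into the
  probability. H 0 is the product of the marginals, and H n is what integrating out the fillers
  leaves.\<close>

lemma tab_law: "distr (PiM {1..n} (\<lambda>_. P) \<Otimes>\<^sub>M table_measure cells) (table_measure cells) tab = table_measure cells"
proof -
  let ?M = "PiM {1..n} (\<lambda>_. P)"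
  let ?Q = "table_measure cells"
  interpret P: prob_space P by (rule prob_P)
  interpret PP: product_prob_space "\<lambda>_. P" UNIV by (rule product_prob_spaceI) (rule prob_P)
  interpret PQ: product_prob_space "\<lambda>p. arm_law (fst p)" UNIV by (rule product_prob_spaceI) (rule prob_\<mu>)
  interpret M: prob_space ?M by (intro prob_space_PiM prob_P)
  interpret Q: prob_space ?Q by (rule prob_space_table)
  have fc: "finite cells" by simp
  show ?thesis
  proof (rule PQ.PiM_eqI[OF fc])
    fix B assume B: "\<And>p. p \<in> cells \<Longrightarrow> B p \<in> sets (arm_law (fst p))"
    define o' where "o' y u = (indicator (B (cell y u)) (y u (a u y)) :: ennreal)" for y u
    define rest where "rest s y = (\<Prod>p\<in>cells. if \<exists>u\<in>{1..s}. cell y u = p then 1 else emeasure (arm_law (fst p)) (B p))" for s :: nat and y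
    define H where "H s y = (\<Prod>u\<in>{1..s}. o' y u) * rest s y" for s y
    have om: "(\<lambda>y. o' y u) \<in> borel_measurable ?M" if u: "u \<in> {1..n}" for u
    proof -
      \<comment> \<open>The empty set off the table makes every index measurable, as composition
        over the countably many values of \<open>cell\<close> needs.\<close>
      define B' where "B' p = (if p \<in> cells then B p else {})" for p
      have "(\<lambda>y. if fst p \<in> {1..K} then indicator (B' p) (y u (fst p)) else (0 :: ennreal)) \<in> borel_measurable ?M" for p
      proof (cases "fst p \<in> {1..K}")
        case True
        have "B' p \<in> sets borel" using B[of p] sets_\<mu>[of "fst p"] by (auto simp: B'_def)
        then show ?thesis using True outcome_measurable[OF u True] by simp
      next
        case False
        then show ?thesis by (simp only: if_False borel_measurable_const)
      qed
      from measurable_compose_countable[OF this cell_measurable[OF u]]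
      have "(\<lambda>y. if fst (cell y u) \<in> {1..K} then indicator (B' (cell y u)) (y u (fst (cell y u))) else (0 :: ennreal)) \<in> borel_measurable ?M" .
      then show ?thesis
        by (rule measurable_cong[THEN iffD1, rotated]) (use cell_in_cells[OF u] in \<open>auto simp: o'_def B'_def cell_def\<close>)
    qed
    have rm: "rest s \<in> borel_measurable ?M" if "s \<le> n" for s
      unfolding rest_def
    proof (intro borel_measurable_prod_ennreal)
      fix p
      have "Measurable.pred ?M (\<lambda>y. cell y u = p)" if "u \<in> {1..s}" for u
        using cell_pred[of u p] that \<open>s \<le> n\<close> by auto
      then have [measurable]: "Measurable.pred ?M (\<lambda>y. \<exists>u\<in>{1..s}. cell y u = p)" by measurable
      show "(\<lambda>y. if \<exists>u\<in>{1..s}. cell y u = p then 1 else emeasure (arm_law (fst p)) (B p)) \<in> borel_measurable ?M"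
        by measurable
    qed
    have Hm: "H s \<in> borel_measurable ?M" if "s \<le> n" for s
      unfolding H_def using that om rm by (intro borel_measurable_times_ennreal borel_measurable_prod_ennreal) auto
    have step: "(\<integral>\<^sup>+y. H (Suc s) y \<partial>?M) = (\<integral>\<^sup>+y. H s y \<partial>?M)" if s: "Suc s \<le> n" for s
    proof -
      define t where "t = Suc s"
      have t: "t \<in> {1..n}" using s by (auto simp: t_def)
      have JJ: "{1..n} = insert t ({1..n} - {t})" "finite ({1..n} - {t})" "t \<notin> {1..n} - {t}" using t by auto
      have fub: "(\<integral>\<^sup>+y. f y \<partial>?M) = (\<integral>\<^sup>+x. \<integral>\<^sup>+v. f (x(t := v)) \<partial>P \<partial>PiM ({1..n} - {t}) (\<lambda>_. P))"
        if "f \<in> borel_measurable ?M" for f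
        using PP.product_nn_integral_insert[OF JJ(2,3), of f] that unfolding JJ(1)[symmetric] .
      have "(\<integral>\<^sup>+v. H t (x(t := v)) \<partial>P) = (\<integral>\<^sup>+v. H s (x(t := v)) \<partial>P)"
        if x: "x \<in> space (PiM ({1..n} - {t}) (\<lambda>_. P))" for x
      proof -
        have sp: "x(t := v) \<in> space ?M" if "v \<in> space P" for v
          using x that t by (auto simp: space_PiM PiE_iff extensional_def)
        \<comment> \<open>x has no proper value at t, but the cell of subject t depends on earlier
          coordinates alone and can be read off from x.\<close>
        define q where "q = cell x t"
        have cellx: "cell (x(t := v)) u = cell x u" if "u \<le> t" for u v
          using that by (intro cell_adapted[where s = t]) auto
        have ax: "a u (x(t := v)) = a u x" if "u \<le> t" for u v
          using that by (intro a_adapted) auto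
        obtain v0 where "v0 \<in> space P" using P.not_empty by blast
        then have q: "q \<in> cells" "a t x = fst q" using cell_in_cells[OF t sp[of v0]] cellx[of t v0] by (auto simp: q_def cell_def)
        have qn: "cell x u \<noteq> q" if "u \<in> {1..s}" for u
          using inj_onD[OF inj_cell[of x], of u t] that t by (auto simp: q_def t_def)
        define pre where "pre = (\<Prod>u\<in>{1..s}. o' x u)"
        have o's: "(\<Prod>u\<in>{1..s}. o' (x(t := v)) u) = pre" for v
          unfolding pre_def o'_def using cellx ax by (intro prod.cong refl) (auto simp: t_def)
        have rs: "rest r (x(t := v)) = rest r x" if "r \<le> t" for r v
          unfolding rest_def using cellx that by (intro prod.cong refl if_cong) auto
        have "rest s x = emeasure (arm_law (fst q)) (B q) * (\<Prod>p\<in>cells - {q}. if \<exists>u\<in>{1..s}. cell x u = p then 1 else emeasure (arm_law (fst p)) (B p))"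
          unfolding rest_def using q qn fc by (subst prod.remove[of _ q]) auto
        also have "(\<Prod>p\<in>cells - {q}. if \<exists>u\<in>{1..s}. cell x u = p then 1 else emeasure (arm_law (fst p)) (B p)) =
          (\<Prod>p\<in>cells - {q}. if \<exists>u\<in>{1..t}. cell x u = p then 1 else emeasure (arm_law (fst p)) (B p))"
          by (intro prod.cong refl if_cong) (auto simp: t_def atLeastAtMostSuc_conv q_def)
        also have "\<dots> = rest t x"
          unfolding rest_def using q fc t by (subst (2) prod.remove[of _ q]) (auto simp: q_def)
        finally have rst: "rest s x = emeasure (arm_law (fst q)) (B q) * rest t x" .
        have Bq: "B q \<in> sets borel" using B[OF q(1)] by (simp add: sets_\<mu>)
        have fq: "fst q \<in> {1..K}" using q by auto
        have "H t (x(t := v)) = (pre * rest t x) * indicator (B q) (v (fst q))" for v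
        proof -
          have e: "(\<Prod>u\<in>{1..t}. o' (x(t := v)) u) = o' (x(t := v)) t * pre"
            unfolding o's[of v, symmetric] by (simp add: t_def atLeastAtMostSuc_conv)
          have e': "o' (x(t := v)) t = indicator (B q) (v (fst q))"
            unfolding o'_def using cellx[of t v] ax[of t v] q by (simp add: q_def)
          show ?thesis unfolding H_def e e' rs[OF order_refl] by (simp only: mult_ac)
        qed
        then have "(\<integral>\<^sup>+v. H t (x(t := v)) \<partial>P) = (\<integral>\<^sup>+v. (pre * rest t x) * indicator (B q) (v (fst q)) \<partial>P)" by simp
        also have "\<dots> = (pre * rest t x) * (\<integral>\<^sup>+v. indicator (B q) (v (fst q)) \<partial>P)"
          using Bq comp[OF fq] by (intro nn_integral_cmult) auto
        also have "(\<integral>\<^sup>+v. indicator (B q) (v (fst q)) \<partial>P) = emeasure (arm_law (fst q)) (B q)"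
        proof -
          have "emeasure (arm_law (fst q)) (B q) = (\<integral>\<^sup>+z. indicator (B q) z \<partial>distr P borel (\<lambda>v. v (fst q)))"
            using Bq fq by (simp add: arm_law_def)
          also have "\<dots> = (\<integral>\<^sup>+v. indicator (B q) (v (fst q)) \<partial>P)"
            using Bq comp[OF fq] by (intro nn_integral_distr) auto
          finally show ?thesis by simp
        qed
        also have "(pre * rest t x) * emeasure (arm_law (fst q)) (B q) = (\<integral>\<^sup>+v. pre * rest s x \<partial>P)"
          by (simp add: rst P.emeasure_space_1 mult_ac)
        also have "\<dots> = (\<integral>\<^sup>+v. H s (x(t := v)) \<partial>P)"
          unfolding H_def using o's rs[of s] by (simp add: t_def)
        finally show ?thesis .
      qed
      then have "(\<integral>\<^sup>+x. \<integral>\<^sup>+v. H t (x(t := v)) \<partial>P \<partial>PiM ({1..n} - {t}) (\<lambda>_. P)) =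
          (\<integral>\<^sup>+x. \<integral>\<^sup>+v. H s (x(t := v)) \<partial>P \<partial>PiM ({1..n} - {t}) (\<lambda>_. P))"
        by (rule nn_integral_cong)
      then show ?thesis using fub[OF Hm[of t]] fub[OF Hm[of s]] s unfolding t_def by (simp only: Suc_leD)
    qed
    have H0: "(\<integral>\<^sup>+y. H s y \<partial>?M) = (\<Prod>p\<in>cells. emeasure (arm_law (fst p)) (B p))" if "s \<le> n" for s
      using that
    proof (induction s)
      case 0
      have e: "H 0 = (\<lambda>_. \<Prod>p\<in>cells. emeasure (arm_law (fst p)) (B p))" by (simp add: fun_eq_iff H_def rest_def)
      show ?case unfolding e nn_integral_const M.emeasure_space_1 by (rule mult_1_right)
    next
      case (Suc s)
      then show ?case using step[of s] by (simp only: Suc_leD)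
    qed
    have Bs: "Pi\<^sub>E cells B \<in> sets ?Q" using fc B by (rule sets_PiM_I_finite)
    have "emeasure (distr (?M \<Otimes>\<^sub>M ?Q) ?Q tab) (Pi\<^sub>E cells B) = (\<integral>\<^sup>+Z. indicator (Pi\<^sub>E cells B) Z \<partial>distr (?M \<Otimes>\<^sub>M ?Q) ?Q tab)"
      by (rule nn_integral_indicator[symmetric], subst sets_distr) (rule Bs)
    also have "\<dots> = (\<integral>\<^sup>+\<omega>. indicator (Pi\<^sub>E cells B) (tab \<omega>) \<partial>(?M \<Otimes>\<^sub>M ?Q))"
      by (rule nn_integral_distr[OF tab_measurable], rule borel_measurable_indicator, subst sets_distr) (rule Bs)
    also have "\<dots> = (\<integral>\<^sup>+y. \<integral>\<^sup>+X. indicator (Pi\<^sub>E cells B) (tab (y, X)) \<partial>?Q \<partial>?M)"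
    proof (rule Q.nn_integral_fst[symmetric])
      have "indicator (Pi\<^sub>E cells B) \<in> borel_measurable ?Q"
        using Bs by (rule borel_measurable_indicator)
      then show "(\<lambda>\<omega>. indicator (Pi\<^sub>E cells B) (tab \<omega>)) \<in> borel_measurable (?M \<Otimes>\<^sub>M ?Q)"
        by (rule measurable_compose[OF tab_measurable])
    qed
    also have "\<dots> = (\<integral>\<^sup>+y. H n y \<partial>?M)"
    proof (intro nn_integral_cong)
      fix y assume y: "y \<in> space ?M"
      have ind: "indicator (Pi\<^sub>E cells B) (tab (y, X)) = (\<Prod>u\<in>{1..n}. o' y u) *
          (\<Prod>p\<in>cells. if \<exists>u\<in>{1..n}. cell y u = p then 1 else (indicator (B p) (X p) :: ennreal))" for X
      proof -
        have "indicator (Pi\<^sub>E cells B) (tab (y, X)) = (\<Prod>p\<in>cells. (indicator (B p) (tab (y, X) p) :: ennreal))"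
        proof (cases "tab (y, X) \<in> Pi\<^sub>E cells B")
          case False
          have "tab (y, X) \<in> extensional cells" by (simp add: tab_def)
          then obtain p where p: "p \<in> cells" "tab (y, X) p \<notin> B p" using False by (auto simp only: PiE_iff)
          then have "\<exists>p\<in>cells. (indicator (B p) (tab (y, X) p) :: ennreal) = 0" by (intro bexI[OF _ p(1)]) simp
          then have "(\<Prod>p\<in>cells. (indicator (B p) (tab (y, X) p) :: ennreal)) = 0" by (rule prod_zero[OF fc])
          then show ?thesis using False by simp
        next
          case True
          then have "(\<Prod>p\<in>cells. (indicator (B p) (tab (y, X) p) :: ennreal)) = 1"
            by (intro prod.neutral ballI) (simp only: PiE_iff indicator_simps)
          then show ?thesis using True by simp
        qed
        also have "\<dots> = (\<Prod>p\<in>cell y ` {1..n}. indicator (B p) (tab (y, X) p)) * (\<Prod>p\<in>cells - cell y ` {1..n}. indicator (B p) (tab (y, X) p))"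
        proof -
          have sub: "cell y ` {1..n} \<subseteq> cells" using cell_in_cells[OF _ y] by blast
          show ?thesis by (subst prod.subset_diff[OF sub fc]) (rule mult.commute)
        qed
        also have "(\<Prod>p\<in>cell y ` {1..n}. indicator (B p) (tab (y, X) p)) = (\<Prod>u\<in>{1..n}. o' y u)"
          unfolding prod.reindex[OF inj_cell] o_def o'_def by (intro prod.cong refl) (simp only: tab_cell[OF _ y])
        also have "(\<Prod>p\<in>cells - cell y ` {1..n}. indicator (B p) (tab (y, X) p)) =
            (\<Prod>p\<in>cells - cell y ` {1..n}. if \<exists>u\<in>{1..n}. cell y u = p then 1 else (indicator (B p) (X p) :: ennreal))"
        proof (intro prod.cong refl)
          fix p assume p: "p \<in> cells - cell y ` {1..n}"
          then have n: "\<not> (\<exists>u\<in>{1..n}. cell y u = p)" and pc: "p \<in> cells" by blast+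
          show "indicator (B p) (tab (y, X) p) = (if \<exists>u\<in>{1..n}. cell y u = p then 1 else (indicator (B p) (X p) :: ennreal))"
            unfolding tab_def restrict_apply fst_conv snd_conv if_P[OF pc] if_not_P[OF n] ..
        qed
        also have "\<dots> = (\<Prod>p\<in>cells. if \<exists>u\<in>{1..n}. cell y u = p then 1 else (indicator (B p) (X p) :: ennreal))"
          using fc by (intro prod.mono_neutral_left) auto
        finally show ?thesis .
      qed
      have "(\<integral>\<^sup>+X. indicator (Pi\<^sub>E cells B) (tab (y, X)) \<partial>?Q) = (\<Prod>u\<in>{1..n}. o' y u) *
          (\<integral>\<^sup>+X. (\<Prod>p\<in>cells. if \<exists>u\<in>{1..n}. cell y u = p then 1 else (indicator (B p) (X p) :: ennreal)) \<partial>?Q)"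
        unfolding ind
      proof (intro nn_integral_cmult borel_measurable_prod_ennreal)
        fix p assume p: "p \<in> cells"
        have "(\<lambda>X. indicator (B p) (X p) :: ennreal) \<in> borel_measurable ?Q"
        proof -
          have "(\<lambda>X. X p) \<in> measurable ?Q (arm_law (fst p))" using p by (rule measurable_component_singleton)
          from measurable_compose[OF this borel_measurable_indicator[OF B[OF p]]] show ?thesis .
        qed
        then show "(\<lambda>X. if \<exists>u\<in>{1..n}. cell y u = p then 1 else (indicator (B p) (X p) :: ennreal)) \<in> borel_measurable ?Q"
          by simp
      qed
      also have "(\<integral>\<^sup>+X. (\<Prod>p\<in>cells. if \<exists>u\<in>{1..n}. cell y u = p then 1 else (indicator (B p) (X p) :: ennreal)) \<partial>?Q)
        = (\<Prod>p\<in>cells. \<integral>\<^sup>+z. (if \<exists>u\<in>{1..n}. cell y u = p then 1 else (indicator (B p) z :: ennreal)) \<partial>arm_law (fst p))"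
        by (rule PQ.product_nn_integral_prod[OF fc]) (use B in simp)
      also have "\<dots> = rest n y"
        unfolding rest_def using B prob_space.emeasure_space_1[OF prob_\<mu>] by (intro prod.cong refl) auto
      finally show "(\<integral>\<^sup>+X. indicator (Pi\<^sub>E cells B) (tab (y, X)) \<partial>?Q) = H n y" by (simp add: H_def)
    qed
    also have "\<dots> = (\<Prod>p\<in>cells. emeasure (arm_law (fst p)) (B p))" by (rule H0) simp
    finally show "emeasure (distr (?M \<Otimes>\<^sub>M ?Q) ?Q tab) (Pi\<^sub>E cells B) = (\<Prod>p\<in>cells. emeasure (arm_law (fst p)) (B p))" .
  qed simp
qed

text \<open>The subjects with treatment i up to time t fill exactly the first r cells of row i. So
  the empirical cdf of an adaptive sample is that of a fixed block of the table.\<close>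

lemma Fhat_eq_tab:
  assumes y: "y \<in> space (PiM {1..n} (\<lambda>_. P))" and t: "t \<le> n"
    and asg: "\<And>s. s \<in> {1..t} \<Longrightarrow> asg s = a s y" and r: "arm_count asg t i = r"
  shows "Fhat y asg t i x = (\<Sum>p\<in>{i} \<times> {1..r}. indicat_real {..x} (tab (y, X) p)) / r"
proof -
  let ?S = "{s \<in> {1..t}. asg s = i}"
  have cell: "cell y s = (i, arm_count asg s i)" if "s \<in> ?S" for s
  proof -
    have "{u \<in> {1..s}. a u y = a s y} = {u \<in> {1..s}. asg u = i}" using that asg by auto
    then show ?thesis using that asg[of s] by (auto simp: cell_def arm_count_def)
  qed
  have bij: "bij_betw (cell y) ?S ({i} \<times> {1..r})"
  proof (rule bij_betw_imageI)
    show inj: "inj_on (cell y) ?S" by (rule inj_on_subset[OF inj_cell]) (use t in auto)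
    have "cell y ` ?S \<subseteq> {i} \<times> {1..r}"
    proof
      fix p assume "p \<in> cell y ` ?S"
      then obtain s where s: "s \<in> ?S" "p = cell y s" by auto
      have "arm_count asg s i \<le> r" unfolding r[symmetric] arm_count_def using s by (intro card_mono) auto
      moreover have "0 < arm_count asg s i" unfolding arm_count_def using s by (auto simp: card_gt_0_iff)
      ultimately show "p \<in> {i} \<times> {1..r}" using s cell by auto
    qed
    moreover have "card (cell y ` ?S) = card ({i} \<times> {1..r})"
      using card_image[OF inj] r by (simp add: arm_count_def card_cartesian_product)
    ultimately show "cell y ` ?S = {i} \<times> {1..r}" by (intro card_subset_eq) auto
  qed
  have "(\<Sum>p\<in>{i} \<times> {1..r}. indicat_real {..x} (tab (y, X) p)) = (\<Sum>s\<in>?S. indicat_real {..x} (tab (y, X) (cell y s)))"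
    using sum.reindex_bij_betw[OF bij, of "\<lambda>p. indicat_real {..x} (tab (y, X) p)"] by simp
  also have "\<dots> = (\<Sum>s\<in>?S. if y s i \<le> x then 1 else 0)"
  proof (intro sum.cong refl)
    fix s assume s: "s \<in> ?S"
    then have "tab (y, X) (cell y s) = y s i" using tab_cell[of s y X] asg[of s] y t by auto
    then show "indicat_real {..x} (tab (y, X) (cell y s)) = (if y s i \<le> x then 1 else 0)" by (simp add: indicator_def)
  qed
  also have "\<dots> = card {s \<in> {1..t}. asg s = i \<and> y s i \<le> x}" by (simp add: sum.If_cases Int_def conj_assoc)
  finally show ?thesis using r by (simp add: Fhat_def arm_count_def)
qed

lemma Fhat_dev_le:
  assumes y: "y \<in> space (PiM {1..n} (\<lambda>_. P))" and t: "t \<le> n"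
    and asg: "\<And>s. s \<in> {1..t} \<Longrightarrow> asg s = a s y" and r: "arm_count asg t i = r" "0 < r"
  shows "\<bar>Fhat y asg t i x - measure (arm_law i) {..x}\<bar> \<le> arm_dev i r (tab (y, X))"
proof -
  have "\<bar>Fhat y asg t i x - measure (arm_law i) {..x}\<bar> =
    \<bar>(\<Sum>p\<in>{i} \<times> {1..r}. indicat_real {..x} (tab (y, X) p)) - card ({i} \<times> {1..r}) * measure (arm_law i) {..x}\<bar> / r"
  proof -
    have "S / r - m = (S - real r * m) / r" for S m :: real using r(2) by (simp add: field_simps)
    then have g: "\<bar>S / r - m\<bar> = \<bar>S - real r * m\<bar> / r" for S m :: real by simp
    have f: "Fhat y asg t i x = (\<Sum>p\<in>{i} \<times> {1..r}. indicat_real {..x} (tab (y, X) p)) / r"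
      by (rule Fhat_eq_tab[OF y t asg r(1)])
    have c: "card ({i} \<times> {1..r}) = r" by (simp add: card_cartesian_product)
    show ?thesis unfolding f g c ..
  qed
  also have "\<dots> \<le> arm_dev i r (tab (y, X))"
    unfolding arm_dev_def by (intro divide_right_mono edev_upper[OF prob_\<mu> sets_\<mu>]) simp
  finally show ?thesis .
qed

end


section \<open>The elimination policy\<close>

lemma lex_less_trans: "lex_less K \<delta> \<gamma> \<Longrightarrow> lex_less K \<gamma> \<zeta> \<Longrightarrow> lex_less K \<delta> \<zeta>"
proof -
  assume "lex_less K \<delta> \<gamma>" "lex_less K \<gamma> \<zeta>"
  then obtain k l where k: "k \<in> {1..K}" "\<forall>i\<in>{1..<k}. \<delta> i = \<gamma> i" "\<delta> k < \<gamma> k"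
    and l: "l \<in> {1..K}" "\<forall>i\<in>{1..<l}. \<gamma> i = \<zeta> i" "\<gamma> l < \<zeta> l"
    by (auto simp: lex_less_def)
  have "\<forall>i\<in>{1..<min k l}. \<delta> i = \<zeta> i" using k l by auto
  moreover have "\<delta> (min k l) < \<zeta> (min k l)"
    using k l by (cases k l rule: linorder_cases) (auto simp: min_def)
  moreover have "min k l \<in> {1..K}" using k l by auto
  ultimately show ?thesis unfolding lex_less_def by blast
qed

lemma lex_less_asym: "lex_less K \<delta> \<gamma> \<Longrightarrow> \<not> lex_less K \<gamma> \<delta>"
proof
  assume "lex_less K \<delta> \<gamma>" "lex_less K \<gamma> \<delta>"
  then obtain k l where k: "k \<in> {1..K}" "\<forall>i\<in>{1..<k}. \<delta> i = \<gamma> i" "\<delta> k < \<gamma> k"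
    and l: "l \<in> {1..K}" "\<forall>i\<in>{1..<l}. \<gamma> i = \<delta> i" "\<gamma> l < \<delta> l"
    by (auto simp: lex_less_def)
  then show False by (cases k l rule: linorder_cases) force+
qed

lemma lex_less_total:
  assumes "\<delta> \<in> unit_simplex K" "\<gamma> \<in> unit_simplex K" "\<delta> \<noteq> \<gamma>"
  shows "lex_less K \<delta> \<gamma> \<or> lex_less K \<gamma> \<delta>"
proof -
  define k where "k = (LEAST k. \<delta> k \<noteq> \<gamma> k)"
  have "\<exists>k. \<delta> k \<noteq> \<gamma> k" using assms(3) by auto
  then have k: "\<delta> k \<noteq> \<gamma> k" unfolding k_def by (rule LeastI_ex)
  have less: "\<delta> i = \<gamma> i" if "i < k" for i using not_less_Least that unfolding k_def by blast
  have "k \<in> {1..K}" using k assms(1,2) unfolding unit_simplex_def by force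
  moreover have "\<delta> k < \<gamma> k \<or> \<gamma> k < \<delta> k" using k by linarith
  moreover have "\<forall>i\<in>{1..<k}. \<delta> i = \<gamma> i" "\<forall>i\<in>{1..<k}. \<gamma> i = \<delta> i" using less by simp_all
  ultimately show ?thesis unfolding lex_less_def by blast
qed

lemma lexmin_in:
  assumes S: "finite S" "S \<noteq> {}" "S \<subseteq> unit_simplex K"
  shows "lexmin K S \<in> S"
proof -
  let ?min = "\<lambda>\<delta>. \<delta> \<in> S \<and> (\<forall>\<gamma>\<in>S. \<gamma> \<noteq> \<delta> \<longrightarrow> lex_less K \<delta> \<gamma>)"
  have "\<exists>\<delta>\<in>S. \<forall>\<gamma>\<in>S. \<gamma> \<noteq> \<delta> \<longrightarrow> lex_less K \<delta> \<gamma>"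
    using S
  proof (induction S rule: finite_ne_induct)
    case (insert x S)
    then obtain \<delta> where \<delta>: "\<delta> \<in> S" "\<forall>\<gamma>\<in>S. \<gamma> \<noteq> \<delta> \<longrightarrow> lex_less K \<delta> \<gamma>" by auto
    have "lex_less K x \<delta> \<or> lex_less K \<delta> x" using insert \<delta>(1) by (intro lex_less_total) auto
    then show ?case
    proof
      assume "lex_less K x \<delta>"
      then have "lex_less K x \<gamma>" if "\<gamma> \<in> S" for \<gamma>
        using that \<delta> lex_less_trans[of K x \<delta> \<gamma>] by (cases "\<gamma> = \<delta>") auto
      then show ?thesis by (intro bexI[of _ x]) auto
    next
      assume "lex_less K \<delta> x"
      then show ?thesis using \<delta> by (intro bexI[of _ \<delta>]) auto
    qed
  qed auto
  then obtain \<delta> where \<delta>: "?min \<delta>" by auto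
  have "\<exists>!\<delta>. ?min \<delta>"
  proof (rule ex1I[of _ \<delta>])
    show "?min \<delta>" by (rule \<delta>)
    fix \<gamma> assume \<gamma>: "?min \<gamma>"
    show "\<gamma> = \<delta>"
    proof (rule ccontr)
      assume ne: "\<gamma> \<noteq> \<delta>"
      then have "lex_less K \<delta> \<gamma>" "lex_less K \<gamma> \<delta>" using \<delta> \<gamma> by auto
      then show False using lex_less_asym by blast
    qed
  qed
  then have "?min (THE \<delta>. ?min \<delta>)" by (rule theI')
  then show ?thesis unfolding lexmin_def by (rule conjunct1)
qed

text \<open>Chains the rounds of the policy: the next step only has to be treated with the current
  state frozen at each of its finitely many values.\<close>

lemma simple_function_bind:
  assumes G: "simple_function M G" and H: "\<And>g. g \<in> G ` space M \<Longrightarrow> simple_function M (\<lambda>y. H g y)"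
  shows "simple_function M (\<lambda>y. H (G y) y)"
proof -
  have "(\<lambda>y. H (G y) y) ` space M \<subseteq> (\<Union>g\<in>G ` space M. H g ` space M)" by auto
  moreover have "finite \<dots>" by (rule finite_UN_I[OF simple_functionD(1)[OF G] simple_functionD(1)[OF H]])
  ultimately have fin: "finite ((\<lambda>y. H (G y) y) ` space M)" by (rule finite_subset)
  have "(\<lambda>y. H (G y) y) -` {v} \<inter> space M \<in> sets M" for v
  proof -
    have "(\<lambda>y. H (G y) y) -` {v} \<inter> space M = (\<Union>g\<in>G ` space M. (G -` {g} \<inter> space M) \<inter> (H g -` {v} \<inter> space M))"
      by auto
    also have "\<dots> \<in> sets M"
      by (rule sets.finite_UN[OF simple_functionD(1)[OF G] sets.Int[OF simple_functionD(2)[OF G] simple_functionD(2)[OF H]]])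
    finally show ?thesis .
  qed
  with fin show ?thesis unfolding simple_function_def by auto
qed

lemma simple_function_filter:
  assumes B: "finite B" and Q: "\<And>x. x \<in> B \<Longrightarrow> {y \<in> space M. Q x y} \<in> sets M"
  shows "simple_function M (\<lambda>y. {x \<in> B. Q x y})"
proof -
  have "(\<lambda>y. {x \<in> B. Q x y}) ` space M \<subseteq> Pow B" by auto
  then have fin: "finite ((\<lambda>y. {x \<in> B. Q x y}) ` space M)" using B finite_subset by blast
  have "(\<lambda>y. {x \<in> B. Q x y}) -` {V} \<inter> space M \<in> sets M" for V
  proof (cases "V \<subseteq> B")
    case True
    have "(\<lambda>y. {x \<in> B. Q x y}) -` {V} \<inter> space M = {y \<in> space M. \<forall>x\<in>B. (x \<in> V \<longleftrightarrow> Q x y)}"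
      using True by auto
    also have "\<dots> \<in> sets M"
    proof (intro sets.sets_Collect_finite_All B)
      fix x assume x: "x \<in> B"
      have "{y \<in> space M. \<not> Q x y} \<in> sets M" using Q[OF x] by (rule sets.sets_Collect_neg)
      then show "{y \<in> space M. (x \<in> V) = Q x y} \<in> sets M" using Q[OF x] by (cases "x \<in> V") auto
    qed
    finally show ?thesis .
  next
    case False
    then have "(\<lambda>y. {x \<in> B. Q x y}) -` {V} \<inter> space M = {}" by auto
    then show ?thesis by (simp only: sets.empty_sets)
  qed
  with fin show ?thesis unfolding simple_function_def by auto
qed

lemma assign_next_old: "s \<le> t \<Longrightarrow> assign_next I t k asg s = asg s"
  by (simp add: assign_next_def)

lemma assign_next_new:
  assumes "finite I" "k \<le> card I" "t < s" "s \<le> t + k"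
  shows "assign_next I t k asg s \<in> I"
proof -
  have "s - t - 1 < length (sorted_list_of_set I)" using assms by (simp add: length_sorted_list_of_set)
  then have "sorted_list_of_set I ! (s - t - 1) \<in> set (sorted_list_of_set I)" by (rule nth_mem)
  then show ?thesis using assms by (simp add: assign_next_def)
qed

text \<open>k0 is the position of i in the sorted list of I. With k = card I this is a full round;
  with smaller k it is the distribution of the leftover subjects.\<close>

lemma arm_count_assign_next:
  assumes I: "finite I" "i \<in> I" and k: "k \<le> card I"
  shows "\<exists>k0<card I. arm_count (assign_next I t k asg) (t + k) i = arm_count asg t i + (if k0 < k then 1 else 0)"
proof -
  let ?l = "sorted_list_of_set I"
  have l: "length ?l = card I" "distinct ?l" "set ?l = I" using I by auto
  obtain k0 where k0: "k0 < card I" "?l ! k0 = i" using l I(2) by (metis in_set_conv_nth)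
  have "{s \<in> {1..t + k}. assign_next I t k asg s = i} =
      {s \<in> {1..t}. asg s = i} \<union> (if k0 < k then {t + k0 + 1} else {})"
  proof (rule set_eqI)
    fix s
    show "s \<in> {s \<in> {1..t + k}. assign_next I t k asg s = i} \<longleftrightarrow>
      s \<in> {s \<in> {1..t}. asg s = i} \<union> (if k0 < k then {t + k0 + 1} else {})"
    proof (cases "s \<le> t")
      case False
      have "?l ! (s - t - 1) = i \<longleftrightarrow> s - t - 1 = k0" if "s \<le> t + k"
        using nth_eq_iff_index_eq[OF l(2), of "s - t - 1" k0] that False k k0 l(1) by auto
      then show ?thesis using False by (auto simp: assign_next_def)
    qed (auto simp: assign_next_def)
  qed
  then have "arm_count (assign_next I t k asg) (t + k) i = arm_count asg t i + (if k0 < k then 1 else 0)"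
    unfolding arm_count_def by (auto simp: card_insert_if)
  then show ?thesis using k0 by auto
qed

lemma Fhat_cong:
  assumes "\<And>s. s \<in> {1..t} \<Longrightarrow> y s = y' s"
  shows "Fhat y asg t = Fhat y' asg t"
  unfolding Fhat_def using assms by (intro ext arg_cong2[where f="(/)"] arg_cong[where f=real] arg_cong[where f=card]) auto

locale elimination_policy =
  fixes a b C \<eta> :: real
    and K m n :: nat
    and D :: "(real \<Rightarrow> real) set"
    and T :: "(real \<Rightarrow> real) \<Rightarrow> real"
    and A :: "nat \<Rightarrow> nat set"
    and MA MnA :: "nat \<Rightarrow> (nat \<Rightarrow> real) set"
    and R :: "nat set"
  assumes ab: "a < b"
    and K2: "2 \<le> K"
    and D_sub: "D \<subseteq> D_cdf a b" and D_convex: "convex_fun_set D"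
    and C_pos: "C > 0"
    and T_lip: "\<forall>F\<in>D. \<forall>G\<in>D_cdf a b. \<bar>T F - T G\<bar> \<le> C * sup_norm (\<lambda>x. F x - G x)"
    and T_meas: "\<forall>q::nat. \<forall>\<delta>\<in>unit_simplex q.
        (\<lambda>x. T (\<lambda>z. \<Sum>j\<in>{1..q}. \<delta> j * (if x j \<le> z then 1 else 0)))
          \<in> borel_measurable (PiM {1..q} (\<lambda>_. restrict_space borel {a..b}))"
    and m_bounds: "2 \<le> m" "m \<le> K"
    and A_ne: "\<forall>j\<in>{1..m}. A j \<noteq> {}"
    and A_disj: "\<forall>j\<in>{1..m}. \<forall>l\<in>{1..m}. j \<noteq> l \<longrightarrow> A j \<inter> A l = {}"
    and A_cover: "(\<Union>j\<in>{1..m}. A j) = {1..K}"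
    and MA_sub: "\<forall>j\<in>{1..m}. MA j \<subseteq> simplex_on (A j) K"
    and n_gt: "n > K"
    and MnA_fin: "\<forall>j\<in>{1..m}. finite (MnA j)"
    and MnA_ne: "\<forall>j\<in>{1..m}. MnA j \<noteq> {}"
    and MnA_sub: "\<forall>j\<in>{1..m}. MnA j \<subseteq> MA j"
    and R_sub: "R \<subseteq> {1..n div 2}" and R_ne: "R \<noteq> {}"
    and R_min: "Min R \<le> n div K"
    and eta_pos: "\<eta> > 0"
begin

abbreviation elim where "elim \<equiv> elim_step K T A R C \<eta> n"
abbreviation loop where "loop \<equiv> policy_loop K T A R C \<eta> n"

definition final_asg where
  "final_asg st = (case st of (t, r, I, J, Ms, asg) \<Rightarrow> assign_next I t (n - t) asg)"

definition final where
  "final y = loop y (Suc n) (0, 0, {1..K}, {1..m}, MnA, (\<lambda>_. 0))"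

text \<open>The assignment is read off from the final state. \<open>loop_keeps_asg\<close>
  identifies it with the one in use at any earlier moment, which is how adaptedness can hold for an
  object defined at the end.\<close>

definition asgn :: "nat \<Rightarrow> (nat \<Rightarrow> nat \<Rightarrow> real) \<Rightarrow> nat" where
  "asgn s y = final_asg (final y) s"

definition candidates where
  "candidates st y = (case st of (t, r, I, J, Ms, asg) \<Rightarrow>
     {\<delta> \<in> (\<Union>j\<in>J. Ms j). \<forall>\<gamma>\<in>(\<Union>j\<in>J. Ms j).
       T (mix K \<gamma> (Fhat y (final_asg st) n)) \<le> T (mix K \<delta> (Fhat y (final_asg st) n))})"

lemma recommend_eq: "recommend K T A R C \<eta> n m MnA y = lexmin K (candidates (final y) y)"
  by (simp add: recommend_def final_def candidates_def final_asg_def Let_def split: prod.splits)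

lemma finite_R: "finite R" using R_sub finite_subset by auto

lemma Min_R: "Min R \<in> R" using finite_R R_ne by (rule Min_in)

lemma R_ge_1: "r \<in> R \<Longrightarrow> 1 \<le> r" and R_le: "r \<in> R \<Longrightarrow> r \<le> n"
  using R_sub by (auto dest!: subsetD)

lemma A_sub: "j \<in> {1..m} \<Longrightarrow> A j \<subseteq> {1..K}" using A_cover by blast

lemma finite_A: "j \<in> {1..m} \<Longrightarrow> finite (A j)" using A_sub finite_subset by blast

lemma MnA_simplex: "j \<in> {1..m} \<Longrightarrow> \<delta> \<in> MnA j \<Longrightarrow> \<delta> \<in> simplex_on (A j) K"
  using MnA_sub MA_sub by blast

lemma MnA_unit: "j \<in> {1..m} \<Longrightarrow> \<delta> \<in> MnA j \<Longrightarrow> \<delta> \<in> unit_simplex K"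
  using MnA_simplex by (auto simp: simplex_on_def)

section \<open>Invariants of the elimination loop\<close>

text \<open>The last clause is the source of the upper bound on sample sizes: rounds up to
  \<open>Min R\<close> use all K arms, later ones at least two as long as two are in play. The
  active set only shrinks, so two arms now mean two arms in all earlier rounds.\<close>

fun invar where
  "invar (t, r, I, J, Ms, asg) \<longleftrightarrow> t \<le> n \<and> J \<subseteq> {1..m} \<and> J \<noteq> {} \<and> I = (\<Union>j\<in>J. A j) \<and>
     (\<forall>j\<in>J. Ms j \<noteq> {} \<and> Ms j \<subseteq> MnA j) \<and> (\<forall>s\<in>{1..t}. asg s \<in> {1..K}) \<and>
     (\<forall>i\<in>I. arm_count asg t i = r) \<and> t \<le> K * r \<and> (r < Min R \<longrightarrow> J = {1..m}) \<and>
     (2 \<le> card I \<longrightarrow> (if r \<le> Min R then t = K * r else K * Min R + 2 * (r - Min R) \<le> t))"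

text \<open>Compares a state inside a round with the groups J0 and sets Ms at its start. J stays
  nonempty because an elimination requires two groups.\<close>

fun fold_inv where
  "fold_inv J0 Ms (I, J, Mc) \<longleftrightarrow> J \<subseteq> J0 \<and> J \<noteq> {} \<and> I = (\<Union>j\<in>J. A j) \<and>
     (\<forall>l\<in>J. Mc l \<noteq> {} \<and> Mc l \<subseteq> Ms l)"

lemma elim_inv:
  assumes J0: "J0 \<subseteq> {1..m}" "j \<in> J0" and st: "fold_inv J0 Ms st"
  shows "fold_inv J0 Ms (elim y asg t r Ms j st)"
proof -
  obtain I J Mc where s: "st = (I, J, Mc)" by (cases st)
  have fi: "J \<subseteq> J0" "J \<noteq> {}" "I = (\<Union>j\<in>J. A j)" "\<forall>l\<in>J. Mc l \<noteq> {} \<and> Mc l \<subseteq> Ms l"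
    using st by (auto simp: s)
  have ne: "J - {j} \<noteq> {}" if "2 \<le> card J"
  proof
    assume "J - {j} = {}"
    then have "J \<subseteq> {j}" by auto
    then have "card J \<le> 1" using card_mono[of "{j}" J] by simp
    with that show False by simp
  qed
  have diff: "(\<Union>j\<in>J. A j) - A j = (\<Union>l\<in>J - {j}. A l)"
  proof -
    have "A l \<inter> A j = {}" if "l \<in> J" "l \<noteq> j" for l using that J0 fi(1) A_disj by blast
    then show ?thesis by blast
  qed
  show ?thesis
    unfolding s elim_step_def Let_def
    using fi ne diff by (auto simp: Let_def)
qed

lemma fold_elim_inv:
  assumes "J0 \<subseteq> {1..m}" "set js \<subseteq> J0" "fold_inv J0 Ms st"
  shows "fold_inv J0 Ms (fold (elim y asg t r Ms) js st)"
  using assms(2,3)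
proof (induction js arbitrary: st)
  case (Cons j js)
  then show ?case using elim_inv[OF assms(1), of j Ms st] by simp
qed simp

lemma fold_no_elim:
  assumes "r \<notin> R"
  shows "fold (elim y asg t r Ms) js st = st"
  using assms by (induction js arbitrary: st) (auto simp: elim_step_def split: prod.splits)

text \<open>If \<gamma> is dropped, the maximum over the other groups is attained at some \<delta>
  that beats \<gamma> by more than the threshold. Comparisons within a round use the sets Ms from
  its start, hence the separate assumption that \<gamma> lies in Ms j0.\<close>

lemma fold_keeps_or_bad:
  assumes J0: "J0 \<subseteq> {1..m}" "set js \<subseteq> J0" and st: "fold_inv J0 Ms (I, J, Mc)"
    and Ms: "\<And>l. l \<in> J0 \<Longrightarrow> finite (Ms l) \<and> Ms l \<noteq> {}"
    and good: "j0 \<in> J" "\<gamma> \<in> Mc j0" "\<gamma> \<in> Ms j0"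
    and res: "fold (elim y asg t r Ms) js (I, J, Mc) = (I', J', Mc')"
  shows "(j0 \<in> J' \<and> \<gamma> \<in> Mc' j0) \<or> (r \<in> R \<and> (\<exists>l\<in>J0 - {j0}. \<exists>\<delta>\<in>Ms l.
    u_eta C \<eta> K r n < T (mix K \<delta> (Fhat y asg t)) - T (mix K \<gamma> (Fhat y asg t))))"
  using J0(2) st good(1,2) res
proof (induction js arbitrary: I J Mc)
  case (Cons j js)
  let ?Fh = "Fhat y asg t"
  let ?bad = "r \<in> R \<and> (\<exists>l\<in>J0 - {j0}. \<exists>\<delta>\<in>Ms l. u_eta C \<eta> K r n < T (mix K \<delta> ?Fh) - T (mix K \<gamma> ?Fh))"
  obtain I1 J1 Mc1 where s1: "elim y asg t r Ms j (I, J, Mc) = (I1, J1, Mc1)" by (metis prod_cases3)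
  have inv1: "fold_inv J0 Ms (I1, J1, Mc1)"
    using elim_inv[OF J0(1) _ Cons.prems(2), of j y asg t r] Cons.prems(1) s1 by simp
  have "(j0 \<in> J1 \<and> \<gamma> \<in> Mc1 j0) \<or> ?bad"
  proof (cases "r \<in> R \<and> 2 \<le> card J \<and> j = j0")
    case False
    then show ?thesis using s1 Cons.prems by (auto simp: elim_step_def Let_def split: if_splits)
  next
    case True
    let ?X = "{T (mix K \<delta> ?Fh) | \<delta> l. l \<in> J - {j0} \<and> \<delta> \<in> Ms l}"
    have X: "?X = (\<lambda>\<delta>. T (mix K \<delta> ?Fh)) ` (\<Union>l\<in>J - {j0}. Ms l)" by auto
    have JJ: "J \<subseteq> J0" using Cons.prems(2) by simp
    then have "J \<subseteq> {1..m}" using J0(1) by (rule subset_trans)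
    then have fJ: "finite J" by (rule finite_subset) simp
    have "finite ?X" unfolding X using JJ fJ Ms by (intro finite_imageI finite_UN_I) auto
    moreover have "?X \<noteq> {}"
    proof -
      have "\<not> J \<subseteq> {j0}" using True card_mono[of "{j0}" J] by auto
      then obtain l where "l \<in> J - {j0}" by auto
      then show ?thesis using JJ Ms[of l] by auto
    qed
    ultimately have "Max ?X \<in> ?X" by (rule Max_in)
    then obtain l \<delta> where l: "Max ?X = T (mix K \<delta> ?Fh)" "l \<in> J - {j0}" "\<delta> \<in> Ms l" by auto
    show ?thesis
    proof (cases "Max ?X - T (mix K \<gamma> ?Fh) \<le> u_eta C \<eta> K r n")
      case ok: True
      then have "\<gamma> \<in> {\<gamma> \<in> Ms j0. Max ?X - T (mix K \<gamma> ?Fh) \<le> u_eta C \<eta> K r n}" using good(3) by simp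
      then have "j0 \<in> J1 \<and> \<gamma> \<in> Mc1 j0"
        using s1 True Cons.prems(3) by (auto simp: elim_step_def Let_def split: if_splits)
      then show ?thesis ..
    next
      case no: False
      then have ?bad using True l JJ by (auto simp: not_le)
      then show ?thesis ..
    qed
  qed
  then show ?case
  proof
    assume "j0 \<in> J1 \<and> \<gamma> \<in> Mc1 j0"
    then show ?thesis using Cons.IH[OF _ inv1] Cons.prems s1 by auto
  qed blast
qed simp

lemma invarD:
  assumes st: "invar (t, r, I, J, Ms, asg)"
  shows "t \<le> n" "J \<subseteq> {1..m}" "J \<noteq> {}" "finite J" "I = (\<Union>j\<in>J. A j)"
    and "\<And>j. j \<in> J \<Longrightarrow> Ms j \<noteq> {}" "\<And>j. j \<in> J \<Longrightarrow> Ms j \<subseteq> MnA j" "\<And>j. j \<in> J \<Longrightarrow> finite (Ms j)"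
    and "\<And>s. s \<in> {1..t} \<Longrightarrow> asg s \<in> {1..K}" "\<And>i. i \<in> I \<Longrightarrow> arm_count asg t i = r" "t \<le> K * r"
    and "finite I" "I \<subseteq> {1..K}" "I \<noteq> {}"
proof -
  show J: "J \<subseteq> {1..m}" "J \<noteq> {}" and I: "I = (\<Union>j\<in>J. A j)" and "t \<le> n" "t \<le> K * r"
    using st by simp_all
  show fJ: "finite J" using J(1) by (rule finite_subset) simp
  show M: "\<And>j. j \<in> J \<Longrightarrow> Ms j \<noteq> {}" "\<And>j. j \<in> J \<Longrightarrow> Ms j \<subseteq> MnA j" using st by simp_all
  show "finite (Ms j)" if "j \<in> J" for j
    using finite_subset[OF M(2)[OF that]] MnA_fin J(1) that by blast
  show "\<And>s. s \<in> {1..t} \<Longrightarrow> asg s \<in> {1..K}" "\<And>i. i \<in> I \<Longrightarrow> arm_count asg t i = r" using st by simp_all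
  show IK: "I \<subseteq> {1..K}" unfolding I using A_sub J(1) by blast
  then show "finite I" by (rule finite_subset) simp
  show "I \<noteq> {}" unfolding I using J A_ne by blast
qed

lemma loop_step_invar:
  assumes st: "invar (t, r, I, J, Ms, asg)" and go: "card I \<le> n - t"
    and asg': "asg' = assign_next I t (card I) asg"
    and res: "fold (elim y asg' (t + card I) (r + 1) Ms) (sorted_list_of_set J) (I, J, Ms) = (I', J', Ms')"
  shows "invar (t + card I, r + 1, I', J', Ms', asg')"
    and "\<And>i. i \<in> I \<Longrightarrow> arm_count asg' (t + card I) i = r + 1" and "0 < card I" and "finite J"
    and "fold_inv J Ms (I, J, Ms)" and "fold_inv J Ms (I', J', Ms')"
proof -
  note J = invarD(2-4)[OF st] and I = invarD(5,12,14,13)[OF st]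
  show fJ: "finite J" by fact
  show cI: "0 < card I" using I by (simp add: card_gt_0_iff)
  have cIK: "card I \<le> K" using card_mono[OF _ I(4)] by simp
  show cnt: "arm_count asg' (t + card I) i = r + 1" if i: "i \<in> I" for i
    using arm_count_assign_next[OF I(2) i order_refl, of t asg] st i unfolding asg' by auto
  show fi0: "fold_inv J Ms (I, J, Ms)" using st by auto
  show fi: "fold_inv J Ms (I', J', Ms')"
    using fold_elim_inv[OF J(1) _ fi0, of "sorted_list_of_set J" y asg' "t + card I" "r + 1"] J res by simp
  have I'I: "I' \<subseteq> I" "J' \<subseteq> J" using fi I by auto
  have cI': "card I' \<le> card I" using I'I I by (intro card_mono) auto
  have e1: "t + card I \<le> n" using go st by auto
  have e2: "\<forall>s\<in>{1..t + card I}. asg' s \<in> {1..K}"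
  proof
    fix s assume s: "s \<in> {1..t + card I}"
    show "asg' s \<in> {1..K}"
    proof (cases "s \<le> t")
      case True
      then show ?thesis using st s by (auto simp: asg' assign_next_old)
    next
      case False
      then show ?thesis using assign_next_new[OF I(2) order_refl, of t s asg] s I(4) by (auto simp: asg')
    qed
  qed
  have e3: "t + card I \<le> K * (r + 1)" using st cIK by (simp add: algebra_simps)
  have e4: "J' = {1..m}" if "r + 1 < Min R"
  proof -
    have "r + 1 \<notin> R" using that Min_le[OF finite_R, of "r + 1"] by linarith
    then have "J' = J" using fold_no_elim[of "r + 1"] res by auto
    then show ?thesis using st that by auto
  qed
  have e5: "if r + 1 \<le> Min R then t + card I = K * (r + 1) else K * Min R + 2 * (r + 1 - Min R) \<le> t + card I"
    if c2: "2 \<le> card I'"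
  proof -
    have c2I: "2 \<le> card I" using c2 cI' by simp
    have full: "card I = K" if "r < Min R"
    proof -
      have "I = {1..K}" using st that A_cover by auto
      then show ?thesis by simp
    qed
    have t: "if r \<le> Min R then t = K * r else K * Min R + 2 * (r - Min R) \<le> t"
      using st c2I by simp
    show ?thesis
    proof (cases "r < Min R")
      case True
      then show ?thesis using t full by (auto simp: algebra_simps)
    next
      case False
      then have "K * Min R + 2 * (r - Min R) \<le> t" using t by (auto split: if_splits)
      then show ?thesis using False c2I by auto
    qed
  qed
  show "invar (t + card I, r + 1, I', J', Ms', asg')"
  proof -
    have "J' \<subseteq> {1..m}" "J' \<noteq> {}" "I' = (\<Union>j\<in>J'. A j)" "\<forall>j\<in>J'. Ms' j \<noteq> {} \<and> Ms' j \<subseteq> Ms j"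
      using fi J by auto
    moreover have "\<forall>j\<in>J'. Ms j \<subseteq> MnA j" using st I'I(2) by auto
    moreover have "\<forall>i\<in>I'. arm_count asg' (t + card I) i = r + 1" using cnt I'I by blast
    ultimately show ?thesis using e1 e2 e3 e4 e5 by (simp only: invar.simps) blast
  qed
qed

lemma loop_keeps_asg: "s \<le> fst st \<Longrightarrow> final_asg (loop y k st) s = (snd (snd (snd (snd (snd st))))) s"
proof (induction k arbitrary: st)
  case 0
  obtain t r I J Ms asg where st: "st = (t, r, I, J, Ms, asg)" by (metis prod_cases6)
  then show ?case using 0 by (simp add: final_asg_def assign_next_old)
next
  case (Suc k)
  obtain t r I J Ms asg where st: "st = (t, r, I, J, Ms, asg)" by (metis prod_cases6)
  show ?case
  proof (cases "card I \<le> n - t")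
    case True
    obtain I' J' Ms' where f: "fold (elim y (assign_next I t (card I) asg) (t + card I) (r + 1) Ms) (sorted_list_of_set J) (I, J, Ms) = (I', J', Ms')"
      by (metis prod_cases3)
    have "loop y (Suc k) st = loop y k (t + card I, r + 1, I', J', Ms', assign_next I t (card I) asg)"
      using True f by (simp add: st Let_def)
    then show ?thesis using Suc.IH[of "(t + card I, r + 1, I', J', Ms', assign_next I t (card I) asg)"] Suc.prems
      by (simp add: st assign_next_old)
  next
    case False
    then show ?thesis using Suc.prems by (simp add: st final_asg_def assign_next_old)
  qed
qed

text \<open>Outcomes enter the state only for subjects already assigned. If s belongs to the current
  batch, its treatment is fixed before the eliminations of that round; otherwise the round uses only
  outcomes before s and leads to the same state on both paths.\<close>

lemma loop_adapted:
  assumes y: "\<And>u. u \<in> {1..<s} \<Longrightarrow> y u = y' u"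
  shows "final_asg (loop y k st) s = final_asg (loop y' k st) s"
proof (induction k arbitrary: st)
  case (Suc k)
  obtain t r I J Ms asg where st: "st = (t, r, I, J, Ms, asg)" by (metis prod_cases6)
  show ?case
  proof (cases "card I \<le> n - t")
    case True
    define asg' where "asg' = assign_next I t (card I) asg"
    obtain I' J' Ms' where f: "fold (elim y asg' (t + card I) (r + 1) Ms) (sorted_list_of_set J) (I, J, Ms) = (I', J', Ms')"
      by (metis prod_cases3)
    obtain I2 J2 Ms2 where f2: "fold (elim y' asg' (t + card I) (r + 1) Ms) (sorted_list_of_set J) (I, J, Ms) = (I2, J2, Ms2)"
      by (metis prod_cases3)
    have l: "loop y (Suc k) st = loop y k (t + card I, r + 1, I', J', Ms', asg')"
      using True f by (simp add: st Let_def asg'_def)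
    have l2: "loop y' (Suc k) st = loop y' k (t + card I, r + 1, I2, J2, Ms2, asg')"
      using True f2 by (simp add: st Let_def asg'_def)
    show ?thesis
    proof (cases "s \<le> t + card I")
      case True
      then show ?thesis unfolding l l2 by (simp add: loop_keeps_asg)
    next
      case False
      then have F: "Fhat y asg' (t + card I) = Fhat y' asg' (t + card I)" using y by (intro Fhat_cong) auto
      have "elim y asg' (t + card I) (r + 1) Ms = elim y' asg' (t + card I) (r + 1) Ms"
        by (intro ext) (simp only: elim_step_def F)
      then have "(I2, J2, Ms2) = (I', J', Ms')" using f f2 by simp
      then show ?thesis unfolding l l2 using Suc.IH by simp
    qed
  next
    case False
    then show ?thesis by (simp add: st)
  qed
qed simp

lemma asgn_adapted: "(\<And>u. u \<in> {1..<s} \<Longrightarrow> y u = y' u) \<Longrightarrow> asgn s y = asgn s y'"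
  unfolding asgn_def final_def by (rule loop_adapted)

lemma invar_init: "invar (0, 0, {1..K}, {1..m}, MnA, (\<lambda>_. 0))"
  using m_bounds A_cover MnA_ne Min_R R_ge_1 by (auto simp: arm_count_def)

text \<open>Each round assigns at least one subject, so t + k stays above n. Exhausted fuel would
  mean t > n, against the invariant; hence the loop ends by its own condition.\<close>

lemma loop_invar:
  assumes "invar st" "n < fst st + k" "loop y k st = (t, r, I, J, Ms, asg)"
  shows "invar (t, r, I, J, Ms, asg) \<and> n - t < card I"
  using assms
proof (induction k arbitrary: st)
  case 0
  then show ?case by (cases st) auto
next
  case (Suc k)
  obtain t0 r0 I0 J0 Ms0 asg0 where st: "st = (t0, r0, I0, J0, Ms0, asg0)" by (metis prod_cases6)
  show ?case
  proof (cases "card I0 \<le> n - t0")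
    case True
    define asg' where "asg' = assign_next I0 t0 (card I0) asg0"
    obtain I' J' Ms' where f: "fold (elim y asg' (t0 + card I0) (r0 + 1) Ms0) (sorted_list_of_set J0) (I0, J0, Ms0) = (I', J', Ms')"
      by (metis prod_cases3)
    note step = loop_step_invar[OF Suc.prems(1)[unfolded st] True asg'_def f]
    have l: "loop y (Suc k) st = loop y k (t0 + card I0, r0 + 1, I', J', Ms', asg')"
      using True f by (simp add: st Let_def asg'_def)
    show ?thesis using Suc.IH[OF step(1)] Suc.prems(2,3) step(3) unfolding l by (auto simp: st)
  next
    case False
    then have "(t, r, I, J, Ms, asg) = st" using Suc.prems(3) by (simp add: st)
    then show ?thesis using Suc.prems(1) False st by auto
  qed
qed

text \<open>All arms of the two compared groups have exactly r observations at that moment, so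
  deviations at a fixed size apply although r is random. The running assignment \<open>asg\<close>
  is pinned on the first t subjects, which determine the empirical cdfs at time t.\<close>

definition bad_round where
  "bad_round j0 \<gamma> y \<longleftrightarrow> (\<exists>t r asg l \<delta>. t \<le> n \<and> r \<in> R \<and> (\<forall>s\<in>{1..t}. asg s = asgn s y \<and> asg s \<in> {1..K}) \<and>
     l \<in> {1..m} - {j0} \<and> \<delta> \<in> MnA l \<and> (\<forall>i\<in>A j0 \<union> A l. arm_count asg t i = r) \<and>
     u_eta C \<eta> K r n < T (mix K \<delta> (Fhat y asg t)) - T (mix K \<gamma> (Fhat y asg t)))"

lemma loop_good_or_bad:
  assumes "invar st" "loop y k st = (t, r, I, J, Ms, asg)"
    and "\<And>s. s \<in> {1..n} \<Longrightarrow> final_asg (loop y k st) s = asgn s y"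
    and "j0 \<in> fst (snd (snd (snd st)))" "\<gamma> \<in> fst (snd (snd (snd (snd st)))) j0"
  shows "(j0 \<in> J \<and> \<gamma> \<in> Ms j0) \<or> bad_round j0 \<gamma> y"
  using assms
proof (induction k arbitrary: st)
  case 0
  then show ?case by (cases st) auto
next
  case (Suc k)
  obtain t0 r0 I0 J0 Ms0 asg0 where st: "st = (t0, r0, I0, J0, Ms0, asg0)" by (metis prod_cases6)
  show ?case
  proof (cases "card I0 \<le> n - t0")
    case True
    define asg' where "asg' = assign_next I0 t0 (card I0) asg0"
    obtain I' J' Ms' where f: "fold (elim y asg' (t0 + card I0) (r0 + 1) Ms0) (sorted_list_of_set J0) (I0, J0, Ms0) = (I', J', Ms')"
      by (metis prod_cases3)
    note inv0 = Suc.prems(1)[unfolded st]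
    note step = loop_step_invar[OF inv0 True asg'_def f]
    have l: "loop y (Suc k) st = loop y k (t0 + card I0, r0 + 1, I', J', Ms', asg')"
      using True f by (simp add: st Let_def asg'_def)
    note J0 = invarD(2,7)[OF inv0] conjI[OF invarD(8,6)[OF inv0]]
    have j0: "j0 \<in> J0" "\<gamma> \<in> Ms0 j0" using Suc.prems(4,5) by (auto simp: st)
    have "(j0 \<in> J' \<and> \<gamma> \<in> Ms' j0) \<or> (r0 + 1 \<in> R \<and> (\<exists>l\<in>J0 - {j0}. \<exists>\<delta>\<in>Ms0 l.
      u_eta C \<eta> K (r0 + 1) n < T (mix K \<delta> (Fhat y asg' (t0 + card I0))) - T (mix K \<gamma> (Fhat y asg' (t0 + card I0)))))"
    proof (rule fold_keeps_or_bad[OF J0(1) _ step(5) J0(3) j0 j0(2) f])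
      show "set (sorted_list_of_set J0) \<subseteq> J0" using step(4) by simp
    qed
    then show ?thesis
    proof
      assume "j0 \<in> J' \<and> \<gamma> \<in> Ms' j0"
      then show ?thesis
        using Suc.IH[OF step(1)] Suc.prems(2,3) unfolding l by auto
    next
      assume "r0 + 1 \<in> R \<and> (\<exists>l\<in>J0 - {j0}. \<exists>\<delta>\<in>Ms0 l.
        u_eta C \<eta> K (r0 + 1) n < T (mix K \<delta> (Fhat y asg' (t0 + card I0))) - T (mix K \<gamma> (Fhat y asg' (t0 + card I0))))"
      then obtain l' \<delta> where r: "r0 + 1 \<in> R" and l': "l' \<in> J0 - {j0}" "\<delta> \<in> Ms0 l'"
        "u_eta C \<eta> K (r0 + 1) n < T (mix K \<delta> (Fhat y asg' (t0 + card I0))) - T (mix K \<gamma> (Fhat y asg' (t0 + card I0)))"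
        by auto
      have "t0 + card I0 \<le> n" "\<forall>s\<in>{1..t0 + card I0}. asg' s \<in> {1..K}" using step(1) by auto
      moreover have "asg' s = asgn s y" if "s \<in> {1..t0 + card I0}" for s
      proof -
        have "asg' s = final_asg (loop y (Suc k) st) s" unfolding l using that by (subst loop_keeps_asg) auto
        also have "\<dots> = asgn s y" using that \<open>t0 + card I0 \<le> n\<close> by (intro Suc.prems(3)) auto
        finally show ?thesis .
      qed
      moreover have "\<forall>i\<in>A j0 \<union> A l'. arm_count asg' (t0 + card I0) i = r0 + 1"
      proof -
        have "A j0 \<subseteq> I0" "A l' \<subseteq> I0" using inv0 j0 l' by auto
        then show ?thesis using step(2) by blast
      qed
      moreover have "l' \<in> {1..m} - {j0}" "\<delta> \<in> MnA l'" using l' J0 by auto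
      ultimately have "bad_round j0 \<gamma> y" unfolding bad_round_def using r l'(3) by blast
      then show ?thesis ..
    qed
  next
    case False
    then have "(t, r, I, J, Ms, asg) = st" using Suc.prems(2) by (simp add: st)
    then show ?thesis using Suc.prems(4,5) by auto
  qed
qed

lemma final_state:
  assumes "final y = (t, r, I, J, Ms, asg)"
  shows "invar (t, r, I, J, Ms, asg)" "n - t < card I"
    and "\<And>s. s \<le> t \<Longrightarrow> asgn s y = asg s"
    and "\<And>s. s \<in> {1..n} \<Longrightarrow> asgn s y \<in> {1..K}"
    and "\<And>i. i \<in> I \<Longrightarrow> arm_count (\<lambda>s. asgn s y) n i \<in> {n div K..}"
    and "\<And>i. i \<in> I \<Longrightarrow> 2 \<le> card I \<Longrightarrow> arm_count (\<lambda>s. asgn s y) n i \<le> Min R + (n - Min R * K + 1) div 2"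
    and "j0 \<in> {1..m} \<Longrightarrow> \<gamma> \<in> MnA j0 \<Longrightarrow> (j0 \<in> J \<and> \<gamma> \<in> Ms j0) \<or> bad_round j0 \<gamma> y"
proof -
  have fin: "loop y (Suc n) (0, 0, {1..K}, {1..m}, MnA, (\<lambda>_. 0)) = (t, r, I, J, Ms, asg)"
    using assms by (simp only: final_def)
  have li: "invar (t, r, I, J, Ms, asg) \<and> n - t < card I"
    by (rule loop_invar[OF invar_init _ fin]) simp
  then show inv: "invar (t, r, I, J, Ms, asg)" and lt: "n - t < card I" by auto
  have as: "asgn s y = assign_next I t (n - t) asg s" for s
    by (simp add: asgn_def assms final_asg_def)
  show old: "asgn s y = asg s" if "s \<le> t" for s using that by (simp add: as assign_next_old)
  note J = invarD(2-4)[OF inv] and I = invarD(5,12,13)[OF inv]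
  show "asgn s y \<in> {1..K}" if s: "s \<in> {1..n}" for s
  proof (cases "s \<le> t")
    case True
    then show ?thesis using inv s old by auto
  next
    case False
    then have "assign_next I t (n - t) asg s \<in> I" using s lt I by (intro assign_next_new) auto
    then show ?thesis using I by (auto simp: as)
  qed
  have cIK: "card I \<le> K" using card_mono[OF _ I(3)] by simp
  have tn: "t \<le> n" "t \<le> K * r" using inv by auto
  \<comment> \<open>The loop stops with fewer than card I \<le> K subjects left, while t \<le> K
    r.\<close>
  have nr: "n div K \<le> r"
  proof -
    have "n < K * (r + 1)" using lt cIK tn by (simp add: algebra_simps)
    then have "n div K < r + 1" using K2 by (intro less_mult_imp_div_less) (simp add: mult.commute)
    then show ?thesis by simp
  qed
  \<comment> \<open>The count r + 1 arises from leftover subjects and so needs t < n. Then 2 (r + 1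
    - Min R) \<le> n + 1 - K Min R, which is the origin of the rounding up in the upper
    bound.\<close>
  have cnt: "arm_count (\<lambda>s. asgn s y) n i \<in> {r, r + 1} \<and> (arm_count (\<lambda>s. asgn s y) n i = r + 1 \<longrightarrow> t < n)" if i: "i \<in> I" for i
  proof -
    obtain k0 where "arm_count (assign_next I t (n - t) asg) (t + (n - t)) i = arm_count asg t i + (if k0 < n - t then 1 else 0)"
      using arm_count_assign_next[OF I(2) i, of "n - t" t asg] lt by auto
    then have "arm_count (\<lambda>s. asgn s y) n i = r + (if k0 < n - t then 1 else 0)"
      using inv i tn by (simp add: as[abs_def])
    then show ?thesis by auto
  qed
  show "arm_count (\<lambda>s. asgn s y) n i \<in> {n div K..}" if "i \<in> I" for i
    using cnt[OF that] nr by auto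
  show "arm_count (\<lambda>s. asgn s y) n i \<le> Min R + (n - Min R * K + 1) div 2" if i: "i \<in> I" and c: "2 \<le> card I" for i
  proof -
    have "Min R \<le> r" using R_min nr by simp
    then have "Min R * K + 2 * (r - Min R) \<le> t" using inv c by (auto split: if_splits simp: mult.commute)
    then show ?thesis using cnt[OF i] tn \<open>Min R \<le> r\<close> by (auto simp: mult.commute)
  qed
  show "(j0 \<in> J \<and> \<gamma> \<in> Ms j0) \<or> bad_round j0 \<gamma> y" if "j0 \<in> {1..m}" "\<gamma> \<in> MnA j0"
    by (rule loop_good_or_bad[OF invar_init fin]) (use that in \<open>auto simp: asgn_def final_def\<close>)
qed

end


section \<open>Regret along a path and in expectation\<close>

lemma (in prob_space) expectation_affine:
  fixes s t :: "'a \<Rightarrow> real"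
  assumes "integrable M s" "integrable M t"
  shows "expectation (\<lambda>x. d + c * (2 * s x + t x)) = d + c * (2 * expectation s + expectation t)"
  using assms by (simp add: prob_space)

locale elimination_experiment = elimination_policy +
  fixes P :: "(nat \<Rightarrow> real) measure" and F :: "nat \<Rightarrow> real \<Rightarrow> real"
  assumes prob_P: "prob_space P"
    and sets_P: "sets P = sets (PiM {1..K} (\<lambda>_. restrict_space borel {a..b}))"
    and F_D: "i \<in> {1..K} \<Longrightarrow> F i \<in> D"
    and F_law: "i \<in> {1..K} \<Longrightarrow> measure P {v \<in> space P. v i \<le> x} = F i x"
begin

section \<open>Measurability of the recommendation\<close>

abbreviation outcomes where "outcomes \<equiv> PiM {1..n} (\<lambda>_. P)"

lemma comp_restrict: "i \<in> {1..K} \<Longrightarrow> (\<lambda>v. v i) \<in> measurable P (restrict_space borel {a..b})"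
  using measurable_cong_sets[OF sets_P refl] measurable_component_singleton[of i "{1..K}" "\<lambda>_. restrict_space borel {a..b}"]
  by blast

lemma comp_borel: "i \<in> {1..K} \<Longrightarrow> (\<lambda>v. v i) \<in> borel_measurable P"
  using comp_restrict by (simp add: measurable_restrict_space2_iff)

lemma outcome_range:
  assumes "y \<in> space outcomes" "s \<in> {1..n}" "i \<in> {1..K}"
  shows "y s i \<in> {a..b}"
proof -
  have "y s \<in> space P" using assms by (auto simp: space_PiM)
  then show ?thesis using measurable_space[OF comp_restrict[OF assms(3)]] by (auto simp: space_restrict_space)
qed

text \<open>Under this condition mixtures over B of the empirical cdfs at time t are again
  cdfs.\<close>

definition valid where
  "valid B t asg \<longleftrightarrow> t \<le> n \<and> (\<forall>s\<in>{1..t}. asg s \<in> {1..K}) \<and> (\<forall>i\<in>B. 0 < arm_count asg t i)"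

lemma valid_weight:
  assumes "valid B t asg" "\<delta> \<in> simplex_on B K"
  shows "emp_weight \<delta> asg t \<in> unit_simplex t"
  using assms by (intro emp_weight_simplex[where K = K]) (auto simp: valid_def simplex_on_def)

lemma T_mix_measurable:
  assumes v: "valid B t asg" and \<delta>: "\<delta> \<in> simplex_on B K"
  shows "(\<lambda>y. T (mix K \<delta> (Fhat y asg t))) \<in> borel_measurable outcomes"
proof -
  have t: "t \<le> n" and asg: "\<And>s. s \<in> {1..t} \<Longrightarrow> asg s \<in> {1..K}" using v by (auto simp: valid_def)
  let ?w = "emp_weight \<delta> asg t"
  have "(\<lambda>y. \<lambda>s\<in>{1..t}. y s (asg s)) \<in> measurable outcomes (PiM {1..t} (\<lambda>_. restrict_space borel {a..b}))"
  proof (rule measurable_restrict)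
    fix s assume s: "s \<in> {1..t}"
    then have "s \<in> {1..n}" using t by auto
    then have "(\<lambda>y. y s) \<in> measurable outcomes P" by (rule measurable_component_singleton)
    from measurable_compose[OF this comp_restrict[OF asg[OF s]]]
    show "(\<lambda>y. y s (asg s)) \<in> measurable outcomes (restrict_space borel {a..b})" .
  qed
  moreover have "(\<lambda>x. T (\<lambda>z. \<Sum>j\<in>{1..t}. ?w j * (if x j \<le> z then 1 else 0)))
      \<in> borel_measurable (PiM {1..t} (\<lambda>_. restrict_space borel {a..b}))"
    using T_meas valid_weight[OF v \<delta>] by blast
  ultimately have "(\<lambda>y. T (\<lambda>z. \<Sum>j\<in>{1..t}. ?w j * (if (\<lambda>s\<in>{1..t}. y s (asg s)) j \<le> z then 1 else 0))) \<in> borel_measurable outcomes"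
    by (rule measurable_compose)
  moreover have "(\<lambda>z. \<Sum>j\<in>{1..t}. ?w j * (if (\<lambda>s\<in>{1..t}. y s (asg s)) j \<le> z then 1 else 0)) = mix K \<delta> (Fhat y asg t)" for y
  proof -
    have eq: "mix K \<delta> (Fhat y asg t) = (\<lambda>x. \<Sum>s\<in>{1..t}. ?w s * (if y s (asg s) \<le> x then 1 else 0))"
      by (rule mix_Fhat) (rule asg)
    show ?thesis
      unfolding eq
    proof (intro ext sum.cong refl)
      fix z s assume "s \<in> {1..t}"
      then show "?w s * (if (\<lambda>s\<in>{1..t}. y s (asg s)) s \<le> z then 1 else 0) = ?w s * (if y s (asg s) \<le> z then 1 else 0)"
        by (simp cong: if_cong)
    qed
  qed
  ultimately show ?thesis by simp
qed

text \<open>With the state and the assignment frozen, the retained part of Ms j is a random subset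
  of a finite set, and the next state is a function of it.\<close>

lemma elim_simple:
  assumes J0: "J0 \<subseteq> {1..m}" "j \<in> J0" and st: "fold_inv J0 Ms st"
    and Ms: "\<And>l. l \<in> J0 \<Longrightarrow> Ms l \<subseteq> MnA l \<and> Ms l \<noteq> {}" and v: "valid (\<Union>j\<in>J0. A j) t asg"
  shows "simple_function outcomes (\<lambda>y. elim y asg t r Ms j st)"
proof -
  obtain I J Mc where s: "st = (I, J, Mc)" by (cases st)
  have J: "J \<subseteq> J0" using st by (simp add: s)
  show ?thesis
  proof (cases "r \<in> R \<and> 2 \<le> card J")
    case False
    then have "elim y asg t r Ms j st = (I, J, Mc)" for y by (auto simp: s elim_step_def)
    then show ?thesis by simp
  next
    case True
    let ?X = "\<lambda>y. {T (mix K \<delta> (Fhat y asg t)) | \<delta> l. l \<in> J - {j} \<and> \<delta> \<in> Ms l}"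
    let ?B = "\<Union>l\<in>J - {j}. Ms l"
    have finMs: "finite (Ms l)" if "l \<in> J0" for l
      using Ms[OF that] MnA_fin J0(1) that by (meson finite_subset subsetD)
    have tm: "(\<lambda>y. T (mix K \<delta> (Fhat y asg t))) \<in> borel_measurable outcomes" if "l \<in> J0" "\<delta> \<in> Ms l" for l \<delta>
    proof -
      have "\<delta> \<in> simplex_on (A l) K" using MnA_simplex[of l \<delta>] Ms[OF that(1)] that J0(1) by blast
      moreover have "valid (A l) t asg" using v that(1) by (auto simp: valid_def)
      ultimately show ?thesis by (intro T_mix_measurable)
    qed
    have "finite J" using J J0(1) finite_subset[of J "{1..m}"] by auto
    then have fB: "finite ?B" using J finMs by (intro finite_UN_I) auto
    have X: "?X y = (\<lambda>\<delta>. T (mix K \<delta> (Fhat y asg t))) ` ?B" for y by auto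
    have Mx: "(\<lambda>y. Max (?X y)) \<in> borel_measurable outcomes"
      unfolding X using fB tm J by (intro borel_measurable_Max) auto
    let ?Mj = "\<lambda>y. {\<gamma> \<in> Ms j. Max (?X y) - T (mix K \<gamma> (Fhat y asg t)) \<le> u_eta C \<eta> K r n}"
    have sf: "simple_function outcomes ?Mj"
    proof (rule simple_function_filter[OF finMs[OF J0(2)]])
      fix \<gamma> assume \<gamma>: "\<gamma> \<in> Ms j"
      show "{y \<in> space outcomes. Max (?X y) - T (mix K \<gamma> (Fhat y asg t)) \<le> u_eta C \<eta> K r n} \<in> sets outcomes"
        by (rule borel_measurable_le[OF borel_measurable_diff[OF Mx tm[OF J0(2) \<gamma>]] borel_measurable_const])
    qed
    define G where "G V = (if V = {} then (I - A j, J - {j}, Mc(j := V)) else (I, J, Mc(j := V)))" for V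
    have "elim y asg t r Ms j st = G (?Mj y)" for y
      by (simp only: s elim_step_def G_def Let_def prod.case if_P[OF True])
    then show ?thesis using simple_function_compose[OF sf, of G] by (simp add: comp_def)
  qed
qed

lemma fold_simple:
  assumes J0: "J0 \<subseteq> {1..m}" "set js \<subseteq> J0" and st: "fold_inv J0 Ms st"
    and Ms: "\<And>l. l \<in> J0 \<Longrightarrow> Ms l \<subseteq> MnA l \<and> Ms l \<noteq> {}" and v: "valid (\<Union>j\<in>J0. A j) t asg"
  shows "simple_function outcomes (\<lambda>y. fold (elim y asg t r Ms) js st)"
  using J0(2) st
proof (induction js arbitrary: st)
  case (Cons j js)
  have j: "j \<in> J0" "set js \<subseteq> J0" using Cons.prems by auto
  have "simple_function outcomes (\<lambda>y. fold (elim y asg t r Ms) js (elim y asg t r Ms j st))"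
  proof (rule simple_function_bind[OF elim_simple[OF J0(1) j(1) Cons.prems(2) Ms v]])
    fix g assume "g \<in> (\<lambda>y. elim y asg t r Ms j st) ` space outcomes"
    then have "fold_inv J0 Ms g" using elim_inv[OF J0(1) j(1) Cons.prems(2)] by auto
    then show "simple_function outcomes (\<lambda>y. fold (elim y asg t r Ms) js g)" by (rule Cons.IH[OF j(2)])
  qed
  then show ?case by simp
qed simp

lemma loop_simple: "invar st \<Longrightarrow> simple_function outcomes (\<lambda>y. loop y k st)"
proof (induction k arbitrary: st)
  case (Suc k)
  obtain t r I J Ms asg where st: "st = (t, r, I, J, Ms, asg)" by (metis prod_cases6)
  note inv0 = Suc.prems[unfolded st]
  show ?case
  proof (cases "card I \<le> n - t")
    case True
    define asg' where "asg' = assign_next I t (card I) asg"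
    define Fo where "Fo y = fold (elim y asg' (t + card I) (r + 1) Ms) (sorted_list_of_set J) (I, J, Ms)" for y
    define H where "H g y = loop y k (t + card I, r + 1, fst g, fst (snd g), snd (snd g), asg')" for g y
    have l: "loop y (Suc k) st = H (Fo y) y" for y
      using True by (simp add: st Let_def asg'_def Fo_def H_def split: prod.splits)
    have step: "invar (t + card I, r + 1, fst (Fo y), fst (snd (Fo y)), snd (snd (Fo y)), asg')" for y
      by (rule loop_step_invar(1)[OF inv0 True asg'_def]) (simp add: Fo_def)
    \<comment> \<open>The counts do not involve the outcomes, so an arbitrary path can be
      inserted.\<close>
    have cnt: "arm_count asg' (t + card I) i = r + 1" if "i \<in> I" for i
      using loop_step_invar(2)[OF inv0 True asg'_def, of undefined "fst (Fo undefined)" "fst (snd (Fo undefined))" "snd (snd (Fo undefined))" i] that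
      by (simp add: Fo_def)
    have v: "valid (\<Union>j\<in>J. A j) (t + card I) asg'"
      using invarD(1,9)[OF step[of undefined]] cnt invarD(5)[OF inv0] by (auto simp: valid_def)
    have "simple_function outcomes Fo"
      unfolding Fo_def
    proof (rule fold_simple[OF invarD(2)[OF inv0] _ _ _ v])
      show "set (sorted_list_of_set J) \<subseteq> J" using invarD(4)[OF inv0] by simp
      show "fold_inv J Ms (I, J, Ms)" using inv0 by auto
      show "Ms l \<subseteq> MnA l \<and> Ms l \<noteq> {}" if "l \<in> J" for l using invarD(6,7)[OF inv0 that] by simp
    qed
    then have "simple_function outcomes (\<lambda>y. H (Fo y) y)"
    proof (rule simple_function_bind)
      fix g assume "g \<in> Fo ` space outcomes"
      then obtain y0 where "g = Fo y0" by blast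
      then show "simple_function outcomes (H g)" unfolding H_def using step[of y0] by (intro Suc.IH) (simp only:)
    qed
    then show ?thesis unfolding l .
  next
    case False
    then show ?thesis by (simp add: st)
  qed
qed simp

lemma final_simple: "simple_function outcomes final"
  unfolding final_def by (rule loop_simple[OF invar_init])

lemma asgn_simple: "simple_function outcomes (asgn s)"
  using simple_function_compose[OF final_simple, of "\<lambda>st. final_asg st s"] by (simp add: asgn_def[abs_def] comp_def)

lemma K_le_n: "0 < n div K"
  using n_gt K2 by (simp add: div_greater_zero_iff)

lemma final_valid:
  assumes "final y = (t, r, I, J, Ms, asg)"
  shows "valid I n (final_asg (final y))"
proof -
  have e: "final_asg (final y) = (\<lambda>s. asgn s y)" by (simp add: asgn_def fun_eq_iff)
  have "0 < arm_count (\<lambda>s. asgn s y) n i" if "i \<in> I" for i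
    using final_state(5)[OF assms that] K_le_n by auto
  then show ?thesis unfolding e valid_def using final_state(4)[OF assms] by auto
qed

lemma recommend_simple: "simple_function outcomes (recommend K T A R C \<eta> n m MnA)"
proof -
  have "simple_function outcomes (\<lambda>y. lexmin K (candidates (final y) y))"
  proof (rule simple_function_bind[OF final_simple])
    fix st assume "st \<in> final ` space outcomes"
    then obtain y0 where y0: "final y0 = st" by auto
    obtain t r I J Ms asg where st: "st = (t, r, I, J, Ms, asg)" by (metis prod_cases6)
    note fin = y0[unfolded st]
    note inv = final_state(1)[OF fin]
    have v: "valid (A j) n (final_asg st)" if "j \<in> J" for j
      using final_valid[OF fin] that invarD(5)[OF inv] unfolding y0 by (auto simp: valid_def)
    let ?S = "\<Union>j\<in>J. Ms j"
    have fS: "finite ?S" using invarD(4,8)[OF inv] by (rule finite_UN_I)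
    have tm: "(\<lambda>y. T (mix K \<delta> (Fhat y (final_asg st) n))) \<in> borel_measurable outcomes" if \<delta>: "\<delta> \<in> ?S" for \<delta>
    proof -
      obtain j where j: "j \<in> J" "\<delta> \<in> Ms j" using \<delta> by blast
      then have "\<delta> \<in> simplex_on (A j) K" using invarD(2,7)[OF inv] MnA_simplex by blast
      then show ?thesis by (rule T_mix_measurable[OF v[OF j(1)]])
    qed
    have "simple_function outcomes (\<lambda>y. candidates st y)"
      unfolding candidates_def st prod.case
    proof (rule simple_function_filter[OF fS])
      fix \<delta> assume \<delta>: "\<delta> \<in> ?S"
      show "{y \<in> space outcomes. \<forall>\<gamma>\<in>?S. T (mix K \<gamma> (Fhat y (final_asg (t, r, I, J, Ms, asg)) n)) \<le> T (mix K \<delta> (Fhat y (final_asg (t, r, I, J, Ms, asg)) n))} \<in> sets outcomes"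
        using tm \<delta> unfolding st by (intro sets.sets_Collect_finite_All fS borel_measurable_le) auto
    qed
    from simple_function_compose[OF this, of "lexmin K"]
    show "simple_function outcomes (\<lambda>y. lexmin K (candidates st y))" by (simp add: comp_def)
  qed
  then show ?thesis by (simp add: recommend_eq[abs_def])
qed

sublocale adaptive_design P K n asgn
proof (rule adaptive_design.intro)
  show "prob_space P" by (rule prob_P)
  show "(\<lambda>v. v i) \<in> borel_measurable P" if "i \<in> {1..K}" for i using that by (rule comp_borel)
  show "asgn s y \<in> {1..K}" if "s \<in> {1..n}" for s y
    using final_state(4)[OF _ that, of y] by (metis prod_cases6)
  show "simple_function outcomes (asgn s)" for s by (rule asgn_simple)
  show "asgn s y = asgn s y'" if "\<And>u. u \<in> {1..<s} \<Longrightarrow> y u = y' u" for s y y'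
    using that by (rule asgn_adapted)
qed

lemma measure_arm_law: "i \<in> {1..K} \<Longrightarrow> measure (arm_law i) {..x} = F i x"
proof -
  assume i: "i \<in> {1..K}"
  have "measure (arm_law i) {..x} = measure P ((\<lambda>v. v i) -` {..x} \<inter> space P)"
    using i comp_borel[OF i] by (simp only: arm_law_def if_True) (rule measure_distr, auto)
  also have "(\<lambda>v. v i) -` {..x} \<inter> space P = {v \<in> space P. v i \<le> x}" by auto
  finally show ?thesis using F_law[OF i] by simp
qed

section \<open>Regret along a path\<close>

definition val where "val \<delta> = T (mix K \<delta> F)"

lemma mix_F: "\<delta> \<in> unit_simplex K \<Longrightarrow> mix K \<delta> F \<in> D"
  by (rule mix_in_convex[OF D_convex _ F_D])

text \<open>Two cdfs differ by at most 1, so no rule loses more than C against another. This is the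
  cost charged to a wrong elimination.\<close>

lemma val_diff_le:
  assumes "\<delta> \<in> unit_simplex K" "\<gamma> \<in> unit_simplex K" "\<And>i. i \<in> {1..K} \<Longrightarrow> F' i \<in> D"
  shows "T (mix K \<delta> F') - T (mix K \<gamma> F') \<le> C"
proof -
  have D: "mix K \<delta> F' \<in> D" "mix K \<gamma> F' \<in> D"
    using assms by (auto intro!: mix_in_convex[OF D_convex])
  have "\<bar>mix K \<delta> F' x - mix K \<gamma> F' x\<bar> \<le> 1" for x
    using D_cdf_range[OF subsetD[OF D_sub D(1)], of x] D_cdf_range[OF subsetD[OF D_sub D(2)], of x] by linarith
  then have "sup_norm (\<lambda>x. mix K \<delta> F' x - mix K \<gamma> F' x) \<le> 1" by (rule sup_norm_le)
  then have "C * sup_norm (\<lambda>x. mix K \<delta> F' x - mix K \<gamma> F' x) \<le> C * 1" using C_pos by (intro mult_left_mono) auto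
  moreover have "\<bar>T (mix K \<delta> F') - T (mix K \<gamma> F')\<bar> \<le> C * sup_norm (\<lambda>x. mix K \<delta> F' x - mix K \<gamma> F' x)"
    using T_lip D D_sub by blast
  ultimately show ?thesis by linarith
qed

text \<open>The Lipschitz condition asks for one argument in D: the true mixture, which is there by
  convexity. The empirical mixture is merely a cdf on [a, b].\<close>

lemma val_Fhat_le:
  assumes y: "y \<in> space outcomes" and v: "valid B t asg" and asg: "\<And>s. s \<in> {1..t} \<Longrightarrow> asg s = asgn s y"
    and \<delta>: "\<delta> \<in> simplex_on B K"
    and c: "\<And>i. i \<in> B \<Longrightarrow> i \<in> {1..K} \<Longrightarrow> arm_dev i (arm_count asg t i) (tab (y, X)) \<le> c"
  shows "\<bar>val \<delta> - T (mix K \<delta> (Fhat y asg t))\<bar> \<le> C * c"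
proof -
  have t: "t \<le> n" and asgK: "\<And>s. s \<in> {1..t} \<Longrightarrow> asg s \<in> {1..K}" using v by (auto simp: valid_def)
  have \<delta>u: "\<delta> \<in> unit_simplex K" using \<delta> by (simp add: simplex_on_def)
  have eq: "mix K \<delta> (Fhat y asg t) = (\<lambda>x. \<Sum>s\<in>{1..t}. emp_weight \<delta> asg t s * (if y s (asg s) \<le> x then 1 else 0))"
    by (rule mix_Fhat) (rule asgK)
  have "mix K \<delta> (Fhat y asg t) \<in> D_cdf a b"
    unfolding eq
  proof (rule convex_fun_set_sum[OF convex_D_cdf])
    have w: "emp_weight \<delta> asg t \<in> unit_simplex t" by (rule valid_weight[OF v \<delta>])
    show "\<And>s. s \<in> {1..t} \<Longrightarrow> 0 \<le> emp_weight \<delta> asg t s" "(\<Sum>s\<in>{1..t}. emp_weight \<delta> asg t s) = 1"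
      using w by (auto simp: unit_simplex_def)
    show "(\<lambda>z. if y s (asg s) \<le> z then 1 else 0) \<in> D_cdf a b" if s: "s \<in> {1..t}" for s
      using outcome_range[OF y, of s "asg s"] asgK[OF s] s t by (intro step_in_D_cdf) auto
  qed simp
  then have "\<bar>T (mix K \<delta> F) - T (mix K \<delta> (Fhat y asg t))\<bar> \<le> C * sup_norm (\<lambda>x. mix K \<delta> F x - mix K \<delta> (Fhat y asg t) x)"
    using T_lip mix_F[OF \<delta>u] by blast
  moreover have "sup_norm (\<lambda>x. mix K \<delta> F x - mix K \<delta> (Fhat y asg t) x) \<le> c"
  proof (rule sup_norm_le, rule mix_diff_le[OF \<delta>])
    fix x i assume i: "i \<in> B" "i \<in> {1..K}"
    have "\<bar>Fhat y asg t i x - measure (arm_law i) {..x}\<bar> \<le> arm_dev i (arm_count asg t i) (tab (y, X))"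
      using v i by (intro Fhat_dev_le[OF y t asg refl]) (auto simp: valid_def)
    then show "\<bar>F i x - Fhat y asg t i x\<bar> \<le> c" using c[OF i] measure_arm_law[OF i(2)] by (simp add: abs_minus_commute)
  qed
  then have "C * sup_norm (\<lambda>x. mix K \<delta> F x - mix K \<delta> (Fhat y asg t) x) \<le> C * c"
    using C_pos by (intro mult_left_mono) auto
  ultimately show ?thesis unfolding val_def by linarith
qed

definition width where
  "width r = sqrt ((1 + \<eta>) / real r * (0.5 * ln (real n) + ln (real r * real K)))"

lemma u_eta_width: "u_eta C \<eta> K r n = C * width r"
  by (simp add: u_eta_def width_def)

abbreviation lo where "lo \<equiv> n div K"
abbreviation hi where "hi \<equiv> Min R + (n - Min R * K + 1) div 2"

lemma Min_R_K: "Min R * K \<le> n"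
  using R_min K2 by (metis div_times_less_eq_dividend mult_le_mono1 order_trans)

lemma lo_hi: "0 < lo" "lo \<le> hi" "hi \<le> n"
proof -
  show "0 < lo" by (rule K_le_n)
  have 1: "1 \<le> Min R" using Min_R R_ge_1 by blast
  define q where "q = n - Min R * K"
  have q: "n = Min R * K + q" using Min_R_K by (simp add: q_def)
  have "lo \<le> Min R + q div 2"
  proof -
    have "n div K = Min R + q div K" using K2 by (simp add: q)
    moreover have "q div K \<le> q div 2" using K2 by (intro div_le_mono2) auto
    ultimately show ?thesis by simp
  qed
  moreover have "q div 2 \<le> (q + 1) div 2" by (rule div_le_mono) simp
  ultimately show "lo \<le> hi" unfolding q_def[symmetric] by simp
  have "Min R \<le> Min R * K" using K2 by simp
  moreover have "(q + 1) div 2 \<le> q" by presburger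
  ultimately have "Min R + (q + 1) div 2 \<le> Min R * K + q" by (rule add_mono)
  then show "hi \<le> n" unfolding q_def[symmetric] q[symmetric] .
qed

text \<open>Since \<gamma> is best, the estimated lead of \<delta> is estimation error alone. The
  arms of \<delta> lie in the complement of A j0, because the groups are disjoint.\<close>

lemma bad_round_imp_bad_event:
  assumes y: "y \<in> space outcomes" and X: "X \<in> space (table_measure cells)"
    and j0: "j0 \<in> {1..m}" "\<gamma> \<in> MnA j0"
    and best: "\<And>l \<delta>. l \<in> {1..m} \<Longrightarrow> \<delta> \<in> MnA l \<Longrightarrow> val \<delta> \<le> val \<gamma>"
    and bad: "bad_round j0 \<gamma> y"
  shows "\<exists>r\<in>R. tab (y, X) \<in> bad_event K n (A j0) r (width r)"
proof -
  obtain t r asg l \<delta> where b: "t \<le> n" "r \<in> R" "\<And>s. s \<in> {1..t} \<Longrightarrow> asg s = asgn s y" "\<And>s. s \<in> {1..t} \<Longrightarrow> asg s \<in> {1..K}"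
     "l \<in> {1..m}" "l \<noteq> j0" "\<delta> \<in> MnA l" "\<And>i. i \<in> A j0 \<union> A l \<Longrightarrow> arm_count asg t i = r"
     "u_eta C \<eta> K r n < T (mix K \<delta> (Fhat y asg t)) - T (mix K \<gamma> (Fhat y asg t))"
    using bad unfolding bad_round_def by blast
  let ?Z = "tab (y, X)"
  have r: "0 < r" using R_ge_1[OF b(2)] by simp
  have dev: "\<bar>val \<zeta> - T (mix K \<zeta> (Fhat y asg t))\<bar> \<le> C * max_dev B r ?Z"
    if z: "\<zeta> \<in> MnA j" and j: "j \<in> {1..m}" "j = j0 \<or> j = l" and B: "A j \<subseteq> B" "finite B" for \<zeta> j B
  proof (rule val_Fhat_le[OF y _ b(3) MnA_simplex[OF j(1) z]])
    have cnt: "arm_count asg t i = r" if "i \<in> A j" for i using b(8) that j by blast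
    show "valid (A j) t asg" using b(1,4) cnt r by (auto simp: valid_def)
    show "arm_dev i (arm_count asg t i) ?Z \<le> max_dev B r ?Z" if "i \<in> A j" for i
      unfolding cnt[OF that] max_dev_def using that B by (intro Max_ge) auto
  qed auto
  have sub: "A l \<subseteq> {1..K} - A j0" using A_sub[OF b(5)] A_disj b(5,6) j0(1) by blast
  have "C * width r < T (mix K \<delta> (Fhat y asg t)) - T (mix K \<gamma> (Fhat y asg t))"
    using b(9) by (simp add: u_eta_width)
  also have "\<dots> \<le> (val \<delta> + C * max_dev ({1..K} - A j0) r ?Z) - (val \<gamma> - C * max_dev (A j0) r ?Z)"
    using dev[OF b(7) b(5) _ sub] dev[OF j0(2) j0(1) _ order_refl finite_A[OF j0(1)]] by simp
  also have "\<dots> \<le> C * (max_dev (A j0) r ?Z + max_dev ({1..K} - A j0) r ?Z)"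
    using best[OF b(5,7)] by (simp add: algebra_simps)
  finally have "width r < max_dev (A j0) r ?Z + max_dev ({1..K} - A j0) r ?Z" using C_pos by simp
  moreover have "?Z \<in> space (table_measure cells)"
    using measurable_space[OF tab_measurable, of "(y, X)"] y X by (simp add: space_pair_measure)
  ultimately show ?thesis using b(2) unfolding bad_event_def by blast
qed

lemma simplex_singleton:
  assumes "\<delta> \<in> simplex_on {i} K" "\<gamma> \<in> simplex_on {i} K"
  shows "\<delta> = \<gamma>"
proof
  have one: "\<zeta> i = 1 \<and> i \<in> {1..K}" if z: "\<zeta> \<in> simplex_on {i} K" for \<zeta> :: "nat \<Rightarrow> real"
  proof -
    have "(\<Sum>k\<in>{1..K}. \<zeta> k) = (\<Sum>k\<in>{1..K}. if k = i then \<zeta> i else 0)"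
      using z by (intro sum.cong) (auto simp: simplex_on_def)
    then show ?thesis using z by (auto simp: simplex_on_def unit_simplex_def split: if_splits)
  qed
  fix k show "\<delta> k = \<gamma> k" using one[OF assms(1)] one[OF assms(2)] assms by (cases "k = i") (auto simp: simplex_on_def)
qed

text \<open>A bad round costs at most C and is paid for by one indicator. If none occurs and two
  arms are in play, the sample sizes of the surviving arms lie between lo and hi, and optimality on
  the estimates gives twice the deviation. If one arm is in play, hi need not bound its sample size,
  but each surviving rule is the point mass on that arm, hence equal to \<gamma>.\<close>

lemma val_gap_pathwise:
  assumes y: "y \<in> space outcomes" and X: "X \<in> space (table_measure cells)"
    and j0: "j0 \<in> {1..m}" "\<gamma> \<in> MnA j0"
    and best: "\<And>l \<delta>. l \<in> {1..m} \<Longrightarrow> \<delta> \<in> MnA l \<Longrightarrow> val \<delta> \<le> val \<gamma>"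
  shows "val \<gamma> - val (recommend K T A R C \<eta> n m MnA y)
    \<le> C * (2 * sup_dev K lo hi (tab (y, X)) + (\<Sum>r\<in>R. indicator (bad_event K n (A j0) r (width r)) (tab (y, X))))"
proof -
  let ?Z = "tab (y, X)"
  let ?rec = "recommend K T A R C \<eta> n m MnA y"
  let ?ind = "\<Sum>r\<in>R. indicat_real (bad_event K n (A j0) r (width r)) ?Z"
  have K0: "0 < K" using K2 by simp
  have sd0: "0 \<le> sup_dev K lo hi ?Z" by (rule sup_dev_bounds(1)[OF K0 lo_hi])
  have ind0: "0 \<le> ?ind" by (intro sum_nonneg) auto
  obtain t r I J Ms asg where fin: "final y = (t, r, I, J, Ms, asg)" by (metis prod_cases6)
  note inv = final_state(1)[OF fin]
  let ?S = "\<Union>j\<in>J. Ms j"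
  have fS: "finite ?S" using invarD(4,8)[OF inv] by (rule finite_UN_I)
  have nS: "?S \<noteq> {}" using invarD(3,6)[OF inv] by blast
  have cand: "?rec \<in> candidates (final y) y"
    unfolding recommend_eq
  proof (rule lexmin_in)
    have cs: "candidates (final y) y = {\<delta> \<in> ?S. \<forall>\<gamma>\<in>?S. T (mix K \<gamma> (Fhat y (final_asg (final y)) n)) \<le> T (mix K \<delta> (Fhat y (final_asg (final y)) n))}"
      unfolding candidates_def fin by simp
    show "finite (candidates (final y) y)" unfolding cs by (rule finite_subset[OF _ fS]) blast
    let ?t = "\<lambda>\<delta>. T (mix K \<delta> (Fhat y (final_asg (final y)) n))"
    have "Max (?t ` ?S) \<in> ?t ` ?S" using fS nS by (intro Max_in) auto
    then obtain \<delta> where "\<delta> \<in> ?S" "Max (?t ` ?S) = ?t \<delta>" by blast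
    then have "\<delta> \<in> candidates (final y) y" unfolding cs using Max_ge[of "?t ` ?S"] fS by auto
    then show "candidates (final y) y \<noteq> {}" by blast
    show "candidates (final y) y \<subseteq> unit_simplex K"
      unfolding cs using invarD(2,7)[OF inv] MnA_unit by blast
  qed
  then obtain l where l: "l \<in> J" "?rec \<in> Ms l"
    and opt: "\<And>\<zeta>. \<zeta> \<in> ?S \<Longrightarrow> T (mix K \<zeta> (Fhat y (final_asg (final y)) n)) \<le> T (mix K ?rec (Fhat y (final_asg (final y)) n))"
    unfolding candidates_def fin by auto
  have lm: "l \<in> {1..m}" "?rec \<in> MnA l" using l invarD(2,7)[OF inv] by blast+
  show ?thesis
  proof (cases "bad_round j0 \<gamma> y")
    case True
    have "\<exists>r\<in>R. ?Z \<in> bad_event K n (A j0) r (width r)"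
      by (rule bad_round_imp_bad_event[OF y X j0 _ True]) (erule (1) best)
    then obtain r where r: "r \<in> R" "?Z \<in> bad_event K n (A j0) r (width r)" by blast
    have "indicat_real (bad_event K n (A j0) r (width r)) ?Z \<le> ?ind"
      using r finite_R by (intro member_le_sum) auto
    then have "1 \<le> ?ind" using r by simp
    then have "C * 1 \<le> C * (2 * sup_dev K lo hi ?Z + ?ind)" using sd0 C_pos by (intro mult_left_mono) auto
    moreover have "val \<gamma> - val ?rec \<le> C"
      unfolding val_def using MnA_unit j0 lm F_D by (intro val_diff_le) auto
    ultimately show ?thesis by simp
  next
    case False
    then have good: "j0 \<in> J" "\<gamma> \<in> Ms j0" using final_state(7)[OF fin j0] by auto
    show ?thesis
    proof (cases "2 \<le> card I")
      case True
      have e: "final_asg (final y) = (\<lambda>s. asgn s y)" by (simp add: asgn_def fun_eq_iff)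
      have dev: "\<bar>val \<zeta> - T (mix K \<zeta> (Fhat y (final_asg (final y)) n))\<bar> \<le> C * sup_dev K lo hi ?Z"
        if z: "j \<in> J" "\<zeta> \<in> Ms j" for \<zeta> j
      proof (rule val_Fhat_le[OF y _ _ MnA_simplex])
        have AI: "A j \<subseteq> I" using invarD(5)[OF inv] z(1) by blast
        then show "valid (A j) n (final_asg (final y))" using final_valid[OF fin] by (auto simp: valid_def)
        show "arm_dev i (arm_count (final_asg (final y)) n i) ?Z \<le> sup_dev K lo hi ?Z" if "i \<in> A j" "i \<in> {1..K}" for i
          unfolding e using final_state(5,6)[OF fin, of i] AI that True
          by (intro arm_dev_le_sup_dev[OF K0 lo_hi]) auto
        show "j \<in> {1..m}" "\<zeta> \<in> MnA j" using z invarD(2,7)[OF inv] by blast+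
      qed (simp add: e)
      have "val \<gamma> - val ?rec \<le> C * (2 * sup_dev K lo hi ?Z)"
        using dev[OF good] dev[OF l] opt[of \<gamma>] good by (force simp: algebra_simps abs_le_iff)
      also have "\<dots> \<le> C * (2 * sup_dev K lo hi ?Z + ?ind)" using ind0 C_pos by (intro mult_left_mono) auto
      finally show ?thesis .
    next
      case False
      have "card I \<noteq> 0" using invarD(12,14)[OF inv] by simp
      then have "card I = 1" using False by simp
      then obtain i where i: "I = {i}" by (auto simp: card_1_singleton_iff)
      have Ai: "A j = {i}" if j: "j \<in> J" for j
      proof -
        have "A j \<noteq> {}" using A_ne subsetD[OF invarD(2)[OF inv] j] by blast
        moreover have "A j \<subseteq> {i}" unfolding i[symmetric] invarD(5)[OF inv] using j by blast
        ultimately show ?thesis by blast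
      qed
      have "l = j0" using A_disj Ai[OF l(1)] Ai[OF good(1)] lm(1) j0(1) by blast
      moreover have "\<gamma> \<in> simplex_on {i} K" "?rec \<in> simplex_on {i} K"
        using MnA_simplex[OF j0] MnA_simplex[OF lm] Ai[OF l(1)] Ai[OF good(1)] by auto
      then have "?rec = \<gamma>" by (intro simplex_singleton)
      then show ?thesis using sd0 ind0 C_pos by simp
    qed
  qed
qed

lemma regret_le:
  assumes j0: "j0 \<in> {1..m}" "\<gamma> \<in> MnA j0"
    and best: "\<And>l \<delta>. l \<in> {1..m} \<Longrightarrow> \<delta> \<in> MnA l \<Longrightarrow> val \<delta> \<le> val \<gamma>"
  shows "regret K T (\<Union>j\<in>{1..m}. MA j) F \<zeta> \<le> disc_err K T D (\<Union>j\<in>{1..m}. MA j) (\<Union>j\<in>{1..m}. MnA j) + (val \<gamma> - val \<zeta>)"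
proof -
  let ?M = "\<Union>j\<in>{1..m}. MA j" and ?Mn = "\<Union>j\<in>{1..m}. MnA j"
  let ?e = "\<lambda>F'. \<bar>(SUP \<delta>\<in>?M. T (mix K \<delta> F')) - (SUP \<delta>\<in>?Mn. T (mix K \<delta> F'))\<bar>"
  have unit: "\<delta> \<in> unit_simplex K" if "\<delta> \<in> ?M" for \<delta> using that MA_sub by (auto simp: simplex_on_def)
  have sub: "?Mn \<subseteq> ?M" using MnA_sub by blast
  have \<gamma>n: "\<gamma> \<in> ?Mn" using j0 by blast
  then have \<gamma>M: "\<gamma> \<in> ?M" using sub by blast
  \<comment> \<open>The errors must be bounded for the supremum in \<open>disc_err\<close> to
    dominate the value at F.\<close>
  have e_le: "?e F' \<le> C" if F': "\<And>i. i \<in> {1..K} \<Longrightarrow> F' i \<in> D" for F'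
  proof -
    let ?t = "\<lambda>\<delta>. T (mix K \<delta> F')"
    have le: "?t \<delta> \<le> ?t \<gamma> + C" if "\<delta> \<in> ?M" for \<delta>
      using val_diff_le[of \<delta> \<gamma> F', OF unit[OF that] unit[OF \<gamma>M] F'] by simp
    have bdd: "bdd_above (?t ` ?M)" using le by (intro bdd_aboveI[of _ "?t \<gamma> + C"]) auto
    have "(SUP \<delta>\<in>?M. ?t \<delta>) \<le> ?t \<gamma> + C" using \<gamma>M le by (intro cSUP_least) auto
    moreover have "?t \<gamma> \<le> (SUP \<delta>\<in>?Mn. ?t \<delta>)"
      using bdd_above_mono[OF bdd image_mono[OF sub]] \<gamma>n by (intro cSUP_upper)
    moreover have "(SUP \<delta>\<in>?Mn. ?t \<delta>) \<le> (SUP \<delta>\<in>?M. ?t \<delta>)"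
      by (rule cSUP_subset_mono[OF _ bdd sub order_refl]) (use \<gamma>n in blast)
    ultimately show ?thesis by simp
  qed
  have "?e F \<le> disc_err K T D ?M ?Mn"
    unfolding disc_err_def
  proof (rule cSUP_upper[where f = ?e])
    show "F \<in> {F. \<forall>i\<in>{1..K}. F i \<in> D}" using F_D by blast
    show "bdd_above (?e ` {F. \<forall>i\<in>{1..K}. F i \<in> D})"
      using e_le by (intro bdd_aboveI[of _ C]) auto
  qed
  moreover have "(SUP \<delta>\<in>?Mn. T (mix K \<delta> F)) = val \<gamma>"
    unfolding val_def[symmetric] using \<gamma>n best by (intro cSup_eq_maximum) auto
  ultimately show ?thesis unfolding regret_def val_def[of \<zeta>] by simp
qed

text \<open>j0 is the group of a best discretized rule and depends on F. The later bounds on the bad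
  events hold for every group, so its existence is enough.\<close>

lemma expected_regret_le:
  "\<exists>j0\<in>{1..m}. integrable outcomes (\<lambda>y. regret K T (\<Union>j\<in>{1..m}. MA j) F (recommend K T A R C \<eta> n m MnA y)) \<and>
    (\<integral>y. regret K T (\<Union>j\<in>{1..m}. MA j) F (recommend K T A R C \<eta> n m MnA y) \<partial>outcomes)
     \<le> disc_err K T D (\<Union>j\<in>{1..m}. MA j) (\<Union>j\<in>{1..m}. MnA j)
       + C * (2 * (\<integral>Z. sup_dev K lo hi Z \<partial>table_measure cells)
         + (\<Sum>r\<in>R. measure (table_measure cells) (bad_event K n (A j0) r (width r))))"
proof -
  let ?M = "\<Union>j\<in>{1..m}. MA j" and ?Mn = "\<Union>j\<in>{1..m}. MnA j"
  let ?reg = "\<lambda>y. regret K T ?M F (recommend K T A R C \<eta> n m MnA y)"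
  let ?Q = "table_measure cells"
  have fMn: "finite ?Mn" using MnA_fin by auto
  have "?Mn \<noteq> {}" using MnA_ne m_bounds by (auto simp: ex_in_conv[symmetric] intro!: exI[of _ 1])
  then have "Max (val ` ?Mn) \<in> val ` ?Mn" using fMn by (intro Max_in) auto
  then obtain j0 \<gamma> where j0: "j0 \<in> {1..m}" "\<gamma> \<in> MnA j0" and mx: "Max (val ` ?Mn) = val \<gamma>" by auto
  have best: "val \<delta> \<le> val \<gamma>" if "l \<in> {1..m}" "\<delta> \<in> MnA l" for l \<delta>
  proof -
    have "val \<delta> \<in> val ` ?Mn" using that by blast
    then show ?thesis unfolding mx[symmetric] using fMn by (intro Max_ge) auto
  qed
  interpret O: prob_space outcomes by (intro prob_space_PiM prob_P)
  interpret Q: prob_space ?Q by (rule prob_space_table)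
  interpret OQ: pair_prob_space outcomes ?Q ..
  have sreg: "simple_function outcomes ?reg"
    using simple_function_compose[OF recommend_simple, of "regret K T ?M F"] by (simp add: comp_def)
  have mreg: "?reg \<in> borel_measurable outcomes" by (rule borel_measurable_simple_function[OF sreg])
  have ireg: "integrable outcomes ?reg"
  proof -
    \<comment> \<open>The recommendation has finitely many values, so the regret is bounded.\<close>
    define bnd where "bnd = Max ((\<lambda>y. \<bar>?reg y\<bar>) ` space outcomes)"
    have "finite ((\<lambda>y. \<bar>?reg y\<bar>) ` space outcomes)"
      using simple_functionD(1)[OF simple_function_compose[OF sreg, of abs]] by (simp add: comp_def)
    then have "\<bar>?reg y\<bar> \<le> bnd" if "y \<in> space outcomes" for y
      unfolding bnd_def using that by (intro Max_ge) auto
    then show ?thesis using mreg by (intro O.integrable_const_bound[where B = bnd]) auto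
  qed
  have K0: "0 < K" using K2 by simp
  have AK: "A j0 \<subseteq> {1..K}" by (rule A_sub[OF j0(1)])
  have bm[measurable]: "bad_event K n (A j0) r (width r) \<in> sets ?Q" if "r \<in> R" for r
    by (rule bad_event_sets[OF AK R_le[OF that]])
  have sm: "sup_dev K lo hi \<in> borel_measurable ?Q" by (rule sup_dev_measurable[OF K0 lo_hi])
  \<comment> \<open>The pathwise bound as a function of the table alone. Since the table has the
    product law, its expectation no longer involves the policy.\<close>
  define g where "g Z = disc_err K T D ?M ?Mn
    + C * (2 * sup_dev K lo hi Z + (\<Sum>r\<in>R. indicator (bad_event K n (A j0) r (width r)) Z))" for Z
  have isd: "integrable ?Q (sup_dev K lo hi)"
    using sm sup_dev_bounds[OF K0 lo_hi] by (intro Q.integrable_const_bound[where B = 1]) auto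
  have iind: "integrable ?Q (indicat_real (bad_event K n (A j0) r (width r)))" if "r \<in> R" for r
  proof (rule Q.integrable_const_bound[where B = 1])
    show "AE Z in ?Q. norm (indicat_real (bad_event K n (A j0) r (width r)) Z) \<le> 1" by (simp add: indicator_def)
    show "indicat_real (bad_event K n (A j0) r (width r)) \<in> borel_measurable ?Q"
      using bm[OF that] by (rule borel_measurable_indicator)
  qed
  have ig: "integrable ?Q g"
    unfolding g_def
    by (intro Bochner_Integration.integrable_add Q.integrable_const integrable_mult_right Bochner_Integration.integrable_sum isd iind)
  then have gm: "g \<in> borel_measurable ?Q" by (rule borel_measurable_integrable)
  have igt: "integrable (outcomes \<Otimes>\<^sub>M ?Q) (\<lambda>\<omega>. g (tab \<omega>))"
    using integrable_distr_eq[OF tab_measurable gm] ig unfolding tab_law by simp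
  have df: "distr (outcomes \<Otimes>\<^sub>M ?Q) outcomes fst = outcomes" by (rule Q.distr_pair_fst)
  have irf: "integrable (outcomes \<Otimes>\<^sub>M ?Q) (\<lambda>\<omega>. ?reg (fst \<omega>))"
    by (rule integrable_distr[OF measurable_fst]) (simp only: df ireg)
  have "(\<integral>y. ?reg y \<partial>outcomes) = (\<integral>\<omega>. ?reg (fst \<omega>) \<partial>(outcomes \<Otimes>\<^sub>M ?Q))"
  proof -
    have "(\<integral>y. ?reg y \<partial>distr (outcomes \<Otimes>\<^sub>M ?Q) outcomes fst) = (\<integral>\<omega>. ?reg (fst \<omega>) \<partial>(outcomes \<Otimes>\<^sub>M ?Q))"
      by (rule integral_distr[OF measurable_fst mreg])
    then show ?thesis unfolding df .
  qed
  also have "\<dots> \<le> (\<integral>\<omega>. g (tab \<omega>) \<partial>(outcomes \<Otimes>\<^sub>M ?Q))"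
  proof (rule integral_mono[OF irf igt])
    fix \<omega> assume \<omega>: "\<omega> \<in> space (outcomes \<Otimes>\<^sub>M ?Q)"
    obtain y X where yX: "\<omega> = (y, X)" "y \<in> space outcomes" "X \<in> space ?Q"
      using \<omega> by (auto simp: space_pair_measure)
    let ?rec = "recommend K T A R C \<eta> n m MnA y"
    have "regret K T ?M F ?rec \<le> disc_err K T D ?M ?Mn + (val \<gamma> - val ?rec)"
      by (rule regret_le[OF j0]) (erule (1) best)
    moreover have "val \<gamma> - val ?rec \<le> C * (2 * sup_dev K lo hi (tab (y, X))
        + (\<Sum>r\<in>R. indicator (bad_event K n (A j0) r (width r)) (tab (y, X))))"
      by (rule val_gap_pathwise[OF yX(2,3) j0]) (erule (1) best)
    ultimately show "?reg (fst \<omega>) \<le> g (tab \<omega>)"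
      unfolding yX(1) fst_conv g_def by linarith
  qed
  also have "\<dots> = (\<integral>Z. g Z \<partial>?Q)"
    using integral_distr[OF tab_measurable gm] unfolding tab_law by simp
  also have "\<dots> = disc_err K T D ?M ?Mn + C * (2 * (\<integral>Z. sup_dev K lo hi Z \<partial>?Q)
      + (\<Sum>r\<in>R. measure ?Q (bad_event K n (A j0) r (width r))))"
  proof -
    have "(\<integral>Z. (\<Sum>r\<in>R. indicat_real (bad_event K n (A j0) r (width r)) Z) \<partial>?Q) = (\<Sum>r\<in>R. measure ?Q (bad_event K n (A j0) r (width r)))"
      using iind bm by (subst Bochner_Integration.integral_sum) (auto intro!: sum.cong simp: Q.emeasure_eq_measure)
    moreover have "integrable ?Q (\<lambda>Z. \<Sum>r\<in>R. indicat_real (bad_event K n (A j0) r (width r)) Z)"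
      by (intro Bochner_Integration.integrable_sum iind)
    ultimately show ?thesis unfolding g_def using Q.expectation_affine[OF isd] by (simp only:)
  qed
  finally show ?thesis using ireg j0(1) by blast
qed

end


section \<open>The numerical bounds\<close>

lemma sqrt_8pi_bounds: "5 \<le> sqrt (8 * pi)" "sqrt (8 * pi) \<le> 5.02"
proof -
  show "5 \<le> sqrt (8 * pi)" using pi_approx by (intro real_le_rsqrt) (simp add: power2_eq_square)
  show "sqrt (8 * pi) \<le> 5.02" by (rule real_le_lsqrt) (use pi_approx in \<open>auto simp: power2_eq_square\<close>)
qed

lemma sqrt_2pi_bounds: "2.5 \<le> sqrt (2 * pi)" "sqrt (2 * pi) \<le> 2.51"
proof -
  show "2.5 \<le> sqrt (2 * pi)" using pi_approx by (intro real_le_rsqrt) (simp add: power2_eq_square)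
  show "sqrt (2 * pi) \<le> 2.51" by (rule real_le_lsqrt) (use pi_approx in \<open>auto simp: power2_eq_square\<close>)
qed

text \<open>Four digits of e are kept because 16 pi \<le> 18.5 e, used for \<open>C1_nK\<close>,
  holds with a margin of only about 0.02.\<close>

lemma exp_1_bounds: "27182 / 10000 \<le> exp (1 :: real)" "exp (1 :: real) \<le> 27183 / 10000"
proof -
  have "2 * \<bar>exp 1 * 2147483648 - 5837465777\<bar> \<le> (1 :: real)" using e_approx_32 by (auto simp: field_simps)
  then have h: "\<bar>exp 1 * 2147483648 - 5837465777\<bar> \<le> (1 / 2 :: real)" by simp
  show "27182 / 10000 \<le> exp (1 :: real)" using abs_le_D2[OF h] by simp
  show "exp (1 :: real) \<le> 27183 / 10000" using abs_le_D1[OF h] by simp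
qed

lemma maximal_const_bounds:
  "16 \<le> 1 + (1 + sqrt (8 * pi)) * sqrt (2 * pi)" "1 + (1 + sqrt (8 * pi)) * sqrt (2 * pi) \<le> 17"
proof -
  have "6 * 2.5 \<le> (1 + sqrt (8 * pi)) * sqrt (2 * pi)"
    using sqrt_8pi_bounds sqrt_2pi_bounds by (intro mult_mono) auto
  then show "16 \<le> 1 + (1 + sqrt (8 * pi)) * sqrt (2 * pi)" by simp
  have "(1 + sqrt (8 * pi)) * sqrt (2 * pi) \<le> 6.02 * 2.51"
    using sqrt_8pi_bounds sqrt_2pi_bounds by (intro mult_mono) auto
  then show "1 + (1 + sqrt (8 * pi)) * sqrt (2 * pi) \<le> 17" by simp
qed

lemma div_K_lower:
  fixes n K :: nat
  assumes "0 < K"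
  shows "real n - real K \<le> real K * real (n div K)"
proof -
  have "n < K * (n div K) + K" using assms by (metis div_mult_mod_eq mod_less_divisor mult.commute nat_add_left_cancel_less)
  then have "real n < real K * real (n div K) + real K" by (metis of_nat_add of_nat_less_iff of_nat_mult)
  then show ?thesis by simp
qed

context
  fixes n K u :: nat
  assumes K: "2 \<le> K" and n: "K < n" and u: "1 \<le> u" "u \<le> n div K"
begin

lemma u_K: "u * K \<le> n"
  using u(2) K by (metis div_times_less_eq_dividend mult_le_mono1 order_trans)

lemma lo_pos: "0 < n div K"
  using n K by (simp add: div_greater_zero_iff)

lemma inverse_lo: "1 / real (n div K) \<le> real K / (real n - real K)"
  using div_K_lower[of K n] lo_pos K n by (simp add: field_simps)

lemma half_up: "real ((n - u * K + 1) div 2) \<le> (real n - real u * real K) / 2 + 1 / 2"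
proof -
  have "real ((n - u * K + 1) div 2) \<le> real (n - u * K + 1) / 2" 
  proof -
    have "2 * ((n - u * K + 1) div 2) \<le> n - u * K + 1" by (rule times_div_less_eq_dividend)
    then have "real (2 * ((n - u * K + 1) div 2)) \<le> real (n - u * K + 1)" by (simp only: of_nat_le_iff)
    then show ?thesis by (simp only: of_nat_mult of_nat_numeral) simp
  qed
  also have "real (n - u * K + 1) = real n - real u * real K + 1" using u_K by (simp add: of_nat_diff)
  finally show ?thesis unfolding add_divide_distrib .
qed

text \<open>n times \<open>f_nK\<close> is u + (n - u K) / 2 + 1, which dominates the largest sample
  size with room for the rounding.\<close>

lemma f_nK_ge: "real (u + (n - u * K + 1) div 2) \<le> real n * f_nK n K (real u)"
proof -
  have "real n * f_nK n K (real u) = real n / 2 + real u - real u * real K / 2 + 1"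
    using n by (simp add: f_nK_def field_simps)
  then show ?thesis using half_up by (simp add: field_simps)
qed

lemma f_nK_le_1: "f_nK n K (real u) \<le> 1"
proof -
  have "real u * 2 \<le> real u * real K" using K by (intro mult_left_mono) auto
  moreover have "2 \<le> real n" using n K by simp
  ultimately have "real n / 2 + real u - real u * real K / 2 + 1 \<le> real n" by simp
  moreover have "real n * f_nK n K (real u) = real n / 2 + real u - real u * real K / 2 + 1"
    using n by (simp add: f_nK_def field_simps)
  ultimately have "real n * f_nK n K (real u) \<le> real n * 1" by simp
  then show ?thesis using n by (subst (asm) mult_le_cancel_left_pos) auto
qed

lemma A_nK_eq: "A_nK n K u = (1 + exp 1) / (sqrt 2 * exp 1)
    * sqrt (ln (real K * (1 + (1 + sqrt (8 * pi)) * sqrt (2 * pi)))) * sqrt (real n * f_nK n K (real u)) * (real K / (real n - real K))"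
proof -
  have n0: "0 < real n" "0 < real n - real K" using n by auto
  have s: "sqrt (real n) * sqrt (real n) = real n" by simp
  have "1 / ((1 - real K / real n) * sqrt (real n)) = sqrt (real n) / (real n - real K)"
  proof -
    have "1 - real K / real n = (real n - real K) / real n" using n0 by (simp add: diff_divide_distrib)
    then have "(1 - real K / real n) * sqrt (real n) = (real n - real K) / sqrt (real n)"
      using n0 s by (metis divide_divide_eq_right nonzero_mult_div_cancel_left real_sqrt_gt_zero less_irrefl times_divide_eq_left mult.commute real_div_sqrt less_imp_le)
    then show ?thesis by simp
  qed
  then have "A_nK n K u = (1 + exp 1) / (sqrt 2 * exp 1)
    * sqrt (ln (real K * (1 + (1 + sqrt (8 * pi)) * sqrt (2 * pi)))) * sqrt (f_nK n K (real u)) * real K * (sqrt (real n) / (real n - real K))"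
  proof -
    assume *: "1 / ((1 - real K / real n) * sqrt (real n)) = sqrt (real n) / (real n - real K)"
    have "x / (y * p) * l * f * k / q = x / y * l * f * k * (1 / (p * q))" for x y p l f k q :: real by simp
    then show ?thesis unfolding A_nK_def *[symmetric] .
  qed
  then show ?thesis by (simp add: real_sqrt_mult mult_ac)
qed

text \<open>The maximal inequality gives the constants sqrt (3/4) and 5 e, about 0.87 and 13.6;
  \<open>A_nK\<close> allows (1 + e) / (sqrt 2 e) and at least 16, the first being about
  0.97.\<close>

lemma maximal_bound_le_A_nK:
  "sqrt (3 / 4 * real (u + (n - u * K + 1) div 2) * (1 + ln (5 * real K))) / real (n div K) \<le> A_nK n K u"
proof -
  let ?L = "ln (real K * (1 + (1 + sqrt (8 * pi)) * sqrt (2 * pi)))"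
  have L: "1 + ln (5 * real K) \<le> ?L"
  proof -
    have "1 + ln (5 * real K) = ln (exp 1 * (5 * real K))" using K by (simp add: ln_mult)
    also have "\<dots> \<le> ?L"
    proof (rule ln_mono)
      have "exp 1 * 5 \<le> (16 :: real)" using exp_1_bounds by simp
      then have "exp 1 * 5 \<le> 1 + (1 + sqrt (8 * pi)) * sqrt (2 * pi)" using maximal_const_bounds by linarith
      then have "real K * (exp 1 * 5) \<le> real K * (1 + (1 + sqrt (8 * pi)) * sqrt (2 * pi))" by (rule mult_left_mono) simp
      then show "exp 1 * (5 * real K) \<le> real K * (1 + (1 + sqrt (8 * pi)) * sqrt (2 * pi))" by (simp add: mult_ac)
    qed (use K in auto)
    finally show ?thesis .
  qed
  have l0: "0 \<le> 1 + ln (5 * real K)" using K by simp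
  have c: "sqrt (3 / 4) \<le> (1 + exp 1) / (sqrt 2 * exp (1 :: real))"
  proof (rule real_le_lsqrt)
    have "(5 / 4 * exp 1)\<^sup>2 \<le> (1 + exp (1 :: real))\<^sup>2" using exp_1_bounds by (intro power_mono) auto
    moreover have "(5 / 4 * exp 1)\<^sup>2 = 25 / 16 * (exp (1 :: real))\<^sup>2" by (simp add: power_mult_distrib power_divide)
    ultimately have "3 / 2 * (exp 1)\<^sup>2 \<le> (1 + exp (1 :: real))\<^sup>2"
      using zero_le_power2[of "exp 1 :: real"] by linarith
    then show "3 / 4 \<le> ((1 + exp 1) / (sqrt 2 * exp (1 :: real)))\<^sup>2"
      by (simp add: power_divide power_mult_distrib pos_le_divide_eq)
  qed auto
  have "sqrt (3 / 4 * real (u + (n - u * K + 1) div 2) * (1 + ln (5 * real K))) * (1 / real (n div K))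
     \<le> sqrt (3 / 4 * (real n * f_nK n K (real u)) * ?L) * (real K / (real n - real K))"
    using f_nK_ge L l0 inverse_lo lo_pos
    by (intro mult_mono real_sqrt_le_mono) (auto intro: order_trans)
  also have "\<dots> = sqrt (3 / 4) * (sqrt ?L * sqrt (real n * f_nK n K (real u)) * (real K / (real n - real K)))"
    by (simp only: real_sqrt_mult mult_ac)
  also have "\<dots> \<le> (1 + exp 1) / (sqrt 2 * exp 1) * (sqrt ?L * sqrt (real n * f_nK n K (real u)) * (real K / (real n - real K)))"
  proof (rule mult_right_mono[OF c])
    have "0 \<le> ?L" using L l0 by linarith
    moreover have "0 \<le> real n * f_nK n K (real u)" using f_nK_ge by (meson of_nat_0_le_iff order_trans)
    ultimately show "0 \<le> sqrt ?L * sqrt (real n * f_nK n K (real u)) * (real K / (real n - real K))"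
      using n by (intro mult_nonneg_nonneg divide_nonneg_nonneg) auto
  qed
  also have "\<dots> = A_nK n K u" unfolding A_nK_eq by (simp only: mult_ac)
  finally show ?thesis by simp
qed

lemma A_nK_le: "A_nK n K u \<le> 1 / (1 - real K / real n) * sqrt (ln (17 * real K)) * real K / sqrt (real n)"
proof -
  let ?l = "1 + (1 + sqrt (8 * pi)) * sqrt (2 * pi)"
  have p: "0 < 1 - real K / real n" using n by simp
  have c: "(1 + exp 1) / (sqrt 2 * exp (1 :: real)) \<le> 1"
  proof -
    \<comment> \<open>The claim amounts to sqrt 2 \<ge> 1 + 1 / e, about 1.37.\<close>
    have "(7 / 5 :: real) \<le> sqrt 2" by (rule real_le_rsqrt) (simp add: power2_eq_square)
    then have "7 / 5 * exp 1 \<le> sqrt 2 * exp (1 :: real)" by (intro mult_right_mono) auto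
    then have "1 + exp 1 \<le> sqrt 2 * exp (1 :: real)" using exp_1_bounds by linarith
    then show ?thesis by simp
  qed
  have lK: "0 \<le> ln (real K * ?l)"
  proof -
    have "1 * 1 \<le> real K * ?l" using K maximal_const_bounds by (intro mult_mono) auto
    then show ?thesis by simp
  qed
  have ll: "ln (real K * ?l) \<le> ln (17 * real K)"
  proof (rule ln_mono)
    show "0 < real K * ?l" using K maximal_const_bounds by (intro mult_pos_pos) auto
    show "real K * ?l \<le> 17 * real K" using mult_left_mono[OF maximal_const_bounds(2), of "real K"] by simp
  qed
  have "A_nK n K u = ((1 + exp 1) / (sqrt 2 * exp 1) * sqrt (ln (real K * ?l)) * sqrt (f_nK n K (real u))) * (1 / (1 - real K / real n) * real K / sqrt (real n))"
    unfolding A_nK_def by simp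
  also have "\<dots> \<le> (1 * sqrt (ln (17 * real K)) * 1) * (1 / (1 - real K / real n) * real K / sqrt (real n))"
  proof (intro mult_right_mono)
    have f0: "0 \<le> f_nK n K (real u)"
    proof -
      have "0 \<le> real n * f_nK n K (real u)" using f_nK_ge by (meson of_nat_0_le_iff order_trans)
      then show ?thesis using n by (simp add: zero_le_mult_iff)
    qed
    show "(1 + exp 1) / (sqrt 2 * exp 1) * sqrt (ln (real K * ?l)) * sqrt (f_nK n K (real u)) \<le> 1 * sqrt (ln (17 * real K)) * 1"
      using c ll lK f_nK_le_1 f0 by (intro mult_mono real_sqrt_le_mono mult_nonneg_nonneg) auto
    show "0 \<le> 1 / (1 - real K / real n) * real K / sqrt (real n)" using p by simp
  qed
  finally show ?thesis by (simp add: mult_ac)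
qed

lemma B_count: "real u + real_of_int \<lceil>(real n - real u * real K) / 2\<rceil> - real_of_int \<lfloor>real n / real K\<rfloor> + 1
    = real (u + (n - u * K + 1) div 2) - real (n div K) + 1"
proof -
  define q where "q = n - u * K"
  have "real n - real u * real K = real q" unfolding q_def using u_K by (simp add: of_nat_diff)
  moreover have "\<lceil>real q / 2\<rceil> = int ((q + 1) div 2)"
  proof (rule ceiling_unique)
    have e: "2 * ((q + 1) div 2) = q \<or> 2 * ((q + 1) div 2) = q + 1" by presburger
    then have "2 * real ((q + 1) div 2) = real q \<or> 2 * real ((q + 1) div 2) = real q + 1"
      by (metis of_nat_mult of_nat_numeral of_nat_add of_nat_1)
    then show "real_of_int (int ((q + 1) div 2)) - 1 < real q / 2" "real q / 2 \<le> real_of_int (int ((q + 1) div 2))"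
      by auto
  qed
  moreover have "\<lfloor>real n / real K\<rfloor> = int (n div K)" by (rule floor_divide_of_nat_eq)
  ultimately show ?thesis by (simp add: q_def)
qed

lemma lo_le_hi: "n div K \<le> u + (n - u * K + 1) div 2"
proof -
  define q where "q = n - u * K"
  have q: "n = u * K + q" using u_K by (simp add: q_def)
  have "n div K = u + q div K" using K by (simp add: q)
  also have "q div K \<le> q div 2" using K by (intro div_le_mono2) auto
  also have "q div 2 \<le> (q + 1) div 2" by (rule div_le_mono) simp
  finally show ?thesis by (simp add: q_def)
qed

lemma B_nK_eq: "B_nK n K u = sqrt ((1 + exp 1) / (2 * exp 1) *
    ln (real K * (real (u + (n - u * K + 1) div 2) - real (n div K) + 1) * (1 + sqrt (8 * pi))) * (real K / (real n - real K)))"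
proof -
  have n0: "0 < real n" "0 < real n - real K" using n by auto
  have "1 - real K / real n = (real n - real K) / real n" using n0 by (simp add: diff_divide_distrib)
  then have "x / (2 * exp 1 * (1 - real K / real n)) * l * real K / real n = x / (2 * exp 1) * l * (real K / (real n - real K))" for x l :: real
    using n0 by simp
  then show ?thesis unfolding B_nK_def B_count by simp
qed

text \<open>The slack lies in 1/2 against (1 + e) / (2 e) and in 2 e, about 5.44, against 1 + sqrt
  (8 pi), about 6.01.\<close>

lemma union_bound_le_B_nK:
  "sqrt ((1 + ln (2 * real (K * (u + (n - u * K + 1) div 2 - n div K + 1)))) / (2 * real (n div K))) \<le> B_nK n K u"
proof -
  define M where "M = real (K * (u + (n - u * K + 1) div 2 - n div K + 1))"
  have M: "M = real K * (real (u + (n - u * K + 1) div 2) - real (n div K) + 1)"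
  proof -
    have "real (K * (h - l + 1)) = real K * (real h - real l + 1)" if "l \<le> h" for h l :: nat
      using that by (simp only: of_nat_mult of_nat_add of_nat_diff of_nat_1)
    then show ?thesis unfolding M_def using lo_le_hi by blast
  qed
  have M1: "1 \<le> M"
  proof -
    have "1 \<le> K * (u + (n - u * K + 1) div 2 - n div K + 1)" using K by simp
    then show ?thesis unfolding M_def by linarith
  qed
  have L: "1 + ln (2 * M) \<le> ln (M * (1 + sqrt (8 * pi)))"
  proof -
    have "1 + ln (2 * M) = ln (exp 1 * (2 * M))" using M1 by (simp add: ln_mult)
    also have "\<dots> \<le> ln (M * (1 + sqrt (8 * pi)))"
    proof (rule ln_mono)
      have "exp 1 * 2 \<le> 1 + sqrt (8 * pi)" using exp_1_bounds sqrt_8pi_bounds by linarith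
      then have "M * (exp 1 * 2) \<le> M * (1 + sqrt (8 * pi))" using M1 by (intro mult_left_mono) auto
      then show "exp 1 * (2 * M) \<le> M * (1 + sqrt (8 * pi))" by (simp add: mult_ac)
    qed (use M1 in auto)
    finally show ?thesis .
  qed
  have l0: "0 \<le> 1 + ln (2 * M)" using M1 by simp
  have "(1 + ln (2 * M)) / (2 * real (n div K)) = 1 / 2 * (1 + ln (2 * M)) * (1 / real (n div K))" by simp
  also have "\<dots> \<le> (1 + exp 1) / (2 * exp 1) * ln (M * (1 + sqrt (8 * pi))) * (real K / (real n - real K))"
  proof (intro mult_mono inverse_lo L)
    show "1 / 2 \<le> (1 + exp 1) / (2 * exp (1 :: real))" by (simp add: field_simps)
    show "0 \<le> (1 + exp 1) / (2 * exp 1) * ln (M * (1 + sqrt (8 * pi)))" using L l0 by (intro mult_nonneg_nonneg) auto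
  qed (use l0 in auto)
  finally show ?thesis unfolding B_nK_eq M_def[symmetric] M[symmetric] by (rule real_sqrt_le_mono)
qed

lemma round_count_bound:
  fixes u' uK h x l y :: real
  assumes "u' * 2 \<le> uK" "h \<le> (x - uK) / 2 + 1 / 2" "y - 1 \<le> l"
  shows "u' + h - l + 1 \<le> 3 + x / 2 - y"
  using assms by (simp add: field_simps)

lemma B_nK_le: "B_nK n K u \<le> sqrt (1 / (1 - real K / real n)
    * ln (6.02 * real K * (3 + real n / 2 - real n / real K)) * real K / real n)"
proof -
  define N where "N = real (u + (n - u * K + 1) div 2) - real (n div K) + 1"
  have N1: "1 \<le> N" using lo_le_hi by (simp add: N_def)
  have N3: "N \<le> 3 + real n / 2 - real n / real K"
  proof -
    have lo: "real n / real K - 1 \<le> real (n div K)"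
      using div_K_lower[of K n] K by (simp add: field_simps)
    have "real u * 2 \<le> real u * real K" using K by (intro mult_left_mono) auto
    then show ?thesis using half_up lo unfolding N_def of_nat_add
      by (rule round_count_bound)
  qed
  have n0: "0 < real n" "0 < real n - real K" using n by auto
  have l0: "0 \<le> ln (real K * N * (1 + sqrt (8 * pi)))"
  proof -
    have "1 * 1 * 1 \<le> real K * N * (1 + sqrt (8 * pi))" using K N1 by (intro mult_mono) auto
    then show ?thesis by simp
  qed
  have ll: "ln (real K * N * (1 + sqrt (8 * pi))) \<le> ln (6.02 * real K * (3 + real n / 2 - real n / real K))"
  proof (rule ln_mono)
    have "real K * N * (1 + sqrt (8 * pi)) \<le> real K * (3 + real n / 2 - real n / real K) * 6.02"
      using N3 N1 sqrt_8pi_bounds K by (intro mult_mono) auto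
    then show "real K * N * (1 + sqrt (8 * pi)) \<le> 6.02 * real K * (3 + real n / 2 - real n / real K)" by (simp only: mult_ac)
    show "0 < real K * N * (1 + sqrt (8 * pi))" using K N1 by (intro mult_pos_pos) (auto simp: add_pos_nonneg)
  qed
  have "B_nK n K u = sqrt ((1 + exp 1) / (2 * exp 1) * ln (real K * N * (1 + sqrt (8 * pi))) * (real K / (real n - real K)))"
    unfolding B_nK_eq N_def ..
  also have "\<dots> \<le> sqrt (1 * ln (6.02 * real K * (3 + real n / 2 - real n / real K)) * (real K / (real n - real K)))"
    using ll l0 n0 by (intro real_sqrt_le_mono mult_mono) (auto simp: field_simps)
  also have "1 * ln (6.02 * real K * (3 + real n / 2 - real n / real K)) * (real K / (real n - real K))
     = 1 / (1 - real K / real n) * ln (6.02 * real K * (3 + real n / 2 - real n / real K)) * real K / real n"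
  proof -
    have "1 - real K / real n = (real n - real K) / real n" using n0 by (simp add: diff_divide_distrib)
    then show ?thesis using n0 by simp
  qed
  finally show ?thesis .
qed

end

lemma sum_powr_le:
  fixes s :: real
  assumes s: "0 < s" and R: "finite R" "\<And>r. r \<in> R \<Longrightarrow> 1 \<le> r"
  shows "(\<Sum>r\<in>R. 1 / real r powr (1 + s)) \<le> 1 + 1 / s"
proof -
  have main: "(\<Sum>r\<in>{1..Suc N}. 1 / real r powr (1 + s)) \<le> 1 + 1 / s - 1 / s * real (Suc N) powr (- s)" for N
  proof (induction N)
    case (Suc N)
    define x where "x = real (Suc (Suc N))"
    have x: "1 < x" "real (Suc N) = x * (1 - 1 / x)" by (auto simp: x_def field_simps)
    have x1: "0 < 1 - 1 / x" using x(1) by simp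
    \<comment> \<open>Multiplied by x^(-s), this reads x^(-1-s) \<le> ((x - 1)^(-s) - x^(-s)) / s, a
      discrete form of comparing the sum with the integral; the right side telescopes.\<close>
    have "1 + s * (1 / x) \<le> (1 - 1 / x) powr (- s)"
    proof -
      have "ln (1 - 1 / x) \<le> - (1 / x)" using ln_add_one_self_le_self2[of "- (1 / x)"] x1 by simp
      then have "s * (1 / x) \<le> s * - ln (1 - 1 / x)" using s by (intro mult_left_mono) auto
      then have "1 + s * (1 / x) \<le> exp (- s * ln (1 - 1 / x))"
        using exp_ge_add_one_self[of "- s * ln (1 - 1 / x)"] by simp
      then show ?thesis using x1 x(1) by (simp add: powr_def)
    qed
    then have "x powr (- s) * (1 + s * (1 / x)) \<le> x powr (- s) * (1 - 1 / x) powr (- s)" by (rule mult_left_mono) simp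
    also have "\<dots> = real (Suc N) powr (- s)" unfolding x(2) using x(1) x1 by (subst powr_mult) auto
    finally have "s * (x powr (- s) * (1 / x)) \<le> real (Suc N) powr (- s) - x powr (- s)" by (simp add: algebra_simps)
    moreover have "x powr (- s) * (1 / x) = 1 / x powr (1 + s)"
      using x(1) by (simp add: powr_minus powr_add divide_inverse mult.commute)
    ultimately have "s * (1 / x powr (1 + s)) \<le> real (Suc N) powr (- s) - x powr (- s)" by (simp only:)
    moreover have "t \<le> 1 / s * p - 1 / s * q" if "s * t \<le> p - q" for t p q using that s by (simp add: field_simps)
    ultimately have "1 / x powr (1 + s) \<le> 1 / s * real (Suc N) powr (- s) - 1 / s * x powr (- s)" by blast
    moreover have "(\<Sum>r\<in>{1..Suc (Suc N)}. 1 / real r powr (1 + s)) = (\<Sum>r\<in>{1..Suc N}. 1 / real r powr (1 + s)) + 1 / x powr (1 + s)"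
      by (simp add: x_def)
    ultimately show ?case using Suc.IH unfolding x_def[symmetric] by linarith
  qed simp
  obtain N where N: "R \<subseteq> {1..Suc N}"
  proof -
    have "R \<subseteq> {1..Suc (Max R)}" using R by (auto simp: le_SucI)
    then show ?thesis using that by blast
  qed
  have "(\<Sum>r\<in>R. 1 / real r powr (1 + s)) \<le> (\<Sum>r\<in>{1..Suc N}. 1 / real r powr (1 + s))"
    using N by (intro sum_mono2) auto
  also have "\<dots> \<le> 1 + 1 / s - 1 / s * real (Suc N) powr (- s)" by (rule main)
  also have "\<dots> \<le> 1 + 1 / s" using s by simp
  finally show ?thesis .
qed

lemma C_nK_le:
  assumes K: "2 \<le> K" and n: "K < n" and \<eta>: "0 < \<eta>" and R: "finite R" "\<And>r. r \<in> R \<Longrightarrow> 1 \<le> r"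
  shows "C_nK n K \<eta> R \<le> min (C1_nK n K \<eta> * (2 * (1 + \<eta>) / \<eta>)) (C2_nK n K \<eta> * (\<Sum>r\<in>R. real r powr (- (1 + \<eta>) / 2)))"
  unfolding C_nK_def
proof (rule min.mono)
  have "(\<Sum>r\<in>R. 1 / real r powr (1 + \<eta> / (2 + \<eta>))) \<le> 1 + 1 / (\<eta> / (2 + \<eta>))"
    using \<eta> R by (intro sum_powr_le) auto
  also have "\<dots> = 2 * (1 + \<eta>) / \<eta>" using \<eta> by (simp add: field_simps)
  finally show "C1_nK n K \<eta> * (\<Sum>r\<in>R. 1 / real r powr (1 + \<eta> / (2 + \<eta>))) \<le> C1_nK n K \<eta> * (2 * (1 + \<eta>) / \<eta>)"
    by (rule mult_left_mono) (simp add: C1_nK_def)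
  have "- (1 + \<eta>) / 2 = - ((1 + \<eta>) / 2)" by (rule minus_divide_left[symmetric])
  then show "C2_nK n K \<eta> * (\<Sum>r\<in>R. 1 / real r powr ((1 + \<eta>) / 2)) \<le> C2_nK n K \<eta> * (\<Sum>r\<in>R. real r powr (- (1 + \<eta>) / 2))"
    by (simp only: powr_minus_divide order_refl)
qed

text \<open>Uses (1 + y)^2 \<le> 2 (1 + y^2) and 16 pi / e \<le> 18.5.\<close>

lemma C1_nK_le:
  assumes \<eta>: "0 < \<eta>"
  shows "C1_nK n K \<eta> * (2 * (1 + \<eta>) / \<eta>)
         \<le> (1 + 18.5 * (real K)\<^sup>2 / \<eta>) / ((sqrt (real n) * real K) powr (1 + \<eta> / (2 + \<eta>))) * (4 * (1 + \<eta>) / \<eta>)"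
proof -
  define y where "y = real K * sqrt (16 * pi / (\<eta> * exp 1))"
  define q where "q = (sqrt (real n) * real K) powr (1 + \<eta> / (2 + \<eta>))"
  have q0: "0 \<le> q" by (simp add: q_def)
  have y2: "y\<^sup>2 \<le> 18.5 * (real K)\<^sup>2 / \<eta>"
  proof -
    have "16 * pi \<le> 18.5 * exp 1" using pi_approx exp_1_bounds by simp
    then have "16 * pi / exp 1 \<le> 18.5" by (simp add: pos_divide_le_eq)
    then have "(real K)\<^sup>2 / \<eta> * (16 * pi / exp 1) \<le> (real K)\<^sup>2 / \<eta> * 18.5" using \<eta> by (intro mult_left_mono) auto
    moreover have "y\<^sup>2 = (real K)\<^sup>2 / \<eta> * (16 * pi / exp 1)" using \<eta> by (simp add: y_def power_mult_distrib)
    ultimately show ?thesis by simp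
  qed
  have "(1 + y)\<^sup>2 \<le> 2 * (1 + y\<^sup>2)" using zero_le_power2[of "1 - y"] by (simp add: power2_eq_square algebra_simps)
  also have "\<dots> \<le> 2 * (1 + 18.5 * (real K)\<^sup>2 / \<eta>)" by (intro mult_left_mono add_left_mono y2) simp
  finally have "(1 + y)\<^sup>2 \<le> 2 * (1 + 18.5 * (real K)\<^sup>2 / \<eta>)" .
  then have "(1 + y)\<^sup>2 / q * (2 * (1 + \<eta>) / \<eta>) \<le> 2 * (1 + 18.5 * (real K)\<^sup>2 / \<eta>) / q * (2 * (1 + \<eta>) / \<eta>)"
    using q0 \<eta> by (intro mult_right_mono divide_right_mono) auto
  moreover have "2 * x / q * (2 * z / \<eta>) = x / q * (4 * z / \<eta>)" for x z by simp
  ultimately have "(1 + y)\<^sup>2 / q * (2 * (1 + \<eta>) / \<eta>) \<le> (1 + 18.5 * (real K)\<^sup>2 / \<eta>) / q * (4 * (1 + \<eta>) / \<eta>)"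
    by (simp only:)
  then show ?thesis unfolding C1_nK_def y_def q_def .
qed

lemma C1_nK_le_powr:
  assumes K: "2 \<le> K" and n: "K < n" and \<eta>: "0 < \<eta>"
  shows "(1 + 18.5 * (real K)\<^sup>2 / \<eta>) / ((sqrt (real n) * real K) powr (1 + \<eta> / (2 + \<eta>))) * (4 * (1 + \<eta>) / \<eta>)
         \<le> real K powr (1 - 3 * \<eta> / (4 + 2 * \<eta>)) / sqrt (real n) * (4 * (1 + 18.5 / \<eta>)\<^sup>2)"
proof -
  \<comment> \<open>2 s is the excess of the exponent over 1. The quotient in \<open>pw\<close> is
    K^(1 - 2 s) n^(-1/2 - s), and n > K allows n^(-s) to be replaced by K^(-s).\<close>
  define s where "s = \<eta> / (4 + 2 * \<eta>)"
  define c where "c = 1 + 18.5 / \<eta>"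
  have s: "0 < s" "\<eta> / (2 + \<eta>) = 2 * s" "3 * \<eta> / (4 + 2 * \<eta>) = 3 * s"
  proof -
    have e: "4 + 2 * \<eta> = 2 * (2 + \<eta>)" by simp
    show "0 < s" "3 * \<eta> / (4 + 2 * \<eta>) = 3 * s" using \<eta> by (simp_all add: s_def)
    have "x / y = 2 * (x / (2 * y))" for x y :: real by simp
    then show "\<eta> / (2 + \<eta>) = 2 * s" unfolding s_def e .
  qed
  have c: "0 \<le> c" "(1 + \<eta>) / \<eta> \<le> c" using \<eta> by (auto simp: c_def field_simps)
  have K0: "1 \<le> real K" "0 < real K" "0 < real n" using K n by auto
  have lnKn: "ln (real K) \<le> ln (real n)" using K n by simp
  have k2: "1 + 18.5 * (real K)\<^sup>2 / \<eta> \<le> (real K)\<^sup>2 * c"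
  proof -
    have "1 \<le> (real K)\<^sup>2" using K0 by simp
    then show ?thesis by (simp add: c_def algebra_simps)
  qed
  have pw: "(real K)\<^sup>2 / (sqrt (real n) * real K) powr (1 + 2 * s) \<le> real K powr (1 - 3 * s) / sqrt (real n)"
  proof -
    have l: "ln (sqrt (real n) * real K) = ln (real n) / 2 + ln (real K)" using K0 by (simp add: ln_mult ln_sqrt)
    have "(real K)\<^sup>2 / (sqrt (real n) * real K) powr (1 + 2 * s) = exp (2 * ln (real K) - (1 + 2 * s) * (ln (real n) / 2 + ln (real K)))"
    proof -
      have "(real K)\<^sup>2 = exp (ln (real K)) * exp (ln (real K))" using K0 by (simp add: power2_eq_square)
      then have "(real K)\<^sup>2 = exp (2 * ln (real K))" by (simp only: mult_2 exp_add)
      moreover have "(sqrt (real n) * real K) powr (1 + 2 * s) = exp ((1 + 2 * s) * ln (sqrt (real n) * real K))"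
        using K0 by (simp add: powr_def)
      ultimately show ?thesis unfolding l by (simp only: exp_diff)
    qed
    also have "\<dots> \<le> exp ((1 - 3 * s) * ln (real K) - ln (real n) / 2)"
    proof -
      have "s * ln (real K) \<le> s * ln (real n)" using lnKn s by (intro mult_left_mono) auto
      then show ?thesis by (simp add: algebra_simps)
    qed
    also have "\<dots> = real K powr (1 - 3 * s) / sqrt (real n)"
    proof -
      have "sqrt (real n) = exp (ln (sqrt (real n)))" using K0 by simp
      then have "sqrt (real n) = exp (ln (real n) / 2)" using K0 by (simp only: ln_sqrt)
      moreover have "real K powr (1 - 3 * s) = exp ((1 - 3 * s) * ln (real K))" using K0 by (simp add: powr_def)
      ultimately show ?thesis by (simp only: exp_diff)
    qed
    finally show ?thesis .
  qed
  have "(1 + 18.5 * (real K)\<^sup>2 / \<eta>) / (sqrt (real n) * real K) powr (1 + 2 * s) * (4 * ((1 + \<eta>) / \<eta>))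
      \<le> ((real K)\<^sup>2 * c) / (sqrt (real n) * real K) powr (1 + 2 * s) * (4 * c)"
    using k2 c(2) \<eta> by (intro mult_mono divide_right_mono mult_left_mono) (auto simp: c(1))
  also have "\<dots> = ((real K)\<^sup>2 / (sqrt (real n) * real K) powr (1 + 2 * s)) * (4 * c\<^sup>2)" by (simp add: power2_eq_square)
  also have "\<dots> \<le> real K powr (1 - 3 * s) / sqrt (real n) * (4 * c\<^sup>2)"
    using c by (intro mult_right_mono pw) auto
  finally have "(1 + 18.5 * (real K)\<^sup>2 / \<eta>) / (sqrt (real n) * real K) powr (1 + 2 * s) * (4 * ((1 + \<eta>) / \<eta>))
      \<le> real K powr (1 - 3 * s) / sqrt (real n) * (4 * c\<^sup>2)" .
  then show ?thesis unfolding s(2,3) c_def[symmetric] by simp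
qed

section \<open>The bounds applied to the experiment\<close>

context elimination_experiment
begin

lemma width_facts:
  assumes r: "r \<in> R"
  shows "0 < width r" "real r * (width r)\<^sup>2 = (1 + \<eta>) * (0.5 * ln (real n) + ln (real r * real K))"
proof -
  have r1: "1 \<le> real r" using R_ge_1[OF r] by simp
  have "1 * 2 \<le> real r * real K" using r1 K2 by (intro mult_mono) auto
  then have "0 < ln (real r * real K)" by simp
  moreover have "0 \<le> ln (real n)" using n_gt by simp
  ultimately have v: "0 < (1 + \<eta>) / real r * (0.5 * ln (real n) + ln (real r * real K))"
    using eta_pos r1 by (intro mult_pos_pos divide_pos_pos add_nonneg_pos) auto
  then show "0 < width r" by (simp add: width_def)
  have "(width r)\<^sup>2 = (1 + \<eta>) / real r * (0.5 * ln (real n) + ln (real r * real K))"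
    unfolding width_def using v by (intro real_sqrt_pow2) simp
  then show "real r * (width r)\<^sup>2 = (1 + \<eta>) * (0.5 * ln (real n) + ln (real r * real K))"
    using r1 by simp
qed

lemma sum_bad_event_le_C_nK:
  assumes j0: "j0 \<in> {1..m}"
  shows "(\<Sum>r\<in>R. measure (table_measure cells) (bad_event K n (A j0) r (width r))) \<le> C_nK n K \<eta> R"
proof -
  have AK: "A j0 \<subseteq> {1..K}" by (rule A_sub[OF j0])
  have A0: "A j0 \<noteq> {}" using A_ne j0 by blast
  have "\<exists>l\<in>{1..m}. l \<noteq> j0" using m_bounds by (intro bexI[of _ "if j0 = 1 then 2 else 1"]) auto
  then obtain l where l: "l \<in> {1..m}" "l \<noteq> j0" by blast
  have "A l \<subseteq> {1..K} - A j0" using A_sub[OF l(1)] A_disj l j0 by blast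
  moreover have "A l \<noteq> {}" using A_ne l by blast
  ultimately have A1: "{1..K} - A j0 \<noteq> {}" by blast
  have n0: "0 < real n" "0 < real K" using n_gt K2 by auto
  \<comment> \<open>Taking \<kappa> = \<eta> / 2 gives the exponent (1 + \<eta>) / (1 + \<eta> / 2)
    = 1 + \<eta> / (2 + \<eta>) and turns 8 pi / \<kappa> into 16 pi / \<eta>.\<close>
  have 1: "measure (table_measure cells) (bad_event K n (A j0) r (width r)) \<le> C1_nK n K \<eta> * (1 / real r powr (1 + \<eta> / (2 + \<eta>)))"
    if r: "r \<in> R" for r
  proof -
    have r0: "0 < real r" "0 < r" using R_ge_1[OF r] by auto
    define L where "L = ln (real n) / 2 + ln (real K)"
    define q where "q = 1 + \<eta> / (2 + \<eta>)"
    have q: "(1 + \<eta>) / (1 + \<eta> / 2) = q" unfolding q_def using eta_pos by (simp add: field_simps)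
    have "measure (table_measure cells) (bad_event K n (A j0) r (width r))
      \<le> (1 + real K * sqrt (8 * pi / (\<eta> / 2 * exp 1)))\<^sup>2 * exp (- real r * (width r)\<^sup>2 / (1 + \<eta> / 2))"
      using eta_pos by (intro prob_bad_event_le_indep[OF AK A0 A1 r0(2) R_le[OF r] width_facts(1)[OF r]]) simp
    also have "8 * pi / (\<eta> / 2 * exp 1) = 16 * pi / (\<eta> * exp 1)" using eta_pos by (simp add: field_simps)
    also have "- real r * (width r)\<^sup>2 / (1 + \<eta> / 2) = - (q * L) - q * ln (real r)"
    proof -
      have "- real r * (width r)\<^sup>2 / (1 + \<eta> / 2) = - ((1 + \<eta>) / (1 + \<eta> / 2) * (0.5 * ln (real n) + ln (real r * real K)))"
        using width_facts(2)[OF r] by simp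
      also have "\<dots> = - (q * (0.5 * ln (real n) + ln (real r * real K)))" unfolding q ..
      also have "0.5 * ln (real n) + ln (real r * real K) = L + ln (real r)"
        using r0 n0 by (simp add: L_def ln_mult)
      finally show ?thesis by (simp add: distrib_left)
    qed
    also have "exp (- (q * L) - q * ln (real r)) = 1 / ((sqrt (real n) * real K) powr q) * (1 / real r powr q)"
    proof -
      have "ln (sqrt (real n) * real K) = L" using n0 by (simp add: L_def ln_mult ln_sqrt)
      then have "(sqrt (real n) * real K) powr q = exp (q * L)" using n0 by (simp add: powr_def)
      moreover have "real r powr q = exp (q * ln (real r))" using r0 by (simp add: powr_def)
      ultimately show ?thesis by (simp add: exp_diff exp_minus divide_inverse)
    qed
    finally show ?thesis unfolding C1_nK_def q_def by simp
  qed
  \<comment> \<open>The factor K of the union bound combines with K^(-(1 + \<eta>) / 2) from the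
    width to K^((1 - \<eta>) / 2).\<close>
  have 2: "measure (table_measure cells) (bad_event K n (A j0) r (width r)) \<le> C2_nK n K \<eta> * (1 / real r powr ((1 + \<eta>) / 2))"
    if r: "r \<in> R" for r
  proof -
    have r0: "0 < real r" "0 < r" using R_ge_1[OF r] by auto
    have "measure (table_measure cells) (bad_event K n (A j0) r (width r)) \<le> 2 * real K * exp (- real r * (width r)\<^sup>2 / 2)"
      using width_facts(1)[OF r] by (intro prob_bad_event_le_union[OF AK A0 A1 r0(2) R_le[OF r]]) simp
    also have "\<dots> = 2 * exp (ln (real K) + - real r * (width r)\<^sup>2 / 2)" by (simp only: exp_add exp_ln[OF n0(2)] mult.assoc)
    also have "ln (real K) + - real r * (width r)\<^sup>2 / 2 = (1 - \<eta>) / 2 * ln (real K) - (1 + \<eta>) / 4 * ln (real n) - (1 + \<eta>) / 2 * ln (real r)"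
    proof -
      have "- real r * (width r)\<^sup>2 / 2 = - ((1 + \<eta>) * (0.5 * ln (real n) + ln (real r * real K)) / 2)"
        using width_facts(2)[OF r] by simp
      also have "ln (real r * real K) = ln (real r) + ln (real K)" using r0 n0 by (simp add: ln_mult)
      finally show ?thesis by (simp add: field_simps)
    qed
    also have "2 * exp ((1 - \<eta>) / 2 * ln (real K) - (1 + \<eta>) / 4 * ln (real n) - (1 + \<eta>) / 2 * ln (real r))
        = C2_nK n K \<eta> * (1 / real r powr ((1 + \<eta>) / 2))"
      unfolding C2_nK_def using r0 n0 by (simp add: powr_def exp_diff)
    finally show ?thesis .
  qed
  show ?thesis
    unfolding C_nK_def sum_distrib_left using 1 2 by (intro min.boundedI sum_mono) auto
qed

lemma expectation_sup_dev_le_min: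
  "(\<integral>Z. sup_dev K lo hi Z \<partial>table_measure cells) \<le> min (A_nK n K (Min R)) (B_nK n K (Min R))"
proof -
  have K0: "0 < K" using K2 by simp
  have u: "1 \<le> Min R" using Min_R R_ge_1 by blast
  show ?thesis
    using order_trans[OF expectation_sup_dev_le_maximal[OF K0 lo_hi] maximal_bound_le_A_nK[OF K2 n_gt u R_min]]
      order_trans[OF expectation_sup_dev_le_union[OF K0 lo_hi] union_bound_le_B_nK[OF K2 n_gt u R_min]]
    by (intro min.boundedI)
qed

end

theorem theoremD1:
  fixes a b C \<eta> :: real
    and K m n :: nat
    and D :: "(real \<Rightarrow> real) set"
    and T :: "(real \<Rightarrow> real) \<Rightarrow> real"
    and A :: "nat \<Rightarrow> nat set"
    and MA MnA :: "nat \<Rightarrow> (nat \<Rightarrow> real) set"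
    and R :: "nat set"
  assumes ab: "a < b"
    and K2: "2 \<le> K"
    and D_sub: "D \<subseteq> D_cdf a b" and D_ne: "D \<noteq> {}" and D_convex: "convex_fun_set D"
    and C_pos: "C > 0"
    and T_lip: "\<forall>F\<in>D. \<forall>G\<in>D_cdf a b. \<bar>T F - T G\<bar> \<le> C * sup_norm (\<lambda>x. F x - G x)"
    and T_meas: "\<forall>q::nat. \<forall>\<delta>\<in>unit_simplex q.
        (\<lambda>x. T (\<lambda>z. \<Sum>j\<in>{1..q}. \<delta> j * (if x j \<le> z then 1 else 0)))
          \<in> borel_measurable (PiM {1..q} (\<lambda>_. restrict_space borel {a..b}))"
    and m_bounds: "2 \<le> m" "m \<le> K"
    and A_ne: "\<forall>j\<in>{1..m}. A j \<noteq> {}"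
    and A_disj: "\<forall>j\<in>{1..m}. \<forall>l\<in>{1..m}. j \<noteq> l \<longrightarrow> A j \<inter> A l = {}"
    and A_cover: "(\<Union>j\<in>{1..m}. A j) = {1..K}"
    and MA_ne: "\<forall>j\<in>{1..m}. MA j \<noteq> {}"
    and MA_sub: "\<forall>j\<in>{1..m}. MA j \<subseteq> simplex_on (A j) K"
    and MK_closed: "closed (\<Union>j\<in>{1..m}. MA j)"
    and MK_two: "\<exists>\<delta>\<in>(\<Union>j\<in>{1..m}. MA j). \<exists>\<gamma>\<in>(\<Union>j\<in>{1..m}. MA j). \<delta> \<noteq> \<gamma>"
    and n_gt: "n > K"
    and MnA_fin: "\<forall>j\<in>{1..m}. finite (MnA j)"
    and MnA_ne: "\<forall>j\<in>{1..m}. MnA j \<noteq> {}"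
    and MnA_sub: "\<forall>j\<in>{1..m}. MnA j \<subseteq> MA j"
    and R_sub: "R \<subseteq> {1..n div 2}" and R_ne: "R \<noteq> {}"
    and R_min: "Min R \<le> n div K"
    and eta_pos: "\<eta> > 0"
  shows
    "(\<forall>(P :: (nat \<Rightarrow> real) measure) (F :: nat \<Rightarrow> real \<Rightarrow> real).
        prob_space P
        \<and> sets P = sets (PiM {1..K} (\<lambda>_. restrict_space borel {a..b}))
        \<and> (\<forall>i\<in>{1..K}. F i \<in> D \<and> (\<forall>x. measure P {v \<in> space P. v i \<le> x} = F i x))
      \<longrightarrow>
        integrable (PiM {1..n} (\<lambda>_. P))
          (\<lambda>y. regret K T (\<Union>j\<in>{1..m}. MA j) F (recommend K T A R C \<eta> n m MnA y))
        \<and> (\<integral>y. regret K T (\<Union>j\<in>{1..m}. MA j) F (recommend K T A R C \<eta> n m MnA y)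
               \<partial>(PiM {1..n} (\<lambda>_. P)))
          \<le> disc_err K T D (\<Union>j\<in>{1..m}. MA j) (\<Union>j\<in>{1..m}. MnA j)
             + C * (2 * min (A_nK n K (Min R)) (B_nK n K (Min R)) + C_nK n K \<eta> R))
     \<and> A_nK n K (Min R) \<le> 1 / (1 - real K / real n) * sqrt (ln (17 * real K)) * real K / sqrt (real n)
     \<and> B_nK n K (Min R) \<le> sqrt (1 / (1 - real K / real n)
           * ln (6.02 * real K * (3 + real n / 2 - real n / real K)) * real K / real n)
     \<and> C_nK n K \<eta> R \<le> min (C1_nK n K \<eta> * (2 * (1 + \<eta>) / \<eta>))
                            (C2_nK n K \<eta> * (\<Sum>r\<in>R. real r powr (- (1 + \<eta>) / 2)))
     \<and> C1_nK n K \<eta> * (2 * (1 + \<eta>) / \<eta>)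
         \<le> (1 + 18.5 * (real K)\<^sup>2 / \<eta>) / ((sqrt (real n) * real K) powr (1 + \<eta> / (2 + \<eta>)))
             * (4 * (1 + \<eta>) / \<eta>)
     \<and> (1 + 18.5 * (real K)\<^sup>2 / \<eta>) / ((sqrt (real n) * real K) powr (1 + \<eta> / (2 + \<eta>)))
             * (4 * (1 + \<eta>) / \<eta>)
         \<le> real K powr (1 - 3 * \<eta> / (4 + 2 * \<eta>)) / sqrt (real n) * (4 * (1 + 18.5 / \<eta>)\<^sup>2)"
proof (intro conjI allI impI; (elim conjE)?)
  have finR: "finite R" and R1: "\<And>r. r \<in> R \<Longrightarrow> 1 \<le> r" using R_sub finite_subset by (auto dest: subsetD)
  have u: "1 \<le> Min R" using R1 Min_in[OF finR R_ne] by blast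
  have policy: "elimination_policy a b C \<eta> K m n D T A MA MnA R"
    by unfold_locales (fact assms)+
  show "A_nK n K (Min R) \<le> 1 / (1 - real K / real n) * sqrt (ln (17 * real K)) * real K / sqrt (real n)"
    by (rule A_nK_le[OF K2 n_gt u R_min])
  show "B_nK n K (Min R) \<le> sqrt (1 / (1 - real K / real n)
           * ln (6.02 * real K * (3 + real n / 2 - real n / real K)) * real K / real n)"
    by (rule B_nK_le[OF K2 n_gt u R_min])
  show "C_nK n K \<eta> R \<le> min (C1_nK n K \<eta> * (2 * (1 + \<eta>) / \<eta>))
                            (C2_nK n K \<eta> * (\<Sum>r\<in>R. real r powr (- (1 + \<eta>) / 2)))"
    by (rule C_nK_le[OF K2 n_gt eta_pos finR R1])
  show "C1_nK n K \<eta> * (2 * (1 + \<eta>) / \<eta>)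
         \<le> (1 + 18.5 * (real K)\<^sup>2 / \<eta>) / ((sqrt (real n) * real K) powr (1 + \<eta> / (2 + \<eta>)))
             * (4 * (1 + \<eta>) / \<eta>)"
    by (rule C1_nK_le[OF eta_pos])
  show "(1 + 18.5 * (real K)\<^sup>2 / \<eta>) / ((sqrt (real n) * real K) powr (1 + \<eta> / (2 + \<eta>)))
             * (4 * (1 + \<eta>) / \<eta>)
         \<le> real K powr (1 - 3 * \<eta> / (4 + 2 * \<eta>)) / sqrt (real n) * (4 * (1 + 18.5 / \<eta>)\<^sup>2)"
    by (rule C1_nK_le_powr[OF K2 n_gt eta_pos])
  fix P :: "(nat \<Rightarrow> real) measure" and F :: "nat \<Rightarrow> real \<Rightarrow> real"
  assume P: "prob_space P" "sets P = sets (PiM {1..K} (\<lambda>_. restrict_space borel {a..b}))"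
    "\<forall>i\<in>{1..K}. F i \<in> D \<and> (\<forall>x. measure P {v \<in> space P. v i \<le> x} = F i x)"
  interpret elimination_experiment a b C \<eta> K m n D T A MA MnA R P F
  proof (intro elimination_experiment.intro policy elimination_experiment_axioms.intro)
    show "prob_space P" "sets P = sets (PiM {1..K} (\<lambda>_. restrict_space borel {a..b}))" by (fact P)+
    show "F i \<in> D" "measure P {v \<in> space P. v i \<le> x} = F i x" if "i \<in> {1..K}" for i x
      using P(3) that by blast+
  qed
  let ?reg = "\<lambda>y. regret K T (\<Union>j\<in>{1..m}. MA j) F (recommend K T A R C \<eta> n m MnA y)"
  let ?err = "disc_err K T D (\<Union>j\<in>{1..m}. MA j) (\<Union>j\<in>{1..m}. MnA j)"
  obtain j0 where j0: "j0 \<in> {1..m}" and int: "integrable outcomes ?reg"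
    and le: "(\<integral>y. ?reg y \<partial>outcomes) \<le> ?err + C * (2 * (\<integral>Z. sup_dev K lo hi Z \<partial>table_measure cells)
         + (\<Sum>r\<in>R. measure (table_measure cells) (bad_event K n (A j0) r (width r))))"
    using expected_regret_le by blast
  show "integrable (PiM {1..n} (\<lambda>_. P)) ?reg" by (rule int)
  have "2 * (\<integral>Z. sup_dev K lo hi Z \<partial>table_measure cells) + (\<Sum>r\<in>R. measure (table_measure cells) (bad_event K n (A j0) r (width r)))
      \<le> 2 * min (A_nK n K (Min R)) (B_nK n K (Min R)) + C_nK n K \<eta> R"
    using expectation_sup_dev_le_min sum_bad_event_le_C_nK[OF j0] by (intro add_mono mult_left_mono) auto
  then have "C * (2 * (\<integral>Z. sup_dev K lo hi Z \<partial>table_measure cells) + (\<Sum>r\<in>R. measure (table_measure cells) (bad_event K n (A j0) r (width r))))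
      \<le> C * (2 * min (A_nK n K (Min R)) (B_nK n K (Min R)) + C_nK n K \<eta> R)"
    using C_pos by (intro mult_left_mono) auto
  then show "(\<integral>y. ?reg y \<partial>(PiM {1..n} (\<lambda>_. P))) \<le> ?err + C * (2 * min (A_nK n K (Min R)) (B_nK n K (Min R)) + C_nK n K \<eta> R)"
    using le by linarith
qed

end
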